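(* Let $k=\sum_{n\ge0}\kappa_n\otimes e_n^*$, an $(\ell^2)^*$-valued kernel on the Cantor group $G$. The operator $f\mapsto\mathrm{P.V.}(k*f)$ coincides, for $f\in L^2(G,\ell^2)$, with the map $\iota^{-1}P:L^2(G,\ell^2)\to H^2(\delta)$, i.e. $f=(f_n)\mapsto\sum_n\Delta_nf_n$, and for $f\in L^1(G,\ell^2)$ the principal value exists almost everywhere and defines a bounded operator $L^1(G,\ell^2)\to L^{1,\infty}(G)$ (hence a bounded operator $L^p(G,\ell^2)\to L^p(G)$ for $1<p<\infty$).
   Context: $G=\mathbb{Z}_2^{\mathbb{N}^+}$ with Haar probability measure $\mu$, coordinatewise addition mod 2, identity $\emptyset$, metric $d(x,y)=2^{-\min\{k:x_k\ne y_k\}}$, and $\min x=\min\{k:x_k=1\}$. $\mathcal{F}_n$ is generated by $x_1,\dots,x_n$, $\mathbb{E}_n$ its conditional expectation, $\Delta_0=\mathbb{E}_0$, $\Delta_n=\mathbb{E}_n-\mathbb{E}_{n-1}$. For finite $A\subset\mathbb{N}^+$, $w_A(x)=(-1)^{\sum_{k\in A}x_k}$, $\max\emptyset=0$; $\kappa_n=\sum_{\max A=n}w_A$, i.e. $\kappa_0\equiv1$ and for $n\ge1$, $\kappa_n(x)=2^{n-1}$ if $n<\min x$, $-2^{n-1}$ if $n=\min x$, $0$ if $n>\min x$; thus $\kappa_n*g=\Delta_ng$. $e_n^*$ is the $n$-th coordinate functional on $\ell^2$. $(k*f)(x)=\int_Gk(y)f(x-y)\,d\mu(y)$ and $\mathrm{P.V.}(k*f)(x)=\lim_{r\to0}\int_{G\setminus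 B(\emptyset,r)}k(y)f(x-y)\,d\mu(y)$. $P$ is the orthogonal projection of $L^2(G,\ell^2)$ onto $\{(f_n):\Delta_nf_n=f_n\ \forall n\}$, $\iota(g)=(\Delta_ng)_n$, and $H^2(\delta)=L^2(G)$ with norm $(\mathbb{E}\sum_n|\Delta_ng|^2)^{1/2}$. $L^{1,\infty}(G)$ is weak $L^1$ with quasinorm $\sup_\lambda\lambda\mu\{|g|>\lambda\}$. *)

theory Defs
  imports "HOL-Probability.Probability"
begin

text \<open>The Cantor group Z_2^{N+}. An element is modelled as x :: nat => bool, where the
  paper's coordinate x_k (k >= 1) is x (k - 1). Haar measure = product of fair coins.\<close>

definition cantor :: "(nat \<Rightarrow> bool) measure" where
  "cantor = PiM UNIV (\<lambda>_::nat. measure_pmf (bernoulli_pmf (1/2)))"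

definition gzero :: "nat \<Rightarrow> bool" where
  "gzero = (\<lambda>_. False)"

text \<open>Group operation (coordinatewise addition mod 2); in Z_2, x - y = x + y.\<close>
definition gadd :: "(nat \<Rightarrow> bool) \<Rightarrow> (nat \<Rightarrow> bool) \<Rightarrow> (nat \<Rightarrow> bool)" where
  "gadd x y = (\<lambda>k. x k \<noteq> y k)"

text \<open>min x = min{k >= 1 : x_k = 1} in the paper's indexing (only meaningful for x ~= 0).\<close>
definition cmin :: "(nat \<Rightarrow> bool) \<Rightarrow> nat" where
  "cmin x = Suc (LEAST k. x k)"

definition cdist :: "(nat \<Rightarrow> bool) \<Rightarrow> (nat \<Rightarrow> bool) \<Rightarrow> real" where
  "cdist x y = (if x = y then 0 else (1/2) ^ cmin (gadd x y))"

definition cball :: "(nat \<Rightarrow> bool) \<Rightarrow> real \<Rightarrow> (nat \<Rightarrow> bool) set" where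
  "cball x r = {y. cdist x y < r}"

text \<open>kappa_0 = 1; for n >= 1: 2^(n-1) if n < min x, -2^(n-1) if n = min x, 0 if n > min x
  (with min 0 = infinity).\<close>
definition kappa :: "nat \<Rightarrow> (nat \<Rightarrow> bool) \<Rightarrow> real" where
  "kappa n x = (if n = 0 then 1
     else if x = gzero \<or> n < cmin x then 2 ^ (n - 1)
     else if n = cmin x then - (2 ^ (n - 1)) else 0)"

text \<open>k(y) = sum_n kappa_n(y) e_n^* applied to a vector v of l^2.\<close>
definition kapply :: "(nat \<Rightarrow> bool) \<Rightarrow> (nat \<Rightarrow> real) \<Rightarrow> real" where
  "kapply y v = (\<Sum>n. kappa n y * v n)"

definition ktrunc :: "((nat \<Rightarrow> bool) \<Rightarrow> nat \<Rightarrow> real) \<Rightarrow> (nat \<Rightarrow> bool) \<Rightarrow> real \<Rightarrow> real" where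
  "ktrunc f x r = (LINT y:(space cantor - cball gzero r)|cantor. kapply y (f (gadd x y)))"

definition pv_to :: "((nat \<Rightarrow> bool) \<Rightarrow> nat \<Rightarrow> real) \<Rightarrow> (nat \<Rightarrow> bool) \<Rightarrow> real \<Rightarrow> bool" where
  "pv_to f x c \<longleftrightarrow> ((\<lambda>r. ktrunc f x r) \<longlongrightarrow> c) (at_right 0)"

definition filt :: "nat \<Rightarrow> (nat \<Rightarrow> bool) measure" where
  "filt n = sigma (space cantor) {{x \<in> space cantor. x k} | k. k < n}"

definition Econd :: "nat \<Rightarrow> ((nat \<Rightarrow> bool) \<Rightarrow> real) \<Rightarrow> (nat \<Rightarrow> bool) \<Rightarrow> real" where
  "Econd n g = real_cond_exp cantor (filt n) g"

definition Delta :: "nat \<Rightarrow> ((nat \<Rightarrow> bool) \<Rightarrow> real) \<Rightarrow> (nat \<Rightarrow> bool) \<Rightarrow> real" where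
  "Delta n g = (if n = 0 then Econd 0 g else (\<lambda>x. Econd n g x - Econd (n - 1) g x))"

definition l2norm :: "(nat \<Rightarrow> real) \<Rightarrow> real" where
  "l2norm v = sqrt (\<Sum>n. (v n)\<^sup>2)"

definition Lp_l2_pow :: "real \<Rightarrow> ((nat \<Rightarrow> bool) \<Rightarrow> nat \<Rightarrow> real) \<Rightarrow> ennreal" where
  "Lp_l2_pow p f = (\<integral>\<^sup>+ x. ennreal (l2norm (f x) powr p) \<partial>cantor)"

definition in_Lp_l2 :: "real \<Rightarrow> ((nat \<Rightarrow> bool) \<Rightarrow> nat \<Rightarrow> real) \<Rightarrow> bool" where
  "in_Lp_l2 p f \<longleftrightarrow> (\<forall>n. (\<lambda>x. f x n) \<in> borel_measurable cantor)
     \<and> (AE x in cantor. summable (\<lambda>n. (f x n)\<^sup>2))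
     \<and> Lp_l2_pow p f < \<infinity>"

end

theory Submission
  imports Defs
begin

text \<open>
  Write \<open>E\<^sub>n\<close> for the average over cylinders of length \<open>n\<close> and \<open>F\<close> for the pointwise
  \<open>\<ell>\<^sup>2\<close> norm of \<open>f\<close>. Truncating the kernel outside the ball of level \<open>N\<close> gives
  \<open>S\<^sub>N - R\<^sub>N\<close>, where \<open>S\<^sub>N\<close> is the sum of \<open>\<Delta>\<^sub>n f\<^sub>n\<close> over \<open>n \<le> N\<close> and the remainder
  satisfies \<open>\<bar>R\<^sub>N\<bar> \<le> E\<^sub>N F\<close>.

  The maximal function of \<open>S\<^sub>N\<close> is of weak type (1,1): stop when \<open>E\<^sub>n F\<close> first exceeds
  \<open>\<lambda>\<close>. Since \<open>E\<^sub>n\<^sub>+\<^sub>1 F \<le> 2 E\<^sub>n F\<close>, the stopped function \<open>g\<close> has norm at most \<open>2\<lambda>\<close>, and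
  \<open>\<Delta>\<^sub>n g\<^sub>n = \<Delta>\<^sub>n f\<^sub>n\<close> as long as no stopping has occurred; Doob's inequality in \<open>L\<^sup>2\<close> for
  \<open>g\<close> finishes the estimate. If only finitely many \<open>f\<^sub>n\<close> are nonzero, then \<open>S\<^sub>N\<close> is eventually
  constant and \<open>R\<^sub>N\<close> tends to 0, so the weak type bounds for the tails of \<open>f\<close> give almost
  everywhere convergence in general.

  For \<open>p > 1\<close> the bounds on \<open>S\<^sub>N\<close> are uniform in \<open>N\<close> and pass to the limit by Fatou's lemma. Both
  the case \<open>p < 2\<close>, by duality with a square function estimate for exponents above 2, and the case
  \<open>p > 2\<close>, by Taylor expansion of \<open>\<bar>S\<^sub>N\<bar>\<^sup>p\<close>, rely on the fact that \<open>\<bar>\<Delta>\<^sub>n h\<bar>\<close> depends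
  only on the first \<open>n - 1\<close> coordinates.
\<close>

section \<open>The Cantor group\<close>

text \<open>Each difference acts on its own function, so the partial sums are not those of one
  scalar martingale and no square function of a single function controls them. The substitute is a
  weighted contraction: a nonnegative weight depending on the first \<open>n - 1\<close> coordinates
  commutes with \<open>mdiff n\<close>, hence the weighted square integral of
  \<open>mdiff n h\<close> is at most that of \<open>h\<close>. Summing over \<open>n\<close> then
  costs nothing, because \<open>F\<close> controls all squares together. The indicator of not yet
  being stopped is such a weight. So are powers of the moduli of the differences, and this is where
  the predictability of these moduli pays: jump terms, which a general filtration would produce,
  never appear.

  Averages are defined at every point, so that stopping, adaptedness and running maxima are
  pointwise notions.

  Each strong type estimate ends with the quantity to be bounded (or a comparable one) on both
  sides, with a small coefficient on the right. Subtracting it is legitimate because functions of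
  finitely many coordinates are bounded, so these integrals are finite.\<close>

interpretation coin_product: product_prob_space "\<lambda>_::nat. measure_pmf (bernoulli_pmf (1/2))" UNIV
  by unfold_locales

interpretation cantor: prob_space cantor
  unfolding cantor_def by (rule coin_product.prob_space_axioms)

lemma space_cantor [simp]: "space cantor = UNIV"
  by (simp add: cantor_def space_PiM)

lemma coordinate_measurable [measurable]: "(\<lambda>x. x k) \<in> measurable cantor (count_space UNIV)"
proof -
  have "(\<lambda>x. x k) \<in> measurable cantor (measure_pmf (bernoulli_pmf (1/2)))"
    unfolding cantor_def by (rule measurable_component_singleton) simp
  then show ?thesis
    by (simp add: measurable_def)
qed

definition cylinder :: "nat \<Rightarrow> (nat \<Rightarrow> bool) \<Rightarrow> (nat \<Rightarrow> bool) set" where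
  "cylinder n x = {z. \<forall>k<n. z k = x k}"

lemma cylinder_sets [measurable, simp]: "cylinder n x \<in> sets cantor"
proof -
  have "{z \<in> space cantor. \<forall>k<n. z k = x k} \<in> sets cantor"
    by measurable
  then show ?thesis
    by (simp add: cylinder_def)
qed

lemma measure_cylinder: "measure cantor (cylinder n x) = (1/2) ^ n"
proof -
  have "cylinder n x =
      prod_emb UNIV (\<lambda>_. measure_pmf (bernoulli_pmf (1/2))) {..<n} (Pi\<^sub>E {..<n} (\<lambda>k. {x k}))"
    by (auto simp: cylinder_def prod_emb_def restrict_def PiE_def Pi_def extensional_def)
  then have "measure cantor (cylinder n x) =
      (\<Prod>k<n. measure (measure_pmf (bernoulli_pmf (1/2))) {x k})"
    unfolding cantor_def by (simp add: coin_product.measure_PiM_emb)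
  also have "\<dots> = (\<Prod>k<n. (1/2))"
    by (intro prod.cong) (auto simp: measure_pmf_single pmf_bernoulli_True pmf_bernoulli_False
        split: bool.splits)
  finally show ?thesis by simp
qed

lemma gadd_gadd [simp]: "gadd x (gadd x y) = y"
  by (auto simp: gadd_def)

lemma gadd_measurable [measurable]: "gadd x \<in> measurable cantor cantor"
  unfolding cantor_def
proof (rule measurable_PiM_single')
  fix i :: nat
  have "(\<lambda>w. gadd x w i) \<in> measurable cantor (count_space UNIV)"
    unfolding gadd_def by measurable
  then show "(\<lambda>w. gadd x w i) \<in> measurable (Pi\<^sub>M UNIV (\<lambda>_. measure_pmf (bernoulli_pmf (1/2))))
      (measure_pmf (bernoulli_pmf (1/2)))"
    by (simp add: cantor_def[symmetric] measurable_def)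
qed (auto simp: space_PiM)

text \<open>Invariance of Haar measure. Flipping a coordinate preserves the fair coin, so both
  measures agree on the product sets over finitely many coordinates, which determine them.\<close>

lemma distr_gadd: "distr cantor cantor (gadd x) = cantor"
proof (rule measure_eqI_PiM_infinite[where I=UNIV and M="\<lambda>_. measure_pmf (bernoulli_pmf (1/2))"])
  let ?B = "measure_pmf (bernoulli_pmf (1/2))"
  show "finite_measure (distr cantor cantor (gadd x))"
    by (intro prob_space.finite_measure cantor.prob_space_distr) measurable
  fix A :: "nat \<Rightarrow> bool set" and J :: "nat set"
  assume J: "finite J"
  define A' where "A' i = {b. (x i \<noteq> b) \<in> A i}" for i
  have "emeasure ?B (A' i) = emeasure ?B (A i)" for i
  proof -
    have "A' i = (\<lambda>b. x i \<noteq> b) -` A i" by (auto simp: A'_def)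
    moreover have "map_pmf (\<lambda>b. x i \<noteq> b) (bernoulli_pmf (1/2)) = bernoulli_pmf (1/2)"
    proof (rule pmf_eqI)
      fix b
      \<comment> \<open>\<open>b\<close> is written as the flip of its own flip, so that injectivity
        evaluates the image distribution.\<close>
      have "pmf (map_pmf (\<lambda>b. x i \<noteq> b) (bernoulli_pmf (1/2))) (x i \<noteq> (x i \<noteq> b))
        = pmf (bernoulli_pmf (1/2)) (x i \<noteq> b)"
        by (rule pmf_map_inj') (auto simp: inj_def)
      moreover have "(x i \<noteq> (x i \<noteq> b)) = b" by auto
      ultimately show "pmf (map_pmf (\<lambda>b. x i \<noteq> b) (bernoulli_pmf (1/2))) b
        = pmf (bernoulli_pmf (1/2)) b"
        by (cases "x i \<noteq> b"; cases b) auto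
    qed
    ultimately show ?thesis
      by (metis emeasure_map_pmf)
  qed
  moreover have "gadd x -` (prod_emb UNIV (\<lambda>_. ?B) J (Pi\<^sub>E J A)) = prod_emb UNIV (\<lambda>_. ?B) J (Pi\<^sub>E J A')"
    by (auto simp: prod_emb_def gadd_def A'_def PiE_def Pi_def extensional_def restrict_def)
  moreover have "prod_emb UNIV (\<lambda>_. ?B) J (Pi\<^sub>E J A) \<in> sets cantor"
    unfolding cantor_def using J by (intro sets_PiM_I) auto
  ultimately show "emeasure (distr cantor cantor (gadd x)) (prod_emb UNIV (\<lambda>_. ?B) J (Pi\<^sub>E J A))
      = emeasure cantor (prod_emb UNIV (\<lambda>_. ?B) J (Pi\<^sub>E J A))"
    using J by (simp add: emeasure_distr) (simp add: cantor_def coin_product.emeasure_PiM_emb)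
qed (simp_all add: cantor_def)

section \<open>Functions of finitely many coordinates\<close>

text \<open>Measurability for the first \<open>n\<close> coordinates in pointwise form. Such a
  function has finite range, hence boundedness and integrability come for free; the value type is
  left open so that predicates are covered too.\<close>

definition adapted :: "nat \<Rightarrow> ((nat \<Rightarrow> bool) \<Rightarrow> 'a) \<Rightarrow> bool" where
  "adapted n u \<longleftrightarrow> (\<forall>x y. (\<forall>k<n. x k = y k) \<longrightarrow> u x = u y)"

lemma adaptedD: "adapted n u \<Longrightarrow> (\<And>k. k < n \<Longrightarrow> x k = y k) \<Longrightarrow> u x = u y"
  by (auto simp: adapted_def)

lemma adapted_mono: "adapted m u \<Longrightarrow> m \<le> n \<Longrightarrow> adapted n u"
  by (auto simp: adapted_def)

lemma adapted_const [simp]: "adapted n (\<lambda>_. c)"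
  by (simp add: adapted_def)

lemma adapted_comp: "adapted n u \<Longrightarrow> adapted n (\<lambda>x. \<phi> (u x))"
  unfolding adapted_def by metis

lemma adapted_comp2: "adapted n u \<Longrightarrow> adapted n v \<Longrightarrow> adapted n (\<lambda>x. \<phi> (u x) (v x))"
  unfolding adapted_def by metis

lemma adapted_sum:
  "(\<And>i. i \<in> I \<Longrightarrow> adapted n (u i)) \<Longrightarrow> adapted n (\<lambda>x. \<Sum>i\<in>I. u i x)"
  unfolding adapted_def by (auto intro!: sum.cong)

lemma adapted_all: "(\<And>i. P i \<Longrightarrow> adapted n (u i)) \<Longrightarrow> adapted n (\<lambda>x. \<forall>i. P i \<longrightarrow> u i x)"
  unfolding adapted_def by metis

lemma adapted_indicator_cylinder [simp]:
  "adapted n (indicator (cylinder n x) :: (nat \<Rightarrow> bool) \<Rightarrow> real)"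
  by (auto simp: adapted_def cylinder_def indicator_def)

section \<open>The sigma-algebras of the first coordinates\<close>

lemma space_filt [simp]: "space (filt n) = UNIV"
  by (simp add: filt_def space_measure_of_conv)

lemma sets_filt: "sets (filt n) = sigma_sets UNIV {{x. x k} |k. k < n}"
  by (simp add: filt_def)

lemma subalgebra_filt: "subalgebra cantor (filt n)"
proof -
  have "{{x. x k} |k. k < n} \<subseteq> sets cantor"
  proof safe
    fix k
    have "{x \<in> space cantor. x k} \<in> sets cantor" by measurable
    then show "{x. x k} \<in> sets cantor" by simp
  qed
  then have "sigma_sets (space cantor) {{x. x k} |k. k < n} \<subseteq> sets cantor"
    by (rule sets.sigma_sets_subset)
  then show ?thesis
    by (simp add: subalgebra_def sets_filt)
qed

text \<open>Freezing coordinate \<open>n\<close> at either value leaves a function of the first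
  \<open>n\<close> coordinates, and \<open>u\<close> selects between the two according to a
  generator of \<open>filt (Suc n)\<close>.\<close>

lemma adapted_measurable_filt:
  fixes u :: "(nat \<Rightarrow> bool) \<Rightarrow> real"
  shows "adapted n u \<Longrightarrow> u \<in> borel_measurable (filt n)"
proof (induction n arbitrary: u)
  case 0
  then have "u = (\<lambda>_. u gzero)"
    by (auto simp: adapted_def)
  then show ?case
    by (metis borel_measurable_const)
next
  case (Suc n)
  have sub: "subalgebra (filt (Suc n)) (filt n)"
    by (auto simp: subalgebra_def sets_filt intro!: sigma_sets_mono')
  have m: "(\<lambda>x. u (x(n := b))) \<in> borel_measurable (filt (Suc n))" for b
  proof (rule measurable_from_subalg[OF sub], rule Suc.IH)
    show "adapted n (\<lambda>x. u (x(n := b)))"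
      unfolding adapted_def
    proof (intro allI impI)
      fix x y :: "nat \<Rightarrow> bool" assume "\<forall>k<n. x k = y k"
      then show "u (x(n := b)) = u (y(n := b))"
        by (intro adaptedD[OF Suc.prems]) (auto simp: less_Suc_eq)
    qed
  qed
  have [measurable]: "{x \<in> space (filt (Suc n)). x n} \<in> sets (filt (Suc n))"
    by (auto simp: sets_filt intro!: sigma_sets.Basic)
  have eq: "u = (\<lambda>x. if x n then u (x(n := True)) else u (x(n := False)))"
    by (auto simp: fun_eq_iff fun_upd_idem)
  show ?case
    by (subst eq) (intro measurable_If m, auto simp: sets_filt intro!: sigma_sets.Basic)
qed

lemma adapted_measurable:
  fixes u :: "(nat \<Rightarrow> bool) \<Rightarrow> real"
  shows "adapted n u \<Longrightarrow> u \<in> borel_measurable cantor"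
  using adapted_measurable_filt measurable_from_subalg subalgebra_filt by blast

text \<open>One representative, padded with zeros, for each cylinder of length \<open>n\<close>;
  integrals split into finite sums over them.\<close>

definition heads :: "nat \<Rightarrow> (nat \<Rightarrow> bool) set" where
  "heads n = {w. \<forall>k\<ge>n. \<not> w k}"

lemma finite_heads [simp]: "finite (heads n)"
proof -
  have "heads n \<subseteq> (\<lambda>A k. k \<in> A) ` Pow {..<n}"
  proof
    fix w assume "w \<in> heads n"
    then have "w = (\<lambda>k. k \<in> {k. w k})" "{k. w k} \<in> Pow {..<n}"
      by (auto simp: heads_def not_le[symmetric])
    then show "w \<in> (\<lambda>A k. k \<in> A) ` Pow {..<n}" by blast
  qed
  then show ?thesis
    by (rule finite_subset) simp
qed

lemma sum_heads_indicator: "(\<Sum>w\<in>heads n. indicator (cylinder n w) z) = (1::real)"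
proof -
  have "indicator (cylinder n w) z = (if w = (\<lambda>k. k < n \<and> z k) then 1 else (0::real))"
    if "w \<in> heads n" for w
    using that by (auto simp: heads_def cylinder_def indicator_def fun_eq_iff not_less[symmetric])
  then have "(\<Sum>w\<in>heads n. indicator (cylinder n w) z) =
      (\<Sum>w\<in>heads n. if w = (\<lambda>k. k < n \<and> z k) then 1 else (0::real))"
    by (intro sum.cong) auto
  then show ?thesis
    by (simp add: sum.delta) (simp add: heads_def)
qed

lemma adapted_finite_range: assumes "adapted n u" shows "finite (range u)"
proof -
  have "u x = u (\<lambda>k. k < n \<and> x k)" for x
    by (rule adaptedD[OF assms]) auto
  moreover have "(\<lambda>k. k < n \<and> x k) \<in> heads n" for x
    by (simp add: heads_def)
  ultimately have "range u \<subseteq> u ` heads n"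
    by blast
  then show ?thesis
    by (rule finite_subset) simp
qed

lemma adapted_bounded:
  fixes u :: "(nat \<Rightarrow> bool) \<Rightarrow> real"
  assumes "adapted n u" obtains B where "\<And>x. \<bar>u x\<bar> \<le> B"
proof -
  have "finite (range (\<lambda>x. \<bar>u x\<bar>))"
    using adapted_finite_range[OF adapted_comp[OF assms, of abs]] .
  then have "\<And>x. \<bar>u x\<bar> \<le> Max (range (\<lambda>x. \<bar>u x\<bar>))"
    by (intro Max_ge) auto
  then show thesis by (rule that)
qed

lemma adapted_integrable:
  fixes u :: "(nat \<Rightarrow> bool) \<Rightarrow> real"
  assumes "adapted n u" shows "integrable cantor u"
proof -
  obtain B where "\<And>x. \<bar>u x\<bar> \<le> B" using adapted_bounded[OF assms] by blast
  then show ?thesis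
    using adapted_measurable[OF assms] by (intro cantor.integrable_const_bound[of _ B]) auto
qed

lemma adapted_mult_integrable:
  fixes u :: "(nat \<Rightarrow> bool) \<Rightarrow> real"
  assumes "adapted n u" and h: "integrable cantor h" shows "integrable cantor (\<lambda>x. u x * h x)"
proof -
  obtain B where B: "\<And>x. \<bar>u x\<bar> \<le> B" using adapted_bounded[OF assms(1)] by blast
  have [measurable]: "u \<in> borel_measurable cantor" "h \<in> borel_measurable cantor"
    using adapted_measurable[OF assms(1)] h by auto
  show ?thesis
  proof (rule Bochner_Integration.integrable_bound)
    show "integrable cantor (\<lambda>x. B * h x)" using h by simp
    show "AE x in cantor. norm (u x * h x) \<le> norm (B * h x)"
    proof (rule AE_I2)
      fix x
      have "\<bar>u x\<bar> \<le> \<bar>B\<bar>" using B[of x] by linarith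
      then show "norm (u x * h x) \<le> norm (B * h x)"
        by (simp add: abs_mult mult_right_mono)
    qed
  qed measurable
qed

lemma integral_split_heads:
  fixes h :: "(nat \<Rightarrow> bool) \<Rightarrow> real"
  assumes h: "integrable cantor h"
  shows "(\<integral>z. h z \<partial>cantor) = (\<Sum>w\<in>heads n. \<integral>z. h z * indicator (cylinder n w) z \<partial>cantor)"
proof -
  have "(\<integral>z. h z \<partial>cantor) = (\<integral>z. (\<Sum>w\<in>heads n. h z * indicator (cylinder n w) z) \<partial>cantor)"
    by (simp add: sum_distrib_left[symmetric] sum_heads_indicator)
  also have "\<dots> = (\<Sum>w\<in>heads n. \<integral>z. h z * indicator (cylinder n w) z \<partial>cantor)"
    using h by (intro Bochner_Integration.integral_sum integrable_real_mult_indicator) auto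
  finally show ?thesis .
qed

section \<open>Averages over cylinders\<close>

text \<open>The version of the conditional expectation that is defined at every point;
  \<open>2 ^ n\<close> is the reciprocal of the measure of the cylinder.\<close>

definition avg :: "nat \<Rightarrow> ((nat \<Rightarrow> bool) \<Rightarrow> real) \<Rightarrow> (nat \<Rightarrow> bool) \<Rightarrow> real" where
  "avg n h x = 2 ^ n * (\<integral>z. h z * indicator (cylinder n x) z \<partial>cantor)"

lemma adapted_avg [simp]: "m \<le> n \<Longrightarrow> adapted n (avg m h)"
  by (rule adapted_mono[of m]) (auto simp: adapted_def avg_def cylinder_def)

lemma avg_integrable [simp]: "integrable cantor (avg n h)"
  by (rule adapted_integrable[of n]) simp

lemma avg_measurable [measurable]: "avg n h \<in> borel_measurable cantor"
  by (rule adapted_measurable[of n]) simp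

lemma integrable_indicator_cylinder:
  fixes h :: "(nat \<Rightarrow> bool) \<Rightarrow> real"
  shows "integrable cantor h \<Longrightarrow> integrable cantor (\<lambda>z. h z * indicator (cylinder n x) z)"
  by (rule integrable_real_mult_indicator) auto

lemma avg_adapted_mult:
  assumes "adapted n u" shows "avg n (\<lambda>z. u z * h z) x = u x * avg n h x"
proof -
  have "u z * h z * indicator (cylinder n x) z = u x * (h z * indicator (cylinder n x) z)" for z
    using adaptedD[OF assms, of z x] by (auto simp: indicator_def cylinder_def)
  then show ?thesis by (simp only: avg_def) simp
qed

lemma avg_adapted: assumes "adapted n u" shows "avg n u = u"
proof
  fix x
  have "avg n (\<lambda>_. 1) x = 1"
    by (simp add: avg_def measure_cylinder power_mult_distrib[symmetric])
  then show "avg n u x = u x"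
    using avg_adapted_mult[OF assms, of "\<lambda>_. 1" x] by simp
qed

lemma avg_sum:
  "(\<And>i. i \<in> I \<Longrightarrow> integrable cantor (h i)) \<Longrightarrow>
    avg n (\<lambda>x. \<Sum>i\<in>I. h i x) x = (\<Sum>i\<in>I. avg n (h i) x)"
  by (simp add: avg_def sum_distrib_right sum_distrib_left integrable_indicator_cylinder)

lemma avg_cmult: "avg n (\<lambda>x. c * h x) x = c * avg n h x"
  by (rule avg_adapted_mult) simp

lemma avg_mono:
  assumes "integrable cantor g" "integrable cantor h" "AE x in cantor. g x \<le> h x"
  shows "avg n g x \<le> avg n h x"
  unfolding avg_def using assms(3)
  by (intro mult_left_mono integral_mono_AE integrable_indicator_cylinder assms)
    (auto simp: indicator_def elim!: eventually_mono)

lemma avg_nonneg: "(\<And>x. 0 \<le> h x) \<Longrightarrow> 0 \<le> avg n h x"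
  unfolding avg_def by (intro mult_nonneg_nonneg integral_nonneg) (auto simp: indicator_def)

lemma avg_abs_le:
  assumes "integrable cantor h" shows "\<bar>avg n h x\<bar> \<le> avg n (\<lambda>z. \<bar>h z\<bar>) x"
proof -
  have "- avg n h x = avg n (\<lambda>z. - h z) x" using avg_cmult[of n "-1" h x] by simp
  moreover have "avg n (\<lambda>z. - h z) x \<le> avg n (\<lambda>z. \<bar>h z\<bar>) x" "avg n h x \<le> avg n (\<lambda>z. \<bar>h z\<bar>) x"
    using assms by (auto intro!: avg_mono)
  ultimately show ?thesis by linarith
qed

text \<open>Regularity of the dyadic filtration: halving a cylinder doubles the normalising factor
  and cannot increase the integral of a nonnegative function. It limits the overshoot at the
  stopping time.\<close>

lemma avg_Suc_le:
  assumes "integrable cantor h" "\<And>x. 0 \<le> h x" shows "avg (Suc n) h x \<le> 2 * avg n h x"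
proof -
  have "(\<integral>z. h z * indicator (cylinder (Suc n) x) z \<partial>cantor) \<le> (\<integral>z. h z * indicator (cylinder n x) z \<partial>cantor)"
    using assms by (intro integral_mono integrable_indicator_cylinder)
      (auto simp: indicator_def cylinder_def)
  then show ?thesis by (simp add: avg_def)
qed

text \<open>On each cylinder \<open>u\<close> is constant and \<open>avg n h\<close> is the mean of
  \<open>h\<close>, so the integrals agree cylinder by cylinder.\<close>

lemma integral_avg_mult:
  assumes u: "adapted n u" and h: "integrable cantor h"
  shows "(\<integral>x. u x * avg n h x \<partial>cantor) = (\<integral>x. u x * h x \<partial>cantor)"
proof -
  have I: "(\<integral>z. v z \<partial>cantor) = (\<Sum>w\<in>heads n. v w * (1/2) ^ n)" if v: "adapted n v" for v :: "_ \<Rightarrow> real"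
  proof -
    have "(\<integral>z. v z * indicator (cylinder n w) z \<partial>cantor) = v w * (1/2) ^ n" for w
      using fun_cong[OF avg_adapted[OF v], of w] by (simp add: avg_def field_simps)
    then show ?thesis
      using integral_split_heads[OF adapted_integrable[OF v], of n] by simp
  qed
  have "(\<integral>x. u x * avg n h x \<partial>cantor) = (\<Sum>w\<in>heads n. (u w * avg n h w) * (1/2) ^ n)"
    by (rule I, rule adapted_comp2[OF u]) simp
  also have "\<dots> = (\<Sum>w\<in>heads n. (\<integral>x. (u x * h x) * indicator (cylinder n w) x \<partial>cantor))"
  proof (rule sum.cong)
    fix w
    show "(u w * avg n h w) * (1/2) ^ n = (\<integral>x. (u x * h x) * indicator (cylinder n w) x \<partial>cantor)"
      using avg_adapted_mult[OF u, of h w] by (simp add: avg_def field_simps)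
  qed simp
  also have "\<dots> = (\<integral>x. u x * h x \<partial>cantor)"
    using adapted_mult_integrable[OF u h] by (rule integral_split_heads[symmetric])
  finally show ?thesis .
qed

lemma avg_0: "avg 0 h x = (\<integral>z. h z \<partial>cantor)"
  by (simp add: avg_def cylinder_def)

lemma integral_avg: "integrable cantor h \<Longrightarrow> (\<integral>x. avg n h x \<partial>cantor) = (\<integral>x. h x \<partial>cantor)"
  using integral_avg_mult[of n "\<lambda>_. 1" h] by simp

lemma integral_avg_swap:
  assumes g: "integrable cantor g" and h: "integrable cantor h"
  shows "(\<integral>x. g x * avg n h x \<partial>cantor) = (\<integral>x. avg n g x * h x \<partial>cantor)"
  using integral_avg_mult[of n "avg n h" g] integral_avg_mult[of n "avg n g" h] g h
  by (simp add: mult.commute)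

lemma filt_sets_adapted:
  assumes "A \<in> sets (filt n)" shows "adapted n (\<lambda>x. x \<in> A)"
  using assms unfolding sets_filt
proof (induction rule: sigma_sets.induct)
  case (Basic a) then show ?case by (auto simp: adapted_def)
next
  case (Compl a) then show ?case unfolding adapted_def by blast
next
  case (Union a) then show ?case unfolding adapted_def by blast
qed simp

text \<open>The link to the conditional expectation of the theorem: indicators of sets in
  \<open>filt n\<close> are adapted, so \<open>integral_avg_mult\<close> verifies the defining
  identity.\<close>

lemma Econd_eq_avg:
  assumes "integrable cantor h" shows "AE x in cantor. Econd n h x = avg n h x"
proof -
  interpret finite_measure_subalgebra cantor "filt n"
    by unfold_locales (rule subalgebra_filt)
  show ?thesis
    unfolding Econd_def
  proof (rule real_cond_exp_charact)
    fix A assume "A \<in> sets (filt n)"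
    then have "adapted n (\<lambda>x. indicator A x :: real)"
      using adapted_comp[OF filt_sets_adapted, of A n of_bool] by (simp add: indicator_def of_bool_def)
    from integral_avg_mult[OF this assms]
    show "(LINT x:A|cantor. h x) = (LINT x:A|cantor. avg n h x)"
      by (simp add: set_lebesgue_integral_def)
  qed (use assms in \<open>auto intro!: adapted_measurable_filt\<close>)
qed

section \<open>Martingale differences\<close>

definition mdiff :: "nat \<Rightarrow> ((nat \<Rightarrow> bool) \<Rightarrow> real) \<Rightarrow> (nat \<Rightarrow> bool) \<Rightarrow> real" where
  "mdiff n h x = (if n = 0 then avg 0 h x else avg n h x - avg (n - 1) h x)"

lemma adapted_mdiff [simp]: "m \<le> n \<Longrightarrow> adapted n (mdiff m h)"
  unfolding mdiff_def[abs_def] by (cases "m = 0") (auto intro!: adapted_comp2[where \<phi>="(-)"])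

lemma mdiff_integrable [simp]: "integrable cantor (mdiff n h)"
  by (rule adapted_integrable[of n]) simp

lemma mdiff_measurable [measurable]: "mdiff n h \<in> borel_measurable cantor"
  by (rule adapted_measurable[of n]) simp

lemma sum_mdiff: "(\<Sum>k\<le>n. mdiff k h x) = avg n h x"
  by (induction n) (auto simp: mdiff_def)

lemma Delta_eq_mdiff:
  assumes "integrable cantor h" shows "AE x in cantor. Delta n h x = mdiff n h x"
  using Econd_eq_avg[OF assms, of n] Econd_eq_avg[OF assms, of "n - 1"]
  by eventually_elim (auto simp: Delta_def mdiff_def)

lemma adapted_mult:
  fixes u v :: "_ \<Rightarrow> real"
  shows "adapted n u \<Longrightarrow> adapted n v \<Longrightarrow> adapted n (\<lambda>x. u x * v x)"
  by (rule adapted_comp2[where \<phi>="(*)"])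

lemma adapted_add:
  fixes u v :: "_ \<Rightarrow> real"
  shows "adapted n u \<Longrightarrow> adapted n v \<Longrightarrow> adapted n (\<lambda>x. u x + v x)"
  by (rule adapted_comp2[where \<phi>="(+)"])

lemma adapted_diff:
  fixes u v :: "_ \<Rightarrow> real"
  shows "adapted n u \<Longrightarrow> adapted n v \<Longrightarrow> adapted n (\<lambda>x. u x - v x)"
  by (rule adapted_comp2[where \<phi>="(-)"])

lemma adapted_power:
  fixes u :: "_ \<Rightarrow> real"
  shows "adapted n u \<Longrightarrow> adapted n (\<lambda>x. u x ^ k)"
  by (rule adapted_comp[where \<phi>="\<lambda>t. t ^ k"])

lemma adapted_powr:
  fixes u :: "_ \<Rightarrow> real"
  shows "adapted n u \<Longrightarrow> adapted n (\<lambda>x. u x powr p)"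
  by (rule adapted_comp[where \<phi>="\<lambda>t. t powr p"])

lemma adapted_abs:
  fixes u :: "_ \<Rightarrow> real"
  shows "adapted n u \<Longrightarrow> adapted n (\<lambda>x. \<bar>u x\<bar>)"
  by (rule adapted_comp[where \<phi>=abs])

lemmas adapted_intros = adapted_const adapted_mult adapted_add adapted_diff adapted_power
  adapted_powr adapted_abs adapted_sum adapted_avg adapted_mdiff

text \<open>Averages are self-adjoint, hence so are their differences. This moves a difference from
  one factor of a pairing to the other.\<close>

lemma mdiff_swap:
  assumes g: "integrable cantor g" and h: "integrable cantor h"
  shows "(\<integral>x. g x * mdiff n h x \<partial>cantor) = (\<integral>x. mdiff n g x * h x \<partial>cantor)"
proof -
  have i: "integrable cantor (\<lambda>x. g x * avg k h x)" "integrable cantor (\<lambda>x. avg k g x * h x)" for k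
    using adapted_mult_integrable[of k "avg k h" g] adapted_mult_integrable[of k "avg k g" h] g h
    by (simp_all add: mult.commute)
  show ?thesis
    unfolding mdiff_def
    using i integral_avg_swap[OF g h]
    by (cases "n = 0") (simp_all add: right_diff_distrib left_diff_distrib)
qed

lemma mdiff_sum:
  "(\<And>i. i \<in> I \<Longrightarrow> integrable cantor (h i)) \<Longrightarrow>
    mdiff n (\<lambda>x. \<Sum>i\<in>I. h i x) x = (\<Sum>i\<in>I. mdiff n (h i) x)"
  by (simp add: mdiff_def avg_sum sum_subtractf)

lemma integral_mult_mdiff_zero:
  assumes "adapted (n - 1) u" "integrable cantor h" "0 < n"
  shows "(\<integral>x. u x * mdiff n h x \<partial>cantor) = 0"
proof -
  have u: "adapted n u" using assms by (auto intro: adapted_mono)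
  have "(\<integral>x. u x * mdiff n h x \<partial>cantor) = (\<integral>x. u x * avg n h x - u x * avg (n - 1) h x \<partial>cantor)"
    using assms(3) by (simp add: mdiff_def right_diff_distrib)
  also have "\<dots> = (\<integral>x. u x * avg n h x \<partial>cantor) - (\<integral>x. u x * avg (n - 1) h x \<partial>cantor)"
    by (intro Bochner_Integration.integral_diff adapted_mult_integrable[OF u]) auto
  also have "\<dots> = 0"
    using integral_avg_mult[OF u assms(2)] integral_avg_mult[OF assms(1,2)] by simp
  finally show ?thesis .
qed

text \<open>For \<open>m < k\<close> the factor \<open>v\<close> times the indicator of a cylinder
  of length \<open>m\<close> still depends on \<open>k - 1\<close> coordinates, so the orthogonality
  of \<open>mdiff k h\<close> to such functions makes the average vanish.\<close>

lemma avg_mult_mdiff: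
  assumes v: "adapted (k - 1) v" and h: "integrable cantor h"
  shows "avg m (\<lambda>x. v x * mdiff k h x) x = (if k \<le> m then v x * mdiff k h x else 0)"
proof (cases "k \<le> m")
  case True
  have "adapted m v" using v by (rule adapted_mono) (use True in simp)
  then have "adapted m (\<lambda>x. v x * mdiff k h x)"
    using True by (intro adapted_intros)
  then show ?thesis
    using True by (simp add: avg_adapted)
next
  case False
  have "adapted (k - 1) (\<lambda>z. v z * indicator (cylinder m x) z)"
    by (intro adapted_mult v, rule adapted_mono[OF adapted_indicator_cylinder]) (use False in simp)
  from integral_mult_mdiff_zero[OF this h] False show ?thesis
    by (simp add: avg_def mult_ac)
qed

lemma mdiff_mult_mdiff:
  assumes "adapted (k - 1) v" "integrable cantor h"
  shows "mdiff m (\<lambda>x. v x * mdiff k h x) x = (if m = k then v x * mdiff k h x else 0)"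
  unfolding mdiff_def[of m] using avg_mult_mdiff[OF assms] by auto

text \<open>The weight commutes with \<open>mdiff n\<close>, so self-adjointness turns the left side
  into the weighted pairing of \<open>mdiff n h\<close> with \<open>h\<close>; the
  arithmetic-geometric mean inequality then returns half of the left side, which is
  absorbed.\<close>

lemma integral_mult_mdiff_sq_le:
  assumes w: "adapted (n - 1) w" "\<And>x. 0 \<le> w x"
    and [measurable]: "h \<in> borel_measurable cantor" and h2: "integrable cantor (\<lambda>x. (h x)\<^sup>2)"
  shows "(\<integral>x. w x * (mdiff n h x)\<^sup>2 \<partial>cantor) \<le> (\<integral>x. w x * (h x)\<^sup>2 \<partial>cantor)"
proof -
  let ?d = "mdiff n h"
  have h: "integrable cantor h"
    using h2 by (rule cantor.square_integrable_imp_integrable[rotated]) simp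
  have w': "adapted n w" using w(1) by (rule adapted_mono) simp
  have i1: "integrable cantor (\<lambda>x. w x * (?d x)\<^sup>2)"
    by (rule adapted_integrable[of n]) (intro adapted_intros w' order_refl)
  have i2: "integrable cantor (\<lambda>x. w x * (h x)\<^sup>2)"
    using adapted_mult_integrable[OF w(1) h2] .
  have ad: "adapted n (\<lambda>x. w x * ?d x)" by (intro adapted_intros w' order_refl)
  have "(\<integral>x. w x * (?d x)\<^sup>2 \<partial>cantor) = (\<integral>x. (w x * ?d x) * mdiff n h x \<partial>cantor)"
    by (simp add: power2_eq_square mult_ac)
  also have "\<dots> = (\<integral>x. (w x * ?d x) * h x \<partial>cantor)"
    using mdiff_swap[OF adapted_integrable[OF ad] h, of n] mdiff_mult_mdiff[OF w(1) h, of n] by simp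
  also have "\<dots> \<le> (\<integral>x. (1/2) * (w x * (?d x)\<^sup>2) + (1/2) * (w x * (h x)\<^sup>2) \<partial>cantor)"
  proof (rule integral_mono)
    show "integrable cantor (\<lambda>x. w x * ?d x * h x)"
      by (rule adapted_mult_integrable[OF ad h])
    fix x
    have "?d x * h x \<le> (1/2) * (?d x)\<^sup>2 + (1/2) * (h x)\<^sup>2"
      using sum_squares_bound[of "?d x" "h x"] by simp
    from mult_left_mono[OF this w(2)[of x]]
    show "w x * ?d x * h x \<le> (1/2) * (w x * (?d x)\<^sup>2) + (1/2) * (w x * (h x)\<^sup>2)"
      by (simp add: algebra_simps)
  qed (use i1 i2 in simp)
  also have "\<dots> = (1/2) * (\<integral>x. w x * (?d x)\<^sup>2 \<partial>cantor) + (1/2) * (\<integral>x. w x * (h x)\<^sup>2 \<partial>cantor)"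
    using i1 i2 by simp
  finally show ?thesis by simp
qed

lemma avg_halves:
  assumes h: "integrable cantor h"
  shows "avg n h x = (avg (Suc n) h (x(n := True)) + avg (Suc n) h (x(n := False))) / 2"
proof -
  have "indicator (cylinder n x) z = (indicator (cylinder (Suc n) (x(n := True))) z :: real)
      + indicator (cylinder (Suc n) (x(n := False))) z" for z
    by (auto simp: indicator_def cylinder_def less_Suc_eq)
  then have "(\<integral>z. h z * indicator (cylinder n x) z \<partial>cantor)
      = (\<integral>z. h z * indicator (cylinder (Suc n) (x(n := True))) z
          + h z * indicator (cylinder (Suc n) (x(n := False))) z \<partial>cantor)"
    by (simp add: distrib_left)
  then show ?thesis
    by (simp add: avg_def integrable_indicator_cylinder[OF h] field_simps)
qed

text \<open>On the Cantor group the modulus of a martingale difference is predictable, because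
  its two values on the halves of a cylinder are opposite.\<close>
lemma adapted_abs_mdiff:
  assumes h: "integrable cantor h"
  shows "adapted (n - 1) (\<lambda>x. \<bar>mdiff n h x\<bar>)"
proof (cases n)
  case 0
  then show ?thesis
    by (intro adapted_intros) simp
next
  case (Suc m)
  have eq: "\<bar>mdiff n h x\<bar> = \<bar>avg n h (x(m := True)) - avg n h (x(m := False))\<bar> / 2" for x
  proof -
    have "x = x(m := True) \<or> x = x(m := False)"
      by (metis (full_types) fun_upd_triv)
    then have "avg n h x = avg n h (x(m := True)) \<or> avg n h x = avg n h (x(m := False))" by metis
    then show ?thesis
      using avg_halves[OF h, of m x] Suc by (auto simp: mdiff_def abs_if)
  qed
  have same: "avg n h (x(m := b)) = avg n h (y(m := b))" if "\<forall>k<m. x k = y k" for x y b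
    by (rule adaptedD[OF adapted_avg[OF order_refl]]) (use that Suc in \<open>auto simp: less_Suc_eq\<close>)
  have "\<bar>mdiff n h x\<bar> = \<bar>mdiff n h y\<bar>" if "\<forall>k<m. x k = y k" for x y
    unfolding eq by (simp only: same[OF that])
  then show ?thesis
    unfolding adapted_def using Suc by simp
qed

lemma integral_add_mdiff_sq:
  assumes X: "adapted (n - 1) X" and "0 < n" and h: "integrable cantor h"
  shows "(\<integral>x. (X x + mdiff n h x)\<^sup>2 \<partial>cantor)
    = (\<integral>x. (X x)\<^sup>2 \<partial>cantor) + (\<integral>x. (mdiff n h x)\<^sup>2 \<partial>cantor)"
proof -
  have X': "adapted n X" using X by (rule adapted_mono) simp
  have i: "integrable cantor (\<lambda>x. (X x)\<^sup>2)" "integrable cantor (\<lambda>x. (mdiff n h x)\<^sup>2)"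
    "integrable cantor (\<lambda>x. X x * mdiff n h x)"
    by (rule adapted_integrable[of n], intro adapted_intros X' order_refl)+
  have "(\<integral>x. (X x + mdiff n h x)\<^sup>2 \<partial>cantor)
      = (\<integral>x. ((X x)\<^sup>2 + (mdiff n h x)\<^sup>2) + 2 * (X x * mdiff n h x) \<partial>cantor)"
    by (simp add: power2_sum mult_ac)
  also have "\<dots> = (\<integral>x. (X x)\<^sup>2 \<partial>cantor) + (\<integral>x. (mdiff n h x)\<^sup>2 \<partial>cantor)"
    using i integral_mult_mdiff_zero[OF X h \<open>0 < n\<close>] by simp
  finally show ?thesis .
qed

text \<open>The functions \<open>f k\<close> may be unrelated: orthogonality only needs that the sum
  of the earlier terms depends on earlier coordinates.\<close>

lemma integral_sum_mdiff_sq: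
  assumes "\<And>n. integrable cantor (f n)" "m \<le> n"
  shows "(\<integral>x. (\<Sum>k=m..n. mdiff k (f k) x)\<^sup>2 \<partial>cantor)
    = (\<Sum>k=m..n. \<integral>x. (mdiff k (f k) x)\<^sup>2 \<partial>cantor)"
  using assms(2)
proof (induction n rule: dec_induct)
  case base then show ?case by simp
next
  case (step n)
  have "(\<integral>x. ((\<Sum>k=m..n. mdiff k (f k) x) + mdiff (Suc n) (f (Suc n)) x)\<^sup>2 \<partial>cantor)
      = (\<integral>x. (\<Sum>k=m..n. mdiff k (f k) x)\<^sup>2 \<partial>cantor) + (\<integral>x. (mdiff (Suc n) (f (Suc n)) x)\<^sup>2 \<partial>cantor)"
    by (rule integral_add_mdiff_sq) (auto intro!: adapted_sum assms)
  then show ?case using step by simp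
qed

section \<open>Doob's maximal inequality\<close>

text \<open>Young's inequality in absorbing form. Either \<open>b powr s\<close> is at most
  \<open>e * a powr s\<close>, and the first term suffices, or \<open>a\<close> is controlled by
  \<open>b\<close>; raising that bound to the power \<open>r / s\<close> yields the constant of the
  second term.\<close>

lemma powr_mult_le_eps:
  fixes a b :: real
  assumes "0 \<le> a" "0 \<le> b" "0 < e" "0 \<le> r" "0 < s"
  shows "a powr r * b powr s \<le> e * a powr (r + s) + e powr (- r / s) * b powr (r + s)"
proof (cases "a = 0 \<or> b = 0")
  case True then show ?thesis using assms by auto
next
  case False
  then have a: "0 < a" and b: "0 < b" using assms by auto
  show ?thesis
  proof (cases "b powr s \<le> e * a powr s")
    case True
    then have "a powr r * b powr s \<le> a powr r * (e * a powr s)"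
      by (intro mult_left_mono) auto
    also have "\<dots> = e * a powr (r + s)" by (simp add: powr_add)
    finally show ?thesis by (smt (verit) mult_nonneg_nonneg powr_ge_zero)
  next
    case F: False
    then have "a powr s \<le> b powr s / e" using assms by (simp add: field_simps)
    then have "(a powr s) powr (r / s) \<le> (b powr s / e) powr (r / s)"
      using assms by (intro powr_mono2) auto
    then have "a powr r \<le> b powr r * e powr (- r / s)"
      using assms a b by (simp add: powr_powr powr_divide powr_minus_divide)
    then have "a powr r * b powr s \<le> (b powr r * e powr (- r / s)) * b powr s"
      by (intro mult_right_mono) auto
    also have "\<dots> = e powr (- r / s) * b powr (r + s)" by (simp add: powr_add)
    finally show ?thesis
      using assms by (smt (verit) mult_nonneg_nonneg powr_ge_zero)
  qed
qed

primrec runmax :: "(nat \<Rightarrow> 'a \<Rightarrow> real) \<Rightarrow> nat \<Rightarrow> 'a \<Rightarrow> real" where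
  "runmax X 0 x = \<bar>X 0 x\<bar>"
| "runmax X (Suc n) x = max (runmax X n x) \<bar>X (Suc n) x\<bar>"

lemma runmax_ge: "k \<le> n \<Longrightarrow> \<bar>X k x\<bar> \<le> runmax X n x"
proof (induction n)
  case 0 then show ?case by simp
next
  case (Suc n) then show ?case by (cases "k = Suc n") auto
qed

lemma runmax_nonneg: "0 \<le> runmax X n x"
  using runmax_ge[of 0 n X x] by simp

lemma adapted_runmax: "(\<And>k. k \<le> n \<Longrightarrow> adapted n (X k)) \<Longrightarrow> adapted n (runmax X n)"
proof -
  \<comment> \<open>The level \<open>m\<close> is decoupled from the last index \<open>n\<close>, so
    that the induction on \<open>n\<close> keeps it fixed.\<close>
  have "(\<And>k. k \<le> n \<Longrightarrow> adapted m (X k)) \<Longrightarrow> adapted m (runmax X n)" for m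
    by (induction n) (auto simp: runmax.simps[abs_def] intro!: adapted_abs adapted_comp2[where \<phi>=max])
  then show "(\<And>k. k \<le> n \<Longrightarrow> adapted n (X k)) \<Longrightarrow> adapted n (runmax X n)" .
qed

text \<open>One step of the pathwise form of Doob's inequality; it comes from Young's inequality
  with exponents \<open>p / (p - 1)\<close> and \<open>p\<close> for
  \<open>a powr (p - 1) * b\<close>.\<close>

lemma powr_diff_le:
  fixes a b :: real
  assumes "0 \<le> a" "a \<le> b" "1 < p"
  shows "(p - 1) / p * (b powr p - a powr p) \<le> (b powr (p - 1) - a powr (p - 1)) * b"
proof -
  have "a powr (p - 1) * b \<le> (a powr (p - 1)) powr (p / (p - 1)) / (p / (p - 1)) + b powr p / p"
    using assms by (intro Youngs_inequality) (auto simp: field_simps)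
  then have "a powr (p - 1) * b \<le> (p - 1) / p * (a powr p) + 1 / p * (b powr p)"
    using assms by (simp add: powr_powr mult.commute)
  moreover have "b powr (p - 1) * b = b powr p"
    using assms by (cases "b = 0") (auto simp: powr_diff)
  moreover have "(p - 1) / p * b powr p + 1 / p * b powr p = b powr p"
    using assms by (simp add: field_simps)
  ultimately show ?thesis by (simp add: algebra_simps)
qed

text \<open>The weights \<open>w k\<close> are the increments of \<open>M powr (p - 1)\<close>, where \<open>M\<close> is the running
  maximum; they vanish unless the maximum is attained at time \<open>k\<close>.\<close>
lemma doob_maximal:
  assumes p: "1 < (p::real)"
  obtains C where "0 < C"
    "\<And>N Y. adapted N Y \<Longrightarrow> (\<integral>x. runmax (\<lambda>k. avg k Y) N x powr p \<partial>cantor) \<le> C * (\<integral>x. \<bar>Y x\<bar> powr p \<partial>cantor)"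
proof -
  \<comment> \<open>Half of the factor \<open>(p - 1) / p\<close> that stands on the left at the
    end, so that half of the left side survives the absorption.\<close>
  define e where "e = (p - 1) / (2 * p)"
  have e: "0 < e" using p by (simp add: e_def)
  define K where "K = e powr (- (p - 1))"
  have K: "0 < K" using e by (simp add: K_def)
  have "(\<integral>x. runmax (\<lambda>k. avg k Y) N x powr p \<partial>cantor) \<le> (K / e) * (\<integral>x. \<bar>Y x\<bar> powr p \<partial>cantor)"
    if Y: "adapted N Y" for N Y
  proof -
    let ?X = "\<lambda>k. avg k Y"
    let ?M = "\<lambda>n. runmax ?X n"
    define w where "w k x = (if k = 0 then ?M 0 x powr (p - 1) else ?M k x powr (p - 1) - ?M (k - 1) x powr (p - 1))" for k x
    have wsum: "(\<Sum>k\<le>n. w k x) = ?M n x powr (p - 1)" for n x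
      by (induction n) (auto simp: w_def)
    have w_nonneg: "0 \<le> w k x" for k x
    proof (cases k)
      case (Suc j)
      then have "?M j x powr (p - 1) \<le> ?M k x powr (p - 1)"
        using p by (intro powr_mono2 runmax_nonneg) auto
      then show ?thesis using Suc by (simp add: w_def)
    qed (simp add: w_def)
    have adM: "adapted n (?M k)" if "k \<le> n" for k n
      by (rule adapted_mono[OF adapted_runmax that]) simp
    have adw: "adapted k (w k)" for k
      unfolding w_def[abs_def] by (cases k) (auto simp del: runmax.simps intro!: adapted_intros adM)
    \<comment> \<open>At each time either the maximum stays and the weight is zero, or the new
      modulus equals the new maximum and \<open>powr_diff_le\<close> bounds the increment.\<close>
    have path: "(p - 1) / p * ?M n x powr p \<le> (\<Sum>k\<le>n. w k x * \<bar>?X k x\<bar>)" for n x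
    proof (induction n)
      case 0
      have "(p - 1) / p * ?M 0 x powr p \<le> 1 * ?M 0 x powr p"
        using p by (intro mult_right_mono) auto
      also have "\<dots> = w 0 x * \<bar>?X 0 x\<bar>"
        by (cases "?X 0 x = 0") (auto simp: w_def powr_diff)
      finally show ?case by simp
    next
      case (Suc n)
      have "w (Suc n) x * \<bar>?X (Suc n) x\<bar> = w (Suc n) x * ?M (Suc n) x"
        by (auto simp: w_def max_def)
      then have "(\<Sum>k\<le>Suc n. w k x * \<bar>?X k x\<bar>) = (\<Sum>k\<le>n. w k x * \<bar>?X k x\<bar>) + w (Suc n) x * ?M (Suc n) x"
        by (simp only: sum.atMost_Suc)
      moreover have "(p - 1) / p * (?M (Suc n) x powr p - ?M n x powr p) \<le> w (Suc n) x * ?M (Suc n) x"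
        using powr_diff_le[of "?M n x" "?M (Suc n) x" p] p runmax_nonneg[of ?X n x]
        by (simp add: w_def)
      ultimately show ?case using Suc by (simp only: right_diff_distrib)
    qed
    have adY: "adapted N (\<lambda>x. \<bar>Y x\<bar>)" using Y by (rule adapted_abs)
    have intY: "integrable cantor (\<lambda>x. \<bar>Y x\<bar>)" by (rule adapted_integrable[OF adY])
    have intY0: "integrable cantor Y" by (rule adapted_integrable[OF Y])
    \<comment> \<open>The weight depends on \<open>k\<close> coordinates only, so after Jensen's
      inequality the average can be removed under the integral.\<close>
    have step: "(\<integral>x. w k x * \<bar>?X k x\<bar> \<partial>cantor) \<le> (\<integral>x. w k x * \<bar>Y x\<bar> \<partial>cantor)" for k
    proof -
      have "(\<integral>x. w k x * \<bar>?X k x\<bar> \<partial>cantor) \<le> (\<integral>x. w k x * avg k (\<lambda>z. \<bar>Y z\<bar>) x \<partial>cantor)"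
        by (intro integral_mono adapted_mult_integrable[OF adw] mult_left_mono avg_abs_le w_nonneg intY0) auto
      also have "\<dots> = (\<integral>x. w k x * \<bar>Y x\<bar> \<partial>cantor)"
        by (rule integral_avg_mult[OF adw intY])
      finally show ?thesis .
    qed
    have iM: "integrable cantor (\<lambda>x. ?M N x powr p)"
      by (rule adapted_integrable[of N]) (intro adapted_powr adM order_refl)
    have iMY: "integrable cantor (\<lambda>x. ?M N x powr (p - 1) * \<bar>Y x\<bar>)"
      by (rule adapted_integrable[of N]) (intro adapted_mult adapted_powr adM order_refl adY)
    have iYp: "integrable cantor (\<lambda>x. \<bar>Y x\<bar> powr p)"
      by (rule adapted_integrable[of N]) (intro adapted_powr adY)
    have "(\<integral>x. (p - 1) / p * ?M N x powr p \<partial>cantor) \<le> (\<integral>x. (\<Sum>k\<le>N. w k x * \<bar>?X k x\<bar>) \<partial>cantor)"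
      by (intro integral_mono path Bochner_Integration.integrable_sum adapted_mult_integrable[OF adw]) (use iM in auto)
    also have "\<dots> = (\<Sum>k\<le>N. \<integral>x. w k x * \<bar>?X k x\<bar> \<partial>cantor)"
      by (intro Bochner_Integration.integral_sum adapted_mult_integrable[OF adw]) auto
    also have "\<dots> \<le> (\<Sum>k\<le>N. \<integral>x. w k x * \<bar>Y x\<bar> \<partial>cantor)"
      by (intro sum_mono step)
    also have "\<dots> = (\<integral>x. (\<Sum>k\<le>N. w k x * \<bar>Y x\<bar>) \<partial>cantor)"
      by (intro Bochner_Integration.integral_sum[symmetric] adapted_mult_integrable[OF adw] intY)
    also have "\<dots> = (\<integral>x. ?M N x powr (p - 1) * \<bar>Y x\<bar> \<partial>cantor)"
      by (simp add: sum_distrib_right[symmetric] wsum)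
    also have "\<dots> \<le> (\<integral>x. e * ?M N x powr p + K * \<bar>Y x\<bar> powr p \<partial>cantor)"
    proof (rule integral_mono[OF iMY])
      fix x
      show "?M N x powr (p - 1) * \<bar>Y x\<bar> \<le> e * ?M N x powr p + K * \<bar>Y x\<bar> powr p"
        using powr_mult_le_eps[of "?M N x" "\<bar>Y x\<bar>" e "p - 1" 1] p e
        by (simp add: K_def runmax_nonneg)
    qed (use iM iYp in simp)
    also have "\<dots> = e * (\<integral>x. ?M N x powr p \<partial>cantor) + K * (\<integral>x. \<bar>Y x\<bar> powr p \<partial>cantor)"
      using iM iYp by simp
    finally have "(p - 1) / p * (\<integral>x. ?M N x powr p \<partial>cantor)
       \<le> e * (\<integral>x. ?M N x powr p \<partial>cantor) + K * (\<integral>x. \<bar>Y x\<bar> powr p \<partial>cantor)" by simp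
    moreover have "(p - 1) / p = 2 * e" using p by (simp add: e_def field_simps)
    ultimately have "e * (\<integral>x. ?M N x powr p \<partial>cantor) \<le> K * (\<integral>x. \<bar>Y x\<bar> powr p \<partial>cantor)" by simp
    then show ?thesis using e by (simp add: field_simps)
  qed
  moreover have "0 < K / e" using K e by simp
  ultimately show thesis using that by blast
qed

section \<open>The weak type estimate for the maximal function\<close>

text \<open>A majorant of the pointwise norm instead of the norm itself, expressed by finite sums:
  no summability has to be carried along, and \<open>F\<close> is nonnegative everywhere although
  the bound holds almost everywhere.\<close>

definition dominated :: "(nat \<Rightarrow> (nat \<Rightarrow> bool) \<Rightarrow> real) \<Rightarrow> ((nat \<Rightarrow> bool) \<Rightarrow> real) \<Rightarrow> bool" where
  "dominated f F \<longleftrightarrow> (\<forall>n. f n \<in> borel_measurable cantor) \<and> integrable cantor F \<and> (\<forall>x. 0 \<le> F x)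
    \<and> (AE x in cantor. \<forall>N. (\<Sum>n\<le>N. (f n x)\<^sup>2) \<le> (F x)\<^sup>2)"

lemma dominated_abs_le:
  assumes "dominated f F" shows "AE x in cantor. \<forall>n. \<bar>f n x\<bar> \<le> F x"
proof -
  have "AE x in cantor. \<forall>N. (\<Sum>n\<le>N. (f n x)\<^sup>2) \<le> (F x)\<^sup>2"
    using assms by (simp add: dominated_def)
  then show ?thesis
  proof eventually_elim
    case (elim x)
    show ?case
    proof
      fix n
      have "(f n x)\<^sup>2 \<le> (\<Sum>n\<le>n. (f n x)\<^sup>2)"
        by (rule member_le_sum) auto
      then have "\<bar>f n x\<bar>\<^sup>2 \<le> (F x)\<^sup>2" using elim by (metis order_trans power2_abs)
      then show "\<bar>f n x\<bar> \<le> F x"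
        using assms by (intro power2_le_imp_le[of "\<bar>f n x\<bar>"]) (auto simp: dominated_def)
    qed
  qed
qed

lemma dominated_integrable:
  assumes "dominated f F" shows "integrable cantor (f n)"
proof (rule Bochner_Integration.integrable_bound)
  show "integrable cantor F" "f n \<in> borel_measurable cantor"
    using assms by (auto simp: dominated_def)
  show "AE x in cantor. norm (f n x) \<le> norm (F x)"
    using dominated_abs_le[OF assms] by eventually_elim (auto intro: order_trans[OF _ abs_ge_self])
qed

text \<open>Minkowski's inequality for a vector of averages. Pairing the vector with itself and
  applying Cauchy-Schwarz under the average bounds the square of its norm \<open>s\<close> by
  \<open>s * avg m F x\<close>.\<close>

lemma avg_sum_sq_le:
  assumes fF: "dominated f F"
  shows "(\<Sum>n\<le>N. (avg m (f n) x)\<^sup>2) \<le> (avg m F x)\<^sup>2"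
proof -
  define c where "c n = avg m (f n) x" for n
  define s where "s = sqrt (\<Sum>n\<le>N. (c n)\<^sup>2)"
  have F: "integrable cantor F" "\<And>x. 0 \<le> F x" using fF by (auto simp: dominated_def)
  have s0: "0 \<le> s" and s2: "s\<^sup>2 = (\<Sum>n\<le>N. (c n)\<^sup>2)"
    by (auto simp: s_def sum_nonneg)
  have "s\<^sup>2 = (\<Sum>n\<le>N. avg m (\<lambda>z. c n * f n z) x)"
    unfolding s2 by (simp add: avg_cmult c_def power2_eq_square)
  also have "\<dots> = avg m (\<lambda>z. \<Sum>n\<le>N. c n * f n z) x"
    using dominated_integrable[OF fF] by (simp add: avg_sum)
  also have "\<dots> \<le> avg m (\<lambda>z. s * F z) x"
  proof (rule avg_mono)
    have "AE z in cantor. \<forall>N. (\<Sum>n\<le>N. (f n z)\<^sup>2) \<le> (F z)\<^sup>2"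
      using fF by (simp add: dominated_def)
    then show "AE z in cantor. (\<Sum>n\<le>N. c n * f n z) \<le> s * F z"
    proof eventually_elim
      case (elim z)
      have "(\<Sum>n\<le>N. c n * f n z)\<^sup>2 \<le> (\<Sum>n\<le>N. (c n)\<^sup>2) * (\<Sum>n\<le>N. (f n z)\<^sup>2)"
        by (rule Cauchy_Schwarz_ineq_sum)
      also have "\<dots> \<le> s\<^sup>2 * (F z)\<^sup>2"
        unfolding s2 using elim by (intro mult_left_mono) (auto simp: sum_nonneg)
      finally have "(\<Sum>n\<le>N. c n * f n z)\<^sup>2 \<le> (s * F z)\<^sup>2" by (simp add: power_mult_distrib)
      then show ?case
        by (rule power2_le_imp_le) (use s0 F(2)[of z] in simp)
    qed
  qed (use dominated_integrable[OF fF] F in auto)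
  also have "\<dots> = s * avg m F x" by (rule avg_cmult)
  finally have "s * s \<le> s * avg m F x" by (simp add: power2_eq_square)
  then have "s \<le> avg m F x"
    using s0 avg_nonneg[of F m x] F(2) by (cases "s = 0") auto
  then have "s\<^sup>2 \<le> (avg m F x)\<^sup>2" using s0 by (rule power_mono)
  then show ?thesis by (simp add: s2 c_def)
qed

text \<open>The indicator that no stopping has occurred before time \<open>k\<close>. The strict
  \<open>j < k\<close> makes it depend on \<open>k - 1\<close> coordinates, so its product with a
  martingale difference is again one.\<close>

definition alive :: "((nat \<Rightarrow> bool) \<Rightarrow> real) \<Rightarrow> real \<Rightarrow> nat \<Rightarrow> (nat \<Rightarrow> bool) \<Rightarrow> real" where
  "alive F lam k x = of_bool (\<forall>j<k. avg j F x \<le> lam)"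

text \<open>\<open>stopped F lam N h\<close> is the martingale of \<open>h\<close> at the first time before \<open>N\<close>
  at which the average of \<open>F\<close> exceeds \<open>lam\<close>, or at time \<open>N\<close> if there is none.\<close>
definition stopped :: "((nat \<Rightarrow> bool) \<Rightarrow> real) \<Rightarrow> real \<Rightarrow> nat \<Rightarrow> ((nat \<Rightarrow> bool) \<Rightarrow> real) \<Rightarrow> (nat \<Rightarrow> bool) \<Rightarrow> real" where
  "stopped F lam N h x = (\<Sum>k\<le>N. alive F lam k x * mdiff k h x)"

lemma adapted_alive: "adapted (k - 1) (alive F lam k)"
proof -
  have "adapted (k - 1) (\<lambda>x. \<forall>j. j < k \<longrightarrow> avg j F x \<le> lam)"
    by (rule adapted_all, rule adapted_comp[where \<phi>="\<lambda>t. t \<le> lam"]) simp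
  from adapted_comp[OF this, of of_bool] show ?thesis
    by (simp add: alive_def[abs_def])
qed

lemma adapted_alive_mdiff: "k \<le> n \<Longrightarrow> adapted n (\<lambda>x. alive F lam k x * mdiff k h x)"
  by (rule adapted_mult[OF adapted_mono[OF adapted_alive]]) auto

lemma adapted_stopped: "adapted N (stopped F lam N h)"
  unfolding stopped_def[abs_def] by (intro adapted_sum adapted_alive_mdiff) auto

text \<open>The stopping index \<open>s\<close> depends on \<open>F\<close> and \<open>x\<close> but
  not on \<open>h\<close>. Inequalities between averages of several functions at one point therefore
  carry over to the stopped functions.\<close>

lemma stopped_eq_avg:
  obtains s where "s \<le> N" "\<And>h. stopped F lam N h x = avg s h x" "\<And>j. j < s \<Longrightarrow> avg j F x \<le> lam"
    "s = N \<or> lam < avg s F x"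
proof -
  have "\<exists>s\<le>N. (\<forall>h. stopped F lam N h x = avg s h x) \<and> (\<forall>j<s. avg j F x \<le> lam) \<and> (s = N \<or> lam < avg s F x)"
  proof (induction N)
    case 0
    then show ?case by (simp add: stopped_def alive_def mdiff_def)
  next
    case (Suc N)
    then obtain s where s: "s \<le> N" "\<forall>h. stopped F lam N h x = avg s h x" "\<forall>j<s. avg j F x \<le> lam"
      "s = N \<or> lam < avg s F x" by blast
    show ?case
    proof (cases "lam < avg s F x")
      case True
      then have "alive F lam (Suc N) x = 0"
        using s(1) by (auto simp: alive_def not_le intro!: exI[of _ s])
      then show ?thesis
        using s True by (intro exI[of _ s]) (auto simp: stopped_def)
    next
      case False
      then have "s = N" using s by simp
      then have "\<forall>j<Suc N. avg j F x \<le> lam" using s False by (auto simp: less_Suc_eq)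
      moreover from this have "alive F lam (Suc N) x = 1" by (simp add: alive_def)
      moreover have "stopped F lam (Suc N) h x = avg N h x + alive F lam (Suc N) x * mdiff (Suc N) h x" for h
        using s(2) \<open>s = N\<close> by (simp add: stopped_def)
      ultimately show ?thesis
        by (intro exI[of _ "Suc N"]) (simp add: mdiff_def)
    qed
  qed
  then show thesis using that by blast
qed

lemma integral_stopped:
  assumes "integrable cantor h"
  shows "(\<integral>x. stopped F lam N h x \<partial>cantor) = (\<integral>x. h x \<partial>cantor)"
proof -
  have "(\<integral>x. stopped F lam N h x \<partial>cantor) = (\<Sum>k\<le>N. \<integral>x. alive F lam k x * mdiff k h x \<partial>cantor)"
    unfolding stopped_def
    by (intro Bochner_Integration.integral_sum adapted_integrable[OF adapted_alive_mdiff[OF order_refl]])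
  also have "\<dots> = (\<Sum>k\<le>N. if k = 0 then \<integral>x. h x \<partial>cantor else 0)"
  proof (rule sum.cong)
    fix k
    show "(\<integral>x. alive F lam k x * mdiff k h x \<partial>cantor) = (if k = 0 then \<integral>x. h x \<partial>cantor else 0)"
      using integral_mult_mdiff_zero[OF adapted_alive assms, of k F lam] assms
      by (auto simp: alive_def mdiff_def integral_avg)
  qed simp
  finally show ?thesis by simp
qed

lemma mdiff_stopped:
  assumes h: "integrable cantor h" and "m \<le> N"
  shows "mdiff m (stopped F lam N h) x = alive F lam m x * mdiff m h x"
proof -
  have "mdiff m (stopped F lam N h) x = (\<Sum>k\<le>N. mdiff m (\<lambda>x. alive F lam k x * mdiff k h x) x)"
    unfolding stopped_def[abs_def]
    by (intro mdiff_sum adapted_integrable[OF adapted_alive_mdiff[OF order_refl]])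
  also have "\<dots> = (\<Sum>k\<le>N. if m = k then alive F lam k x * mdiff k h x else 0)"
    by (intro sum.cong mdiff_mult_mdiff adapted_alive h refl)
  finally show ?thesis using \<open>m \<le> N\<close> by simp
qed

lemma stopped_nonneg: "(\<And>x. 0 \<le> h x) \<Longrightarrow> 0 \<le> stopped F lam N h x"
  using stopped_eq_avg[of N F lam x] avg_nonneg by metis

text \<open>Before a positive stopping index the average was still at most \<open>lam\<close>, and
  one step at most doubles it. At index 0 the value is the integral of \<open>F\<close>, which
  explains the hypothesis on \<open>lam\<close>.\<close>

lemma stopped_le:
  assumes F: "integrable cantor F" "\<And>x. 0 \<le> F x" and lam: "(\<integral>x. F x \<partial>cantor) \<le> lam"
  shows "stopped F lam N F x \<le> 2 * lam"
proof -
  obtain s where s: "stopped F lam N F x = avg s F x" "\<And>j. j < s \<Longrightarrow> avg j F x \<le> lam"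
    using stopped_eq_avg[of N F lam x] by metis
  have "0 \<le> (\<integral>x. F x \<partial>cantor)" by (rule Bochner_Integration.integral_nonneg) (rule F(2))
  then show ?thesis
    using s(1) avg_Suc_le[OF F, of "s - 1" x] s(2)[of "s - 1"] lam
    by (cases "s = 0") (simp_all add: avg_0)
qed

lemma stopped_gt:
  assumes "j \<le> N" "lam < avg j F x" shows "lam < stopped F lam N F x"
  using stopped_eq_avg[of N F lam x] assms by (metis le_neq_implies_less not_le)

section \<open>Weak type inequalities for averages and partial sums\<close>

lemma predicate_sets:
  assumes "adapted n P" shows "{x. P x} \<in> sets cantor"
proof -
  have "(\<lambda>x. of_bool (P x) :: real) \<in> borel_measurable cantor"
    by (rule adapted_measurable[of n], rule adapted_comp[OF assms])
  then have "{x \<in> space cantor. of_bool (P x) = (1::real)} \<in> sets cantor"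
    by measurable
  then show ?thesis by simp
qed

text \<open>The stopped function exceeds \<open>lam\<close> wherever some average does, and stopping
  preserves the integral.\<close>

lemma weak_type_avg:
  assumes F: "integrable cantor F" "\<And>x. 0 \<le> F x" and lam: "0 < lam"
  shows "lam * measure cantor {x. \<exists>j\<le>N. lam < avg j F x} \<le> (\<integral>x. F x \<partial>cantor)"
proof -
  have "{x \<in> space cantor. \<exists>j\<le>N. lam < avg j F x} \<in> sets cantor"
    by measurable
  then have A: "{x. \<exists>j\<le>N. lam < avg j F x} \<in> sets cantor" by simp
  have i: "integrable cantor (stopped F lam N F)"
    by (rule adapted_integrable[OF adapted_stopped])
  have "lam * measure cantor {x. \<exists>j\<le>N. lam < avg j F x}
      = (\<integral>x. lam * indicator {x. \<exists>j\<le>N. lam < avg j F x} x \<partial>cantor)"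
    using A by simp
  also have "\<dots> \<le> (\<integral>x. stopped F lam N F x \<partial>cantor)"
  proof (rule integral_mono[OF _ i])
    fix x
    show "lam * indicator {x. \<exists>j\<le>N. lam < avg j F x} x \<le> stopped F lam N F x"
      using stopped_gt[of _ N lam F x] stopped_nonneg[of F F lam N x] F(2)
      by (auto simp: indicator_def intro: less_imp_le)
  qed (use A in \<open>simp add: cantor.emeasure_eq_measure\<close>)
  also have "\<dots> = (\<integral>x. F x \<partial>cantor)" by (rule integral_stopped[OF F(1)])
  finally show ?thesis .
qed

text \<open>The sums \<open>S\<^sub>N\<close> of the overview. They form a martingale by
  \<open>avg_mpart\<close>, which is what allows Doob's inequality for their maximum.\<close>

definition mpart :: "(nat \<Rightarrow> (nat \<Rightarrow> bool) \<Rightarrow> real) \<Rightarrow> nat \<Rightarrow> (nat \<Rightarrow> bool) \<Rightarrow> real" where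
  "mpart f n x = (\<Sum>k\<le>n. mdiff k (f k) x)"

lemma adapted_mpart [simp]: "m \<le> n \<Longrightarrow> adapted n (mpart f m)"
  unfolding mpart_def[abs_def] by (intro adapted_sum) simp

lemma mpart_measurable [measurable]: "mpart f n \<in> borel_measurable cantor"
  by (rule adapted_measurable[of n]) simp

lemma avg_mpart:
  assumes "\<And>k. integrable cantor (f k)" "m \<le> n"
  shows "avg m (mpart f n) x = mpart f m x"
proof -
  have "avg m (mpart f n) x = (\<Sum>k\<le>n. avg m (mdiff k (f k)) x)"
    unfolding mpart_def[abs_def] by (rule avg_sum) simp
  also have "\<dots> = (\<Sum>k\<le>n. if k \<le> m then mdiff k (f k) x else 0)"
    using avg_mult_mdiff[of _ "\<lambda>_. 1" "f _" m x] assms(1) by (intro sum.cong) auto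
  also have "\<dots> = mpart f m x"
    unfolding mpart_def by (rule sum.mono_neutral_cong_right) (use assms(2) in auto)
  finally show ?thesis .
qed

lemma integral_mpart_sq:
  assumes "\<And>k. integrable cantor (f k)"
  shows "(\<integral>x. (mpart f N x)\<^sup>2 \<partial>cantor) = (\<Sum>k\<le>N. \<integral>x. (mdiff k (f k) x)\<^sup>2 \<partial>cantor)"
  using integral_sum_mdiff_sq[OF assms, of 0 N] by (simp add: mpart_def atLeast0AtMost)

text \<open>Orthogonality and contraction reduce to the sum of squares of the stopped components,
  which is at most the square of the stopped \<open>F\<close>. One factor of that square is at most
  \<open>2 * lam\<close>; the other keeps the integral of \<open>F\<close>.\<close>

lemma weak_type_stopped:
  assumes fF: "dominated f F" and lam: "(\<integral>x. F x \<partial>cantor) \<le> lam"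
  shows "(\<integral>x. (mpart (\<lambda>k. stopped F lam N (f k)) N x)\<^sup>2 \<partial>cantor) \<le> 2 * lam * (\<integral>x. F x \<partial>cantor)"
proof -
  let ?g = "\<lambda>k. stopped F lam N (f k)"
  have F: "integrable cantor F" "\<And>x. 0 \<le> F x" using fF by (auto simp: dominated_def)
  have ig: "integrable cantor (?g k)" for k by (rule adapted_integrable[OF adapted_stopped])
  have ig2: "integrable cantor (\<lambda>x. (?g k x)\<^sup>2)" for k
    by (rule adapted_integrable[of N]) (intro adapted_power adapted_stopped)
  have iF: "integrable cantor (stopped F lam N F)" by (rule adapted_integrable[OF adapted_stopped])
  have "(\<integral>x. (mpart ?g N x)\<^sup>2 \<partial>cantor) = (\<Sum>k\<le>N. \<integral>x. (mdiff k (?g k) x)\<^sup>2 \<partial>cantor)"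
    by (rule integral_mpart_sq[OF ig])
  also have "\<dots> \<le> (\<Sum>k\<le>N. \<integral>x. (?g k x)\<^sup>2 \<partial>cantor)"
    using integral_mult_mdiff_sq_le[of _ "\<lambda>_. 1" "?g _"] ig ig2 by (intro sum_mono) auto
  also have "\<dots> = (\<integral>x. (\<Sum>k\<le>N. (?g k x)\<^sup>2) \<partial>cantor)"
    by (rule Bochner_Integration.integral_sum[symmetric, OF ig2])
  also have "\<dots> \<le> (\<integral>x. 2 * lam * stopped F lam N F x \<partial>cantor)"
  proof (rule integral_mono)
    fix x
    obtain s where s: "\<And>h. stopped F lam N h x = avg s h x"
      using stopped_eq_avg[of N F lam x] by metis
    have "(\<Sum>k\<le>N. (?g k x)\<^sup>2) \<le> (stopped F lam N F x)\<^sup>2"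
      unfolding s by (rule avg_sum_sq_le[OF fF])
    also have "\<dots> \<le> 2 * lam * stopped F lam N F x"
      unfolding power2_eq_square
      by (intro mult_right_mono stopped_le F lam stopped_nonneg)
    finally show "(\<Sum>k\<le>N. (?g k x)\<^sup>2) \<le> 2 * lam * stopped F lam N F x" .
  qed (use ig2 iF in auto)
  also have "\<dots> = 2 * lam * (\<integral>x. F x \<partial>cantor)"
    using integral_stopped[OF F(1)] by simp
  finally show ?thesis .
qed

lemma weak_type_mpart:
  obtains C where "1 \<le> C" "\<And>f F lam N. dominated f F \<Longrightarrow> 0 < lam \<Longrightarrow>
    lam * measure cantor {x. \<exists>n\<le>N. lam < \<bar>mpart f n x\<bar>} \<le> C * (\<integral>x. F x \<partial>cantor)"
proof -
  obtain C2 where C2: "0 < C2"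
    "\<And>N Y. adapted N Y \<Longrightarrow> (\<integral>x. runmax (\<lambda>k. avg k Y) N x powr 2 \<partial>cantor) \<le> C2 * (\<integral>x. \<bar>Y x\<bar> powr 2 \<partial>cantor)"
    using doob_maximal[of 2] by auto
  \<comment> \<open>The summand 1 pays for the set where some average of \<open>F\<close> exceeds
    \<open>lam\<close>; \<open>2 * C2\<close> combines Doob's constant with the bound
    \<open>2 * lam\<close> on the stopped norm.\<close>
  define C where "C = 1 + 2 * C2"
  have "lam * measure cantor {x. \<exists>n\<le>N. lam < \<bar>mpart f n x\<bar>} \<le> C * (\<integral>x. F x \<partial>cantor)"
    if fF: "dominated f F" and lam: "0 < lam" for f F lam N
  proof (cases "(\<integral>x. F x \<partial>cantor) \<le> lam")
    case False
    have "lam * measure cantor {x. \<exists>n\<le>N. lam < \<bar>mpart f n x\<bar>} \<le> lam * 1"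
      using lam by (intro mult_left_mono cantor.prob_le_1) auto
    also have "\<dots> \<le> 1 * (\<integral>x. F x \<partial>cantor)" using False by simp
    also have "\<dots> \<le> C * (\<integral>x. F x \<partial>cantor)"
      using False lam C2 by (intro mult_right_mono) (auto simp: C_def)
    finally show ?thesis .
  next
    case True
    have F: "integrable cantor F" "\<And>x. 0 \<le> F x" using fF by (auto simp: dominated_def)
    let ?g = "\<lambda>k. stopped F lam N (f k)"
    let ?Y = "mpart ?g N"
    let ?R = "runmax (\<lambda>k. avg k ?Y) N"
    have ig: "integrable cantor (?g k)" for k by (rule adapted_integrable[OF adapted_stopped])
    have adR: "adapted N ?R" by (rule adapted_runmax) simp
    have iR: "integrable cantor (\<lambda>x. (?R x)\<^sup>2)"
      by (rule adapted_integrable[of N], intro adapted_power adR)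
    let ?A = "{x. \<exists>j\<le>N. lam < avg j F x}" and ?B = "{x. lam < ?R x}"
    have "{x \<in> space cantor. \<exists>j\<le>N. lam < avg j F x} \<in> sets cantor" by measurable
    then have A: "?A \<in> sets cantor" by simp
    have B: "?B \<in> sets cantor"
      by (rule predicate_sets, rule adapted_comp[OF adR])
    \<comment> \<open>Off the first set nothing is stopped up to \<open>N\<close>, so the sums of
      \<open>f\<close> and of the stopped functions coincide, and each is an average of the terminal
      sum.\<close>
    have "{x. \<exists>n\<le>N. lam < \<bar>mpart f n x\<bar>} \<subseteq> ?A \<union> ?B"
    proof safe
      fix x n assume n: "n \<le> N" "lam < \<bar>mpart f n x\<bar>" and nB: "\<not> lam < ?R x"
      have "\<exists>j\<le>N. lam < avg j F x"
      proof (rule ccontr)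
        assume "\<not> ?thesis"
        then have "alive F lam k x = 1" if "k \<le> N" for k
          using that by (auto simp: alive_def not_less)
        then have "mdiff k (?g k) x = mdiff k (f k) x" if "k \<le> N" for k
          using that mdiff_stopped[OF dominated_integrable[OF fF] that] by simp
        then have "mpart ?g n x = mpart f n x"
          using n unfolding mpart_def by (intro sum.cong) auto
        moreover have "\<bar>avg n ?Y x\<bar> \<le> ?R x" using n by (intro runmax_ge)
        ultimately show False using n nB by (simp add: avg_mpart[OF ig])
      qed
      then show "\<exists>j\<le>N. lam < avg j F x" .
    qed
    then have "measure cantor {x. \<exists>n\<le>N. lam < \<bar>mpart f n x\<bar>} \<le> measure cantor (?A \<union> ?B)"
      using A B by (intro cantor.finite_measure_mono) auto
    also have "\<dots> \<le> measure cantor ?A + measure cantor ?B"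
      using A B by (rule measure_Un_le)
    finally have 1: "lam * measure cantor {x. \<exists>n\<le>N. lam < \<bar>mpart f n x\<bar>}
        \<le> lam * measure cantor ?A + lam * measure cantor ?B"
      using lam by (simp add: distrib_left[symmetric])
    \<comment> \<open>Chebyshev's inequality in square mean; one factor \<open>lam\<close> cancels
      below against the one in \<open>weak_type_stopped\<close>.\<close>
    have "lam\<^sup>2 * measure cantor ?B = (\<integral>x. lam\<^sup>2 * indicator ?B x \<partial>cantor)" using B by simp
    also have "\<dots> \<le> (\<integral>x. (?R x)\<^sup>2 \<partial>cantor)"
    proof (rule integral_mono[OF _ iR])
      fix x show "lam\<^sup>2 * indicator ?B x \<le> (?R x)\<^sup>2"
        using lam by (auto simp: indicator_def intro!: power_mono)
    qed (use B in \<open>simp add: cantor.emeasure_eq_measure\<close>)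
    also have "\<dots> \<le> C2 * (\<integral>x. (?Y x)\<^sup>2 \<partial>cantor)"
      using C2(2)[of N ?Y] by (simp add: runmax_nonneg)
    also have "\<dots> \<le> C2 * (2 * lam * (\<integral>x. F x \<partial>cantor))"
      using weak_type_stopped[OF fF True, of N] C2(1) by simp
    finally have "lam * (lam * measure cantor ?B) \<le> lam * (2 * C2 * (\<integral>x. F x \<partial>cantor))"
      by (simp add: power2_eq_square mult_ac)
    then have 2: "lam * measure cantor ?B \<le> 2 * C2 * (\<integral>x. F x \<partial>cantor)"
      using lam by simp
    show ?thesis
      using 1 2 weak_type_avg[OF F lam, of N] by (simp add: C_def distrib_right)
  qed
  moreover have "1 \<le> C" using C2(1) by (simp add: C_def)
  ultimately show thesis using that by blast
qed

section \<open>Truncations of the kernel\<close>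

text \<open>The part of the full convolution that is lost by removing the ball \<open>cylinder N gzero\<close>, on which
  \<open>kappa n\<close> is constant for \<open>n \<le> N\<close>.\<close>
definition rem :: "(nat \<Rightarrow> (nat \<Rightarrow> bool) \<Rightarrow> real) \<Rightarrow> nat \<Rightarrow> (nat \<Rightarrow> bool) \<Rightarrow> real" where
  "rem f N x = (\<Sum>n\<le>N. kappa n gzero / 2 ^ N * avg N (f n) x)"

lemma cylinder_gadd: "gadd x z \<in> cylinder n gzero \<longleftrightarrow> z \<in> cylinder n x"
  by (auto simp: cylinder_def gadd_def gzero_def)

lemma le_Least_iff_cylinder:
  assumes "y \<noteq> gzero" shows "n \<le> (LEAST k. y k) \<longleftrightarrow> y \<in> cylinder n gzero"
proof -
  have "\<exists>k. y k" using assms by (auto simp: gzero_def)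
  then have "y (LEAST k. y k)" by (rule LeastI_ex)
  then have "n \<le> (LEAST k. y k) \<longleftrightarrow> (\<forall>k<n. \<not> y k)"
    by (metis leI not_less_Least order_less_le_trans)
  then show ?thesis
    by (simp add: cylinder_def gzero_def)
qed

text \<open>Nonzero distances are powers of 1/2, so balls change only at dyadic radii. Since
  \<open>cmin\<close> counts from 1, a distance below \<open>r\<close> means \<open>cmin y\<close>
  is at least \<open>Suc N\<close>, that is, the first \<open>N\<close> coordinates vanish.\<close>

lemma cball_eq_cylinder:
  assumes "(1/2) ^ Suc N < r" "r \<le> (1/2) ^ N"
  shows "cball gzero r = cylinder N gzero"
proof (rule set_eqI)
  fix y
  show "y \<in> cball gzero r \<longleftrightarrow> y \<in> cylinder N gzero"
  proof (cases "y = gzero")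
    case True
    have "0 < (1/2::real) ^ Suc N" by simp
    then have "0 < r" using assms(1) by linarith
    then show ?thesis using True by (simp add: cball_def cdist_def cylinder_def)
  next
    case False
    have "gadd gzero y = y" by (simp add: gadd_def gzero_def)
    then have "y \<in> cball gzero r \<longleftrightarrow> (1/2) ^ cmin y < r"
      using False by (simp add: cball_def cdist_def eq_commute[of gzero])
    also have "\<dots> \<longleftrightarrow> Suc N \<le> cmin y"
    proof (rule iffI, rule ccontr)
      assume "(1/2) ^ cmin y < r" "\<not> Suc N \<le> cmin y"
      moreover from this have "(1/2::real) ^ N \<le> (1/2) ^ cmin y" by (intro power_decreasing) auto
      ultimately show False using assms(2) by linarith
    next
      assume "Suc N \<le> cmin y"
      then have "(1/2::real) ^ cmin y \<le> (1/2) ^ Suc N" by (intro power_decreasing) auto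
      then show "(1/2) ^ cmin y < r" using assms by linarith
    qed
    also have "\<dots> \<longleftrightarrow> y \<in> cylinder N gzero"
      using le_Least_iff_cylinder[OF False] by (simp add: cmin_def)
    finally show ?thesis .
  qed
qed

text \<open>A scaled indicator of \<open>cylinder n gzero\<close> is the convolution kernel of
  \<open>avg n\<close>, so this displays \<open>kappa n\<close> as the kernel of
  \<open>mdiff n\<close>.\<close>

lemma kappa_eq_indicators:
  "kappa n y = (if n = 0 then 1
    else 2 ^ n * indicator (cylinder n gzero) y - 2 ^ (n - 1) * indicator (cylinder (n - 1) gzero) y)"
proof (cases "n = 0 \<or> y = gzero")
  case True
  then show ?thesis
    by (cases n) (auto simp: kappa_def cylinder_def)
next
  case False
  then obtain m where m: "n = Suc m" by (cases n) auto
  have y: "y \<noteq> gzero" using False by simp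
  show ?thesis
    using y unfolding kappa_def m
    by (auto simp: indicator_def le_Least_iff_cylinder[OF y, symmetric] cmin_def)
qed

lemma kappa_gadd:
  "kappa n (gadd x z) = (if n = 0 then 1
    else 2 ^ n * indicator (cylinder n x) z - 2 ^ (n - 1) * indicator (cylinder (n - 1) x) z)"
  unfolding kappa_eq_indicators by (simp add: indicator_def cylinder_gadd)

lemma integral_kappa_gadd:
  assumes h: "integrable cantor h"
  shows "integrable cantor (\<lambda>z. kappa n (gadd x z) * h z)"
    and "(\<integral>z. kappa n (gadd x z) * h z \<partial>cantor) = mdiff n h x"
proof -
  have i: "integrable cantor (\<lambda>z. h z * indicator (cylinder k x) z)" for k
    by (rule integrable_indicator_cylinder[OF h])
  have eq: "(\<lambda>z. kappa n (gadd x z) * h z) = (\<lambda>z. if n = 0 then h z else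
      2 ^ n * (h z * indicator (cylinder n x) z) - 2 ^ (n - 1) * (h z * indicator (cylinder (n - 1) x) z))"
    by (auto simp: kappa_gadd algebra_simps)
  show "integrable cantor (\<lambda>z. kappa n (gadd x z) * h z)"
    unfolding eq using h i by (cases "n = 0") (auto intro!: Bochner_Integration.integrable_diff)
  show "(\<integral>z. kappa n (gadd x z) * h z \<partial>cantor) = mdiff n h x"
    unfolding eq using h i[of n] i[of "n - 1"] by (cases "n = 0") (simp_all add: mdiff_def avg_0, simp add: avg_def)
qed

text \<open>For \<open>n > N\<close> the kernel lives on \<open>cylinder (n - 1) gzero\<close>,
  which lies inside the removed ball. Outside the ball the series is thus a finite sum, whatever the
  vector \<open>v\<close>.\<close>

lemma kapply_eq_sum:
  assumes "y \<notin> cylinder N gzero"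
  shows "kapply y v = (\<Sum>n\<le>N. kappa n y * v n)"
  unfolding kapply_def
proof (rule suminf_finite)
  fix n assume "n \<notin> {..N}"
  then have "cylinder n gzero \<subseteq> cylinder N gzero" "cylinder (n - 1) gzero \<subseteq> cylinder N gzero" "n \<noteq> 0"
    by (auto simp: cylinder_def)
  then have "y \<notin> cylinder n gzero" "y \<notin> cylinder (n - 1) gzero" "n \<noteq> 0"
    using assms by auto
  then show "kappa n y * v n = 0" by (simp add: kappa_eq_indicators)
qed simp

lemma ktrunc_eq:
  assumes f: "\<And>n. integrable cantor (\<lambda>z. f z n)"
    and r: "(1/2) ^ Suc N < r" "r \<le> (1/2) ^ N"
  shows "ktrunc f x r = mpart (\<lambda>n z. f z n) N x - rem (\<lambda>n z. f z n) N x"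
proof -
  \<comment> \<open>Subtracting on the ball the constant value of each kernel gives zero inside and
    the original integrand outside, using only terms whose integrals are known.\<close>
  define g where "g z = (\<Sum>n\<le>N. kappa n (gadd x z) * f z n
      - kappa n gzero * (f z n * indicator (cylinder N x) z))" for z
  have int1: "integrable cantor (\<lambda>z. kappa n gzero * (f z n * indicator (cylinder N x) z))" for n
    using integrable_indicator_cylinder[OF f] by simp
  have int: "integrable cantor g"
    unfolding g_def using f int1 by (intro Bochner_Integration.integrable_sum Bochner_Integration.integrable_diff integral_kappa_gadd)
  have pointwise: "indicator (space cantor - cball gzero r) y *\<^sub>R kapply y (f (gadd x y)) = g (gadd x y)" for y
  proof (cases "y \<in> cylinder N gzero")
    case True
    then have "gadd x y \<in> cylinder N x"
      by (auto simp: cylinder_def gadd_def gzero_def)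
    moreover have "kappa n y = kappa n gzero" if "n \<le> N" for n
    proof -
      have "y \<in> cylinder n gzero" "y \<in> cylinder (n - 1) gzero"
        using True that by (auto simp: cylinder_def)
      then show ?thesis
        unfolding kappa_eq_indicators by (simp add: cylinder_def)
    qed
    ultimately have "g (gadd x y) = 0" by (simp add: g_def)
    then show ?thesis using True cball_eq_cylinder[OF r] by simp
  next
    case False
    then have "gadd x y \<notin> cylinder N x"
      by (auto simp: cylinder_def gadd_def gzero_def)
    then show ?thesis
      using False cball_eq_cylinder[OF r] by (simp add: g_def kapply_eq_sum[OF False])
  qed
  have "ktrunc f x r = (\<integral>y. g (gadd x y) \<partial>cantor)"
    unfolding ktrunc_def set_lebesgue_integral_def pointwise ..
  also have "\<dots> = (\<integral>z. g z \<partial>distr cantor cantor (gadd x))"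
    using int by (intro integral_distr[symmetric]) auto
  also have "\<dots> = (\<integral>z. g z \<partial>cantor)" by (simp add: distr_gadd)
  also have "\<dots> = (\<Sum>n\<le>N. \<integral>z. kappa n (gadd x z) * f z n
      - kappa n gzero * (f z n * indicator (cylinder N x) z) \<partial>cantor)"
    unfolding g_def using f int1
    by (intro Bochner_Integration.integral_sum Bochner_Integration.integrable_diff integral_kappa_gadd)
  also have "\<dots> = (\<Sum>n\<le>N. mdiff n (\<lambda>z. f z n) x - kappa n gzero / 2 ^ N * avg N (\<lambda>z. f z n) x)"
  proof (intro sum.cong refl)
    fix n
    have "(\<integral>z. kappa n (gadd x z) * f z n - kappa n gzero * (f z n * indicator (cylinder N x) z) \<partial>cantor)
      = (\<integral>z. kappa n (gadd x z) * f z n \<partial>cantor) - (\<integral>z. kappa n gzero * (f z n * indicator (cylinder N x) z) \<partial>cantor)"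
      by (intro Bochner_Integration.integral_diff integral_kappa_gadd f int1)
    then show "(\<integral>z. kappa n (gadd x z) * f z n - kappa n gzero * (f z n * indicator (cylinder N x) z) \<partial>cantor)
      = mdiff n (\<lambda>z. f z n) x - kappa n gzero / 2 ^ N * avg N (\<lambda>z. f z n) x"
      by (simp add: integral_kappa_gadd(2)[OF f] avg_def)
  qed
  finally show ?thesis
    by (simp add: mpart_def rem_def sum_subtractf)
qed

text \<open>The truncation is constant for radii in each dyadic interval, so the limit over radii
  reduces to a limit over \<open>N\<close>.\<close>

lemma pv_to_from_sequence:
  assumes f: "\<And>n. integrable cantor (\<lambda>z. f z n)"
    and lim: "(\<lambda>N. mpart (\<lambda>n z. f z n) N x - rem (\<lambda>n z. f z n) N x) \<longlonglongrightarrow> c"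
  shows "pv_to f x c"
  unfolding pv_to_def
proof (rule tendstoI)
  fix e :: real assume "0 < e"
  with lim obtain N0 where N0: "\<And>N. N0 \<le> N \<Longrightarrow> dist (mpart (\<lambda>n z. f z n) N x - rem (\<lambda>n z. f z n) N x) c < e"
    by (meson metric_LIMSEQ_D)
  have "eventually (\<lambda>r. r < (1/2::real) ^ N0) (at_right 0)"
    by (intro eventually_at_right_real[THEN eventually_mono] ) auto
  then show "eventually (\<lambda>r. dist (ktrunc f x r) c < e) (at_right 0)"
    using eventually_at_right_less[of "0::real"]
  proof eventually_elim
    case (elim r)
    obtain K where "(1/2::real) ^ K < r" using real_arch_pow_inv[of r "1/2"] elim by auto
    \<comment> \<open>The index of the dyadic interval that contains \<open>r\<close>. Minimality
      gives the upper bound on \<open>r\<close> except for \<open>N = 0\<close>, where smallness of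
      \<open>r\<close> is used.\<close>
    define N where "N = (LEAST N. (1/2::real) ^ Suc N < r)"
    have "(1/2::real) ^ Suc K \<le> (1/2) ^ K" by (intro power_decreasing) auto
    then have "(1/2::real) ^ Suc K < r" using \<open>(1/2::real) ^ K < r\<close> by linarith
    then have 1: "(1/2) ^ Suc N < r" unfolding N_def by (rule LeastI)
    have 2: "r \<le> (1/2) ^ N"
    proof (cases N)
      case 0
      have "(1/2::real) ^ N0 \<le> 1" by (simp add: power_le_one)
      then show ?thesis using elim 0 by simp
    next
      case (Suc m)
      then have "m < N" by simp
      then have "\<not> (1/2) ^ Suc m < r" unfolding N_def by (rule not_less_Least)
      then show ?thesis using Suc by simp
    qed
    have "N0 \<le> N"
    proof (rule ccontr)
      assume "\<not> N0 \<le> N"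
      then have "(1/2::real) ^ N0 \<le> (1/2) ^ Suc N" by (intro power_decreasing) auto
      then show False using 1 elim by linarith
    qed
    then show ?case using N0 ktrunc_eq[OF f 1 2] by simp
  qed
qed

section \<open>Almost everywhere convergence\<close>

definition tail :: "nat \<Rightarrow> (nat \<Rightarrow> (nat \<Rightarrow> bool) \<Rightarrow> real) \<Rightarrow> nat \<Rightarrow> (nat \<Rightarrow> bool) \<Rightarrow> real" where
  "tail M f n = (if n \<le> M then (\<lambda>_. 0) else f n)"

lemma tail_dominated:
  assumes fF: "dominated f F"
  obtains G where "\<And>M. dominated (tail M f) (G M)" "(\<lambda>M. \<integral>x. G M x \<partial>cantor) \<longlonglongrightarrow> 0"
proof -
  \<comment> \<open>The norm of the tail. The modulus keeps it nonnegative also at points where the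
    series diverges.\<close>
  define G where "G M x = sqrt \<bar>\<Sum>n. (f (n + Suc M) x)\<^sup>2\<bar>" for M x
  have [measurable]: "f n \<in> borel_measurable cantor" for n using fF by (auto simp: dominated_def)
  have F: "integrable cantor F" "\<And>x. 0 \<le> F x" using fF by (auto simp: dominated_def)
  have bd: "AE x in cantor. \<forall>N. (\<Sum>n\<le>N. (f n x)\<^sup>2) \<le> (F x)\<^sup>2" using fF by (simp add: dominated_def)
  have sm: "AE x in cantor. summable (\<lambda>n. (f n x)\<^sup>2)"
    using bd
  proof eventually_elim
    case (elim x)
    show ?case
    proof (rule bounded_imp_summable)
      show "(\<Sum>k\<le>n. (f k x)\<^sup>2) \<le> (F x)\<^sup>2" for n using elim by simp
    qed simp
  qed
  have G_le: "AE x in cantor. \<forall>M. G M x \<le> F x"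
    using bd sm
  proof eventually_elim
    case (elim x)
    show ?case
    proof
      fix M
      have s: "summable (\<lambda>n. (f (n + Suc M) x)\<^sup>2)" using elim(2) by (rule summable_ignore_initial_segment)
      have "(\<Sum>n. (f (n + Suc M) x)\<^sup>2) \<le> (F x)\<^sup>2"
      proof (rule suminf_le_const[OF s])
        fix n
        have "(\<Sum>k<n. (f (k + Suc M) x)\<^sup>2) = (\<Sum>k\<in>(\<lambda>k. k + Suc M) ` {..<n}. (f k x)\<^sup>2)"
          by (subst sum.reindex) (auto simp: inj_on_def)
        also have "\<dots> \<le> (\<Sum>k\<le>n + Suc M. (f k x)\<^sup>2)"
          by (intro sum_mono2) auto
        also have "\<dots> \<le> (F x)\<^sup>2" using elim(1) by blast
        finally show "(\<Sum>k<n. (f (k + Suc M) x)\<^sup>2) \<le> (F x)\<^sup>2" .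
      qed
      moreover have "0 \<le> (\<Sum>n. (f (n + Suc M) x)\<^sup>2)" by (rule suminf_nonneg[OF s]) simp
      ultimately show "G M x \<le> F x"
        unfolding G_def using F(2)[of x] by (intro real_le_lsqrt) auto
    qed
  qed
  have G0: "0 \<le> G M x" for M x by (simp add: G_def)
  have [measurable]: "G M \<in> borel_measurable cantor" for M unfolding G_def by measurable
  have G_norm: "AE x in cantor. norm (G M x) \<le> F x" for M
    using G_le by eventually_elim (simp add: G0)
  have intG: "integrable cantor (G M)" for M
  proof (rule Bochner_Integration.integrable_bound[OF F(1)])
    show "AE x in cantor. norm (G M x) \<le> norm (F x)"
      using G_norm[of M] by eventually_elim (use F(2) in simp)
  qed simp
  have "(\<lambda>M. \<integral>x. G M x \<partial>cantor) \<longlonglongrightarrow> (\<integral>x. 0 \<partial>cantor)"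
  proof (rule integral_dominated_convergence[where w=F])
    show "AE x in cantor. (\<lambda>M. G M x) \<longlonglongrightarrow> 0"
      using sm
    proof eventually_elim
      case (elim x)
      have "(\<lambda>M. \<Sum>n. (f (n + M) x)\<^sup>2) \<longlonglongrightarrow> 0"
      proof -
        have "(\<lambda>M. (\<Sum>n. (f n x)\<^sup>2) - (\<Sum>n<M. (f n x)\<^sup>2)) \<longlonglongrightarrow> (\<Sum>n. (f n x)\<^sup>2) - (\<Sum>n. (f n x)\<^sup>2)"
          by (intro tendsto_intros summable_LIMSEQ elim)
        then show ?thesis by (simp add: suminf_minus_initial_segment[OF elim])
      qed
      then have "(\<lambda>M. \<Sum>n. (f (n + Suc M) x)\<^sup>2) \<longlonglongrightarrow> 0" by (rule LIMSEQ_Suc)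
      then have "(\<lambda>M. sqrt \<bar>\<Sum>n. (f (n + Suc M) x)\<^sup>2\<bar>) \<longlonglongrightarrow> sqrt \<bar>0\<bar>"
        by (intro tendsto_intros)
      then show ?case by (simp add: G_def)
    qed
  qed (use F G_norm in auto)
  then have lim: "(\<lambda>M. \<integral>x. G M x \<partial>cantor) \<longlonglongrightarrow> 0" by simp
  have "dominated (tail M f) (G M)" for M
    unfolding dominated_def
  proof (intro conjI allI)
    show "tail M f n \<in> borel_measurable cantor" for n by (simp add: tail_def)
    show "AE x in cantor. \<forall>N. (\<Sum>n\<le>N. (tail M f n x)\<^sup>2) \<le> (G M x)\<^sup>2"
      using sm
    proof eventually_elim
      case (elim x)
      have s: "summable (\<lambda>n. (f (n + Suc M) x)\<^sup>2)" using elim by (rule summable_ignore_initial_segment)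
      have G2: "(G M x)\<^sup>2 = (\<Sum>n. (f (n + Suc M) x)\<^sup>2)"
        unfolding G_def using suminf_nonneg[OF s] by simp
      show ?case
      proof
        fix N
        have "(\<Sum>n\<le>N. (tail M f n x)\<^sup>2) = (\<Sum>n\<in>{Suc M..N}. (f n x)\<^sup>2)"
          by (rule sum.mono_neutral_cong_right) (auto simp: tail_def)
        also have "\<dots> \<le> (\<Sum>n\<in>(\<lambda>k. k + Suc M) ` {..<N}. (f n x)\<^sup>2)"
        proof (rule sum_mono2)
          show "{Suc M..N} \<subseteq> (\<lambda>k. k + Suc M) ` {..<N}"
          proof
            fix n assume "n \<in> {Suc M..N}"
            then have "n = (n - Suc M) + Suc M" "n - Suc M \<in> {..<N}" by auto
            then show "n \<in> (\<lambda>k. k + Suc M) ` {..<N}" by (rule image_eqI)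
          qed
        qed auto
        also have "\<dots> = (\<Sum>k<N. (f (k + Suc M) x)\<^sup>2)" by (subst sum.reindex) (auto simp: inj_on_def)
        also have "\<dots> \<le> (\<Sum>n. (f (n + Suc M) x)\<^sup>2)"
          by (rule sum_le_suminf[OF s]) auto
        finally show "(\<Sum>n\<le>N. (tail M f n x)\<^sup>2) \<le> (G M x)\<^sup>2" by (simp add: G2)
      qed
    qed
  qed (use intG G0 in auto)
  then show thesis using lim that by blast
qed

text \<open>For fixed \<open>e\<close> the exceptional sets of measure at most 1/(j+1) intersect in
  a null set; monotonicity reduces all positive \<open>e\<close> to countably many.\<close>

lemma AE_of_small_exceptions:
  assumes ex: "\<And>e d. 0 < e \<Longrightarrow> 0 < d \<Longrightarrow> \<exists>B\<in>sets cantor. measure cantor B \<le> d \<and> (\<forall>x. x \<notin> B \<longrightarrow> P e x)"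
    and mono: "\<And>e e' x. P e x \<Longrightarrow> e \<le> e' \<Longrightarrow> P e' x"
  shows "AE x in cantor. \<forall>e>0. P (e::real) x"
proof -
  have "AE x in cantor. P (inverse (real (Suc i))) x" for i
  proof -
    have "\<exists>B. \<forall>j. B j \<in> sets cantor \<and> measure cantor (B j) \<le> inverse (real (Suc j))
        \<and> (\<forall>x. x \<notin> B j \<longrightarrow> P (inverse (real (Suc i))) x)"
      by (rule choice) (use ex[of "inverse (real (Suc i))" "inverse (real (Suc _))"] in auto)
    then obtain B where B: "\<And>j. B j \<in> sets cantor" "\<And>j. measure cantor (B j) \<le> inverse (real (Suc j))"
      "\<And>j x. x \<notin> B j \<Longrightarrow> P (inverse (real (Suc i))) x" by blast
    have m: "(\<Inter>j. B j) \<in> sets cantor" using B(1) by auto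
    have "measure cantor (\<Inter>j. B j) \<le> inverse (real (Suc j))" for j
      using cantor.finite_measure_mono[of "\<Inter>j. B j" "B j"] B(1,2)[of j] by (auto intro: order_trans)
    then have "measure cantor (\<Inter>j. B j) \<le> 0"
      by (intro LIMSEQ_le_const[OF LIMSEQ_inverse_real_of_nat]) auto
    then have "measure cantor (\<Inter>j. B j) = 0" using measure_nonneg[of cantor "\<Inter>j. B j"] by linarith
    then have "(\<Inter>j. B j) \<in> null_sets cantor"
      using m by (simp add: null_sets_def cantor.emeasure_eq_measure)
    then show ?thesis
      by (rule AE_I') (use B(3) in auto)
  qed
  then have "AE x in cantor. \<forall>i. P (inverse (real (Suc i))) x" by (simp add: AE_all_countable)
  then show ?thesis
  proof eventually_elim
    case (elim x)
    show ?case
    proof (intro allI impI)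
      fix e :: real assume "0 < e"
      then obtain i where "inverse (real (Suc i)) < e" using reals_Archimedean by blast
      then show "P e x" using elim mono by (meson less_imp_le)
    qed
  qed
qed

lemma measure_ex_le:
  fixes P :: "nat \<Rightarrow> (nat \<Rightarrow> bool) \<Rightarrow> bool"
  assumes [measurable]: "\<And>n. Measurable.pred cantor (P n)"
    and "\<And>N. c * measure cantor {x. \<exists>n\<le>N. P n x} \<le> (K::real)"
  shows "{x. \<exists>n. P n x} \<in> sets cantor" "c * measure cantor {x. \<exists>n. P n x} \<le> K"
proof -
  have "{x \<in> space cantor. \<exists>n. P n x} \<in> sets cantor"
    by (intro sets.sets_Collect_countable_Ex) measurable
  then show "{x. \<exists>n. P n x} \<in> sets cantor" by simp
  have "{x \<in> space cantor. \<exists>n\<in>{..N}. P n x} \<in> sets cantor" for N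
    by (intro sets.sets_Collect_finite_Ex) measurable
  then have "{x. \<exists>n\<le>N. P n x} \<in> sets cantor" for N by (simp add: Bex_def)
  then have "(\<lambda>N. measure cantor {x. \<exists>n\<le>N. P n x}) \<longlonglongrightarrow> measure cantor (\<Union>N. {x. \<exists>n\<le>N. P n x})"
    by (intro cantor.finite_Lim_measure_incseq) (auto simp: incseq_def intro: order_trans)
  moreover have "(\<Union>N. {x. \<exists>n\<le>N. P n x}) = {x. \<exists>n. P n x}" by auto
  ultimately have "(\<lambda>N. c * measure cantor {x. \<exists>n\<le>N. P n x}) \<longlonglongrightarrow> c * measure cantor {x. \<exists>n. P n x}"
    by (auto intro: tendsto_intros)
  then show "c * measure cantor {x. \<exists>n. P n x} \<le> K"
    by (rule LIMSEQ_le_const2) (use assms in auto)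
qed

lemma weak_type_mpart_sup:
  obtains C where "1 \<le> C" "\<And>f F lam. dominated f F \<Longrightarrow> 0 < lam \<Longrightarrow> {x. \<exists>n. lam < \<bar>mpart f n x\<bar>} \<in> sets cantor"
    "\<And>f F lam. dominated f F \<Longrightarrow> 0 < lam \<Longrightarrow>
    lam * measure cantor {x. \<exists>n. lam < \<bar>mpart f n x\<bar>} \<le> C * (\<integral>x. F x \<partial>cantor)"
proof -
  obtain C where C: "1 \<le> C" "\<And>f F lam N. dominated f F \<Longrightarrow> 0 < lam \<Longrightarrow>
    lam * measure cantor {x. \<exists>n\<le>N. lam < \<bar>mpart f n x\<bar>} \<le> C * (\<integral>x. F x \<partial>cantor)"
    by (rule weak_type_mpart) blast
  show thesis
  proof (rule that[OF C(1)])
    fix f F lam assume a: "dominated f F" "0 < (lam::real)"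
    have p: "Measurable.pred cantor (\<lambda>x. lam < \<bar>mpart f n x\<bar>)" for n by measurable
    show "{x. \<exists>n. lam < \<bar>mpart f n x\<bar>} \<in> sets cantor"
      "lam * measure cantor {x. \<exists>n. lam < \<bar>mpart f n x\<bar>} \<le> C * (\<integral>x. F x \<partial>cantor)"
      using measure_ex_le[of "\<lambda>n x. lam < \<bar>mpart f n x\<bar>", OF p C(2)[OF a]] by blast+
  qed
qed

lemma weak_type_avg_sup:
  assumes F: "integrable cantor F" "\<And>x. 0 \<le> F x" and lam: "0 < lam"
  shows "{x. \<exists>j. lam < avg j F x} \<in> sets cantor"
    "lam * measure cantor {x. \<exists>j. lam < avg j F x} \<le> (\<integral>x. F x \<partial>cantor)"
proof -
  have p: "Measurable.pred cantor (\<lambda>x. lam < avg n F x)" for n by measurable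
  show "{x. \<exists>j. lam < avg j F x} \<in> sets cantor"
    "lam * measure cantor {x. \<exists>j. lam < avg j F x} \<le> (\<integral>x. F x \<partial>cantor)"
    using measure_ex_le[of "\<lambda>j x. lam < avg j F x", OF p weak_type_avg[OF F lam]] by blast+
qed

lemma mpart_tail:
  assumes "M \<le> n" shows "mpart f n x = mpart f M x + mpart (tail M f) n x"
proof -
  have 0: "mdiff k (\<lambda>_. 0) x = 0" for k by (simp add: mdiff_def avg_def)
  have "mpart f n x = (\<Sum>k\<le>n. (if k \<le> M then mdiff k (f k) x else 0) + mdiff k (tail M f k) x)"
    unfolding mpart_def by (intro sum.cong) (auto simp: tail_def 0)
  also have "\<dots> = (\<Sum>k\<le>n. if k \<le> M then mdiff k (f k) x else 0) + mpart (tail M f) n x"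
    by (simp add: sum.distrib mpart_def)
  also have "(\<Sum>k\<le>n. if k \<le> M then mdiff k (f k) x else 0) = mpart f M x"
    unfolding mpart_def by (rule sum.mono_neutral_cong_right) (use assms in auto)
  finally show ?thesis .
qed

text \<open>After index \<open>M\<close> the sums move only by those of \<open>tail M f\<close>.
  Their maximal function exceeds \<open>e\<close> on a set of measure at most a constant times the
  integral of \<open>G M\<close>, divided by \<open>e\<close>; this is small for large
  \<open>M\<close>.\<close>

lemma mpart_convergent_AE:
  assumes fF: "dominated f F" shows "AE x in cantor. convergent (\<lambda>n. mpart f n x)"
proof -
  obtain C where C: "1 \<le> C" "\<And>f F lam. dominated f F \<Longrightarrow> 0 < lam \<Longrightarrow> {x. \<exists>n. lam < \<bar>mpart f n x\<bar>} \<in> sets cantor"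
    "\<And>f F lam. dominated f F \<Longrightarrow> 0 < lam \<Longrightarrow>
    lam * measure cantor {x. \<exists>n. lam < \<bar>mpart f n x\<bar>} \<le> C * (\<integral>x. F x \<partial>cantor)"
    by (rule weak_type_mpart_sup) blast
  obtain G where G: "\<And>M. dominated (tail M f) (G M)" "(\<lambda>M. \<integral>x. G M x \<partial>cantor) \<longlonglongrightarrow> 0"
    by (rule tail_dominated[OF fF]) blast
  have "AE x in cantor. \<forall>e>0. \<exists>M. \<forall>n\<ge>M. \<bar>mpart f n x - mpart f M x\<bar> \<le> e"
  proof (rule AE_of_small_exceptions)
    fix e d :: real assume e: "0 < e" and d: "0 < d"
    have "(\<lambda>M. C * (\<integral>x. G M x \<partial>cantor)) \<longlonglongrightarrow> C * 0" by (intro tendsto_intros G)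
    then have "eventually (\<lambda>M. C * (\<integral>x. G M x \<partial>cantor) < e * d) sequentially"
      by (rule order_tendstoD) (use e d in simp)
    then obtain M where M: "C * (\<integral>x. G M x \<partial>cantor) < e * d"
      by (auto simp: eventually_sequentially)
    let ?B = "{x. \<exists>n. e < \<bar>mpart (tail M f) n x\<bar>}"
    have "e * measure cantor ?B \<le> e * d" using C(3)[OF G(1) e, of M] M by linarith
    then have "measure cantor ?B \<le> d" using e by simp
    moreover have "\<bar>mpart f n x - mpart f M x\<bar> \<le> e" if "x \<notin> ?B" "M \<le> n" for x n
      using that mpart_tail[OF that(2), of f x] by (auto simp: not_less)
    ultimately show "\<exists>B\<in>sets cantor. measure cantor B \<le> d \<and>
        (\<forall>x. x \<notin> B \<longrightarrow> (\<exists>M. \<forall>n\<ge>M. \<bar>mpart f n x - mpart f M x\<bar> \<le> e))"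
      using C(2)[OF G(1) e, of M] by blast
  qed (meson order_trans)
  then show ?thesis
  proof eventually_elim
    case (elim x)
    have "Cauchy (\<lambda>n. mpart f n x)"
    proof (rule metric_CauchyI)
      fix e :: real assume "0 < e"
      then obtain M where M: "\<And>n. n \<ge> M \<Longrightarrow> \<bar>mpart f n x - mpart f M x\<bar> \<le> e / 3"
        using elim[rule_format, of "e / 3"] by auto
      show "\<exists>M. \<forall>m\<ge>M. \<forall>n\<ge>M. dist (mpart f m x) (mpart f n x) < e"
      proof (intro exI[of _ M] allI impI)
        fix m n assume "m \<ge> M" "n \<ge> M"
        then show "dist (mpart f m x) (mpart f n x) < e"
          using M[of m] M[of n] \<open>0 < e\<close> unfolding dist_real_def by linarith
      qed
    qed
    then show ?case by (simp add: Cauchy_convergent_iff)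
  qed
qed

section \<open>Vanishing of the remainder\<close>

lemma kappa_gzero: "kappa n gzero = (if n = 0 then 1 else 2 ^ (n - 1))"
  by (simp add: kappa_def)

text \<open>Makes \<open>rem f N x\<close> a weighted mean of the averages, with weights of total
  mass 1.\<close>

lemma sum_kappa_gzero: "(\<Sum>n\<le>N. kappa n gzero) = 2 ^ N"
  by (induction N) (auto simp: kappa_gzero)

lemma avg_abs_le_dominated:
  assumes "dominated f F" shows "\<bar>avg N (f n) x\<bar> \<le> avg N F x"
proof -
  have "\<bar>avg N (f n) x\<bar> \<le> avg N (\<lambda>z. \<bar>f n z\<bar>) x"
    by (rule avg_abs_le[OF dominated_integrable[OF assms]])
  also have "\<dots> \<le> avg N F x"
    using dominated_abs_le[OF assms] dominated_integrable[OF assms] assms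
    by (intro avg_mono) (auto simp: dominated_def)
  finally show ?thesis .
qed

text \<open>The components up to \<open>M\<close> carry weight \<open>2 ^ M / 2 ^ N\<close> only,
  which dies out as \<open>N\<close> grows; the others are charged to the small majorant
  \<open>G\<close>.\<close>

lemma rem_tail_le:
  assumes fF: "dominated f F" and gG: "dominated (tail M f) G" and "M \<le> N"
  shows "\<bar>rem f N x\<bar> \<le> 2 ^ M / 2 ^ N * avg N F x + avg N G x"
proof -
  have k0: "0 \<le> kappa n gzero" for n by (simp add: kappa_gzero)
  have "\<bar>rem f N x\<bar> \<le> (\<Sum>n\<le>N. \<bar>kappa n gzero / 2 ^ N * avg N (f n) x\<bar>)"
    unfolding rem_def by (rule sum_abs)
  also have "\<dots> \<le> (\<Sum>n\<le>N. (if n \<le> M then kappa n gzero / 2 ^ N * avg N F x else 0)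
      + kappa n gzero / 2 ^ N * avg N G x)"
  proof (rule sum_mono)
    fix n
    have "\<bar>avg N (f n) x\<bar> \<le> (if n \<le> M then avg N F x else 0) + avg N G x"
      using avg_abs_le_dominated[OF fF, of N n x] avg_abs_le_dominated[OF gG, of N n x]
      by (auto simp: tail_def)
    then have "kappa n gzero / 2 ^ N * \<bar>avg N (f n) x\<bar>
        \<le> kappa n gzero / 2 ^ N * ((if n \<le> M then avg N F x else 0) + avg N G x)"
      by (intro mult_left_mono) (auto simp: k0)
    then show "\<bar>kappa n gzero / 2 ^ N * avg N (f n) x\<bar> \<le> (if n \<le> M then kappa n gzero / 2 ^ N * avg N F x else 0)
      + kappa n gzero / 2 ^ N * avg N G x"
      using k0[of n] by (auto simp: abs_mult distrib_left)
  qed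
  also have "\<dots> = (\<Sum>n\<le>M. kappa n gzero / 2 ^ N * avg N F x) + (\<Sum>n\<le>N. kappa n gzero / 2 ^ N * avg N G x)"
    unfolding sum.distrib
    by (rule arg_cong2[where f="(+)"], rule sum.mono_neutral_cong_right) (use assms(3) in auto)
  also have "\<dots> = 2 ^ M / 2 ^ N * avg N F x + avg N G x"
    by (simp add: sum_distrib_right[symmetric] sum_divide_distrib[symmetric] sum_kappa_gzero)
  finally show ?thesis .
qed

lemma rem_tendsto_0_AE:
  assumes fF: "dominated f F" shows "AE x in cantor. (\<lambda>N. rem f N x) \<longlonglongrightarrow> 0"
proof -
  have F: "integrable cantor F" "\<And>x. 0 \<le> F x" using fF by (auto simp: dominated_def)
  obtain G where G: "\<And>M. dominated (tail M f) (G M)" "(\<lambda>M. \<integral>x. G M x \<partial>cantor) \<longlonglongrightarrow> 0"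
    by (rule tail_dominated[OF fF]) blast
  have "AE x in cantor. \<forall>e>0. \<exists>N0. \<forall>N\<ge>N0. \<bar>rem f N x\<bar> \<le> e"
  proof (rule AE_of_small_exceptions)
    fix e d :: real assume e: "0 < e" and d: "0 < d"
    have "eventually (\<lambda>M. (\<integral>x. G M x \<partial>cantor) < (e / 2) * (d / 2)) sequentially"
      using G(2) by (rule order_tendstoD) (use e d in simp)
    then obtain M where M: "(\<integral>x. G M x \<partial>cantor) < (e / 2) * (d / 2)"
      by (auto simp: eventually_sequentially)
    have GM: "integrable cantor (G M)" "\<And>x. 0 \<le> G M x" using G(1)[of M] by (auto simp: dominated_def)
    have F0: "0 \<le> (\<integral>x. F x \<partial>cantor)" by (rule Bochner_Integration.integral_nonneg) (rule F(2))
    \<comment> \<open>Chosen so that the averages of \<open>F\<close> stay below \<open>K\<close>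
      outside a set of measure at most \<open>d / 2\<close>; the added 1 keeps \<open>K\<close>
      positive.\<close>
    define K where "K = ((\<integral>x. F x \<partial>cantor) + 1) / (d / 2)"
    have K: "0 < K" using F0 d by (simp add: K_def)
    let ?A = "{x. \<exists>j. K < avg j F x}" and ?B = "{x. \<exists>j. e / 2 < avg j (G M) x}"
    have sets: "?A \<in> sets cantor" "?B \<in> sets cantor"
      using weak_type_avg_sup(1)[OF F K] weak_type_avg_sup(1)[OF GM, of "e / 2"] e by auto
    have "K * (d / 2) = (\<integral>x. F x \<partial>cantor) + 1" using d by (simp add: K_def)
    then have "K * measure cantor ?A \<le> K * (d / 2)"
      using weak_type_avg_sup(2)[OF F K] by linarith
    then have A: "measure cantor ?A \<le> d / 2" using K by simp
    have "(e / 2) * measure cantor ?B \<le> (e / 2) * (d / 2)"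
      using weak_type_avg_sup(2)[OF GM, of "e / 2"] e M by linarith
    then have B: "measure cantor ?B \<le> d / 2" using e by simp
    have "measure cantor (?A \<union> ?B) \<le> d"
      using measure_Un_le[OF sets] A B by simp
    moreover have "\<exists>N0. \<forall>N\<ge>N0. \<bar>rem f N x\<bar> \<le> e" if "x \<notin> ?A \<union> ?B" for x
    proof -
      have "(\<lambda>N. 2 ^ M * K * (1/2) ^ N) \<longlonglongrightarrow> 2 ^ M * K * 0"
        by (intro tendsto_intros LIMSEQ_realpow_zero) auto
      then have "eventually (\<lambda>N. 2 ^ M * K * (1/2) ^ N < e / 2) sequentially"
        by (rule order_tendstoD) (use e in simp)
      then obtain N1 where N1: "\<And>N. N1 \<le> N \<Longrightarrow> 2 ^ M * K * (1/2) ^ N < e / 2"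
        by (auto simp: eventually_sequentially)
      show ?thesis
      proof (intro exI[of _ "max M N1"] allI impI)
        fix N assume N: "max M N1 \<le> N"
        have "\<bar>rem f N x\<bar> \<le> 2 ^ M / 2 ^ N * avg N F x + avg N (G M) x"
          by (rule rem_tail_le[OF fF G(1)]) (use N in simp)
        also have "2 ^ M / 2 ^ N * avg N F x \<le> 2 ^ M / 2 ^ N * K"
          using that by (intro mult_left_mono) (auto simp: not_less)
        also have "\<dots> = 2 ^ M * K * (1/2) ^ N" by (simp add: power_divide)
        also have "\<dots> \<le> e / 2" using N1[of N] N by simp
        also have "avg N (G M) x \<le> e / 2" using that by (auto simp: not_less)
        finally show "\<bar>rem f N x\<bar> \<le> e" by simp
      qed
    qed
    ultimately show "\<exists>B\<in>sets cantor. measure cantor B \<le> d \<and> (\<forall>x. x \<notin> B \<longrightarrow> (\<exists>N0. \<forall>N\<ge>N0. \<bar>rem f N x\<bar> \<le> e))"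
      using sets by (intro bexI[of _ "?A \<union> ?B"]) auto
  qed (meson order_trans)
  then show ?thesis
  proof eventually_elim
    case (elim x)
    show ?case
    proof (rule LIMSEQ_I)
      fix r :: real assume "0 < r"
      then obtain N0 where "\<forall>N\<ge>N0. \<bar>rem f N x\<bar> \<le> r / 2" using elim[rule_format, of "r / 2"] by auto
      then show "\<exists>N0. \<forall>N\<ge>N0. norm (rem f N x - 0) < r"
        using \<open>0 < r\<close> by (intro exI[of _ N0]) force
    qed
  qed
qed

section \<open>Strong type estimates\<close>

text \<open>Convexity of the power function, derived from Young's inequality with exponents
  \<open>s\<close> and \<open>s / (s - 1)\<close> instead of derivatives.\<close>

lemma powr_tangent:
  fixes x y :: real
  assumes "0 \<le> x" "0 \<le> y" "1 < s"
  shows "y powr s + s * y powr (s - 1) * (x - y) \<le> x powr s"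
proof -
  have "x * y powr (s - 1) \<le> x powr s / s + (y powr (s - 1)) powr (s / (s - 1)) / (s / (s - 1))"
    using assms by (intro Youngs_inequality) (auto simp: field_simps)
  also have "\<dots> = x powr s / s + y powr s * ((s - 1) / s)"
    using assms by (simp add: powr_powr)
  finally have "s * (x * y powr (s - 1)) \<le> s * (x powr s / s + y powr s * ((s - 1) / s))"
    using assms by (intro mult_left_mono) auto
  then have "s * y powr (s - 1) * x \<le> x powr s + y powr s * (s - 1)"
    using assms by (simp add: distrib_left mult_ac)
  moreover have "y powr (s - 1) * y = y powr s"
    using assms by (cases "y = 0") (auto simp: powr_diff)
  ultimately show ?thesis by (simp add: algebra_simps)
qed

lemma powr_mult_self:
  fixes x :: real assumes "0 \<le> x" shows "x powr (s - 1) * x = x powr s"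
  using assms by (cases "x = 0") (auto simp: powr_diff)

text \<open>Since \<open>w\<close> is predictable at \<open>k\<close>, the left side is the weighted
  pairing of \<open>h - avg (k - 1) h\<close> with \<open>h\<close>. It falls short of the right
  side by the weighted integral of the square of \<open>avg (k - 1) h\<close>; for
  \<open>k = 0\<close> nothing is subtracted.\<close>

lemma integral_mult_sum_mdiff_sq_le:
  assumes w: "adapted (k - 1) w" "\<And>x. 0 \<le> w x" and h: "adapted N h"
  shows "(\<integral>x. w x * (\<Sum>n\<in>{k..N}. (mdiff n h x)\<^sup>2) \<partial>cantor) \<le> (\<integral>x. w x * (h x)\<^sup>2 \<partial>cantor)"
proof (cases "k \<le> N")
  case False
  then show ?thesis using w by (auto intro!: Bochner_Integration.integral_nonneg)
next
  case True
  have ih: "integrable cantor h" using h by (rule adapted_integrable)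
  have w': "adapted n w" if "k - 1 \<le> n" for n using w(1) that by (rule adapted_mono)
  have iwh: "integrable cantor (\<lambda>x. (w x * mdiff n h x) * h x)" if "k \<le> n" for n
    by (rule adapted_mult_integrable[of n]) (use that ih w' in \<open>auto intro!: adapted_mult\<close>)
  have swap: "(\<integral>x. w x * (mdiff n h x)\<^sup>2 \<partial>cantor) = (\<integral>x. (w x * mdiff n h x) * h x \<partial>cantor)" if "k \<le> n" for n
  proof -
    have wn: "adapted (n - 1) w" by (rule w') (use that in simp)
    have ad: "adapted n (\<lambda>x. w x * mdiff n h x)" by (intro adapted_mult w' adapted_mdiff) (use that in auto)
    have "(\<integral>x. w x * (mdiff n h x)\<^sup>2 \<partial>cantor) = (\<integral>x. (w x * mdiff n h x) * mdiff n h x \<partial>cantor)"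
      by (simp add: power2_eq_square mult_ac)
    also have "\<dots> = (\<integral>x. (w x * mdiff n h x) * h x \<partial>cantor)"
      using mdiff_swap[OF adapted_integrable[OF ad] ih, of n] mdiff_mult_mdiff[OF wn ih, of n] by simp
    finally show ?thesis .
  qed
  have i1: "integrable cantor (\<lambda>x. w x * (mdiff n h x)\<^sup>2)" if "k \<le> n" for n
    by (rule adapted_integrable[of n]) (use that in \<open>auto intro!: adapted_mult adapted_power w'\<close>)
  have "(\<integral>x. w x * (\<Sum>n\<in>{k..N}. (mdiff n h x)\<^sup>2) \<partial>cantor) = (\<Sum>n\<in>{k..N}. \<integral>x. w x * (mdiff n h x)\<^sup>2 \<partial>cantor)"
    unfolding sum_distrib_left by (rule Bochner_Integration.integral_sum) (use i1 in auto)
  also have "\<dots> = (\<Sum>n\<in>{k..N}. \<integral>x. (w x * mdiff n h x) * h x \<partial>cantor)"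
    by (intro sum.cong swap) auto
  also have "\<dots> = (\<integral>x. (\<Sum>n\<in>{k..N}. (w x * mdiff n h x) * h x) \<partial>cantor)"
    by (rule Bochner_Integration.integral_sum[symmetric]) (use iwh in auto)
  also have "\<dots> = (\<integral>x. w x * (\<Sum>n\<in>{k..N}. mdiff n h x) * h x \<partial>cantor)"
    by (simp add: sum_distrib_left sum_distrib_right mult_ac)
  also have "\<dots> \<le> (\<integral>x. w x * (h x)\<^sup>2 \<partial>cantor)"
  proof (cases "k = 0")
    case True
    then show ?thesis
      by (simp add: sum_mdiff avg_adapted[OF h] atLeast0AtMost power2_eq_square mult_ac)
  next
    case False
    have D: "(\<Sum>n\<in>{k..N}. mdiff n h x) = h x - avg (k - 1) h x" for x
    proof -
      have "(\<Sum>n\<le>N. mdiff n h x) = (\<Sum>n\<le>k - 1. mdiff n h x) + (\<Sum>n\<in>{k..N}. mdiff n h x)"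
        using True False by (subst sum.union_disjoint[symmetric]) (auto intro!: sum.cong)
      then show ?thesis by (simp add: sum_mdiff avg_adapted[OF h])
    qed
    have e: "adapted (k - 1) (\<lambda>x. w x * avg (k - 1) h x)" by (intro adapted_mult w(1) adapted_avg) simp
    have i2: "integrable cantor (\<lambda>x. w x * (h x)\<^sup>2)"
      by (rule adapted_integrable[of N]) (use True in \<open>auto intro!: adapted_mult adapted_power w' h\<close>)
    have i3: "integrable cantor (\<lambda>x. (w x * avg (k - 1) h x) * h x)"
      by (rule adapted_mult_integrable[OF e ih])
    have "(\<integral>x. w x * (\<Sum>n\<in>{k..N}. mdiff n h x) * h x \<partial>cantor)
        = (\<integral>x. w x * (h x)\<^sup>2 - (w x * avg (k - 1) h x) * h x \<partial>cantor)"
      by (simp add: D algebra_simps power2_eq_square)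
    also have "\<dots> = (\<integral>x. w x * (h x)\<^sup>2 \<partial>cantor) - (\<integral>x. (w x * avg (k - 1) h x) * avg (k - 1) h x \<partial>cantor)"
      using i2 i3 integral_avg_mult[OF e ih] by simp
    also have "\<dots> \<le> (\<integral>x. w x * (h x)\<^sup>2 \<partial>cantor)"
      using w(2) by (simp add: mult.assoc Bochner_Integration.integral_nonneg)
    finally show ?thesis .
  qed
  finally show ?thesis .
qed

text \<open>Abel summation against the predictable increasing process of partial square sums; the
  factor that has to be absorbed is finite because \<open>h\<close> depends on finitely many coordinates.\<close>
lemma square_function_bound:
  assumes r: "1 < (r::real)"
  obtains C where "0 < C" "\<And>N h. adapted N h \<Longrightarrow>
    (\<integral>x. (\<Sum>n\<le>N. (mdiff n h x)\<^sup>2) powr r \<partial>cantor) \<le> C * (\<integral>x. ((h x)\<^sup>2) powr r \<partial>cantor)"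
proof -
  \<comment> \<open>Makes \<open>r * e\<close> equal to 1/2 in the final absorption.\<close>
  define e where "e = 1 / (2 * r)"
  have e: "0 < e" using r by (simp add: e_def)
  define K where "K = e powr (- (r - 1))"
  have K: "0 < K" using e by (simp add: K_def)
  have "(\<integral>x. (\<Sum>n\<le>N. (mdiff n h x)\<^sup>2) powr r \<partial>cantor) \<le> (2 * r * K) * (\<integral>x. ((h x)\<^sup>2) powr r \<partial>cantor)"
    if h: "adapted N h" for N h
  proof -
    have ih: "integrable cantor h" using h by (rule adapted_integrable)
    define A where "A n x = (\<Sum>k\<le>n. (mdiff k h x)\<^sup>2)" for n x
    have A0: "0 \<le> A n x" for n x by (simp add: A_def sum_nonneg)
    have ad2: "adapted (n - 1) (\<lambda>x. (mdiff n h x)\<^sup>2)" for n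
      using adapted_power[OF adapted_abs_mdiff[OF ih], of n 2] by simp
    have adA: "adapted (n - 1) (A n)" for n
      unfolding A_def[abs_def] by (intro adapted_sum adapted_mono[OF ad2]) auto
    define w where "w k x = (if k = 0 then A 0 x powr (r - 1) else A k x powr (r - 1) - A (k - 1) x powr (r - 1))" for k x
    have wsum: "(\<Sum>k\<le>n. w k x) = A n x powr (r - 1)" for n x
      by (induction n) (auto simp: w_def)
    have w0: "0 \<le> w k x" for k x
    proof (cases k)
      case (Suc j)
      have "A j x powr (r - 1) \<le> A (Suc j) x powr (r - 1)"
        using r A0 by (intro powr_mono2) (auto simp: A_def)
      then show ?thesis using Suc by (simp add: w_def)
    qed (simp add: w_def)
    \<comment> \<open>The weight contains the square of the difference at time \<open>k\<close>, yet
      it depends on \<open>k - 1\<close> coordinates only; the preceding conditional estimate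
      therefore applies with no extra term.\<close>
    have adw: "adapted (k - 1) (w k)" for k
    proof (cases k)
      case 0
      then show ?thesis using adA[of 0] by (simp add: w_def[abs_def] adapted_powr)
    next
      case (Suc j)
      have "adapted j (A j)" by (rule adapted_mono[OF adA]) simp
      moreover have "adapted j (A (Suc j))" using adA[of "Suc j"] by simp
      ultimately show ?thesis using Suc by (simp add: w_def[abs_def] adapted_powr adapted_diff)
    qed
    \<comment> \<open>Telescoping: the tangent at the later value bounds each increment of
      \<open>A powr r\<close> from above.\<close>
    have path: "A n x powr r \<le> r * (\<Sum>k\<le>n. A k x powr (r - 1) * (mdiff k h x)\<^sup>2)" for n x
    proof (induction n)
      case 0
      have "A 0 x powr (r - 1) * A 0 x = A 0 x powr r" by (rule powr_mult_self[OF A0])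
      then have "A 0 x powr (r - 1) * (mdiff 0 h x)\<^sup>2 = A 0 x powr r" by (simp add: A_def)
      moreover have "1 * A 0 x powr r \<le> r * A 0 x powr r" using r by (intro mult_right_mono) auto
      ultimately show ?case by simp
    next
      case (Suc n)
      have "A (Suc n) x powr r + r * A (Suc n) x powr (r - 1) * (A n x - A (Suc n) x) \<le> A n x powr r"
        by (rule powr_tangent[OF A0 A0 r])
      moreover have "A n x - A (Suc n) x = - (mdiff (Suc n) h x)\<^sup>2" by (simp add: A_def)
      ultimately show ?case using Suc by (simp add: distrib_left mult_ac)
    qed
    have adA': "adapted N (A n)" if "n \<le> N" for n
      by (rule adapted_mono[OF adA]) (use that in simp)
    have adw': "adapted N (w k)" if "k \<le> N" for k
      by (rule adapted_mono[OF adw]) (use that in simp)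
    have iA: "integrable cantor (\<lambda>x. A N x powr r)"
      by (rule adapted_integrable[of N]) (intro adapted_powr adA' order_refl)
    have ih2: "integrable cantor (\<lambda>x. ((h x)\<^sup>2) powr r)"
      by (rule adapted_integrable[of N]) (intro adapted_powr adapted_power h)
    have iAh: "integrable cantor (\<lambda>x. A N x powr (r - 1) * (h x)\<^sup>2)"
      by (rule adapted_integrable[of N]) (intro adapted_mult adapted_power adapted_powr h adA' order_refl)
    have abel: "(\<Sum>k\<le>N. A k x powr (r - 1) * (mdiff k h x)\<^sup>2) = (\<Sum>k\<le>N. w k x * (\<Sum>n\<in>{k..N}. (mdiff n h x)\<^sup>2))" for x
    proof -
      have "(\<Sum>n\<le>N. A n x powr (r - 1) * (mdiff n h x)\<^sup>2) = (\<Sum>n\<le>N. \<Sum>k\<le>n. w k x * (mdiff n h x)\<^sup>2)"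
        by (simp add: wsum[symmetric] sum_distrib_right)
      also have "\<dots> = (\<Sum>n\<in>{..N}. \<Sum>k\<in>{k. k \<in> {..N} \<and> k \<le> n}. w k x * (mdiff n h x)\<^sup>2)"
        by (intro sum.cong) auto
      also have "\<dots> = (\<Sum>k\<in>{..N}. \<Sum>n\<in>{n. n \<in> {..N} \<and> k \<le> n}. w k x * (mdiff n h x)\<^sup>2)"
        by (rule sum.swap_restrict) auto
      also have "\<dots> = (\<Sum>k\<le>N. \<Sum>n\<in>{k..N}. w k x * (mdiff n h x)\<^sup>2)"
        by (intro sum.cong) auto
      finally show ?thesis by (simp add: sum_distrib_left)
    qed
    have i4: "integrable cantor (\<lambda>x. w k x * (\<Sum>n\<in>{k..N}. (mdiff n h x)\<^sup>2))" if "k \<le> N" for k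
      by (rule adapted_integrable[of N]) (use that in \<open>auto intro!: adapted_mult adapted_sum adapted_power adw'\<close>)
    have i5: "integrable cantor (\<lambda>x. w k x * (h x)\<^sup>2)" if "k \<le> N" for k
      by (rule adapted_integrable[of N]) (use that in \<open>auto intro!: adapted_mult adapted_power adw' h\<close>)
    have "(\<integral>x. A N x powr r \<partial>cantor) \<le> (\<integral>x. r * (\<Sum>k\<le>N. w k x * (\<Sum>n\<in>{k..N}. (mdiff n h x)\<^sup>2)) \<partial>cantor)"
    proof (rule integral_mono[OF iA])
      show "integrable cantor (\<lambda>x. r * (\<Sum>k\<le>N. w k x * (\<Sum>n\<in>{k..N}. (mdiff n h x)\<^sup>2)))"
        by (intro integrable_mult_right Bochner_Integration.integrable_sum i4) auto
      show "A N x powr r \<le> r * (\<Sum>k\<le>N. w k x * (\<Sum>n\<in>{k..N}. (mdiff n h x)\<^sup>2))" for x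
        using path[of N x] by (simp add: abel)
    qed
    also have "\<dots> = r * (\<Sum>k\<le>N. \<integral>x. w k x * (\<Sum>n\<in>{k..N}. (mdiff n h x)\<^sup>2) \<partial>cantor)"
      by (subst integral_mult_right_zero, subst Bochner_Integration.integral_sum) (use i4 in auto)
    also have "\<dots> \<le> r * (\<Sum>k\<le>N. \<integral>x. w k x * (h x)\<^sup>2 \<partial>cantor)"
      using r by (intro mult_left_mono sum_mono integral_mult_sum_mdiff_sq_le adw w0 h) auto
    also have "\<dots> = r * (\<integral>x. A N x powr (r - 1) * (h x)\<^sup>2 \<partial>cantor)"
      by (subst Bochner_Integration.integral_sum[symmetric]) (use i5 in \<open>auto simp: sum_distrib_right[symmetric] wsum\<close>)
    also have "\<dots> \<le> r * (\<integral>x. e * A N x powr r + K * ((h x)\<^sup>2) powr r \<partial>cantor)"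
    proof (intro mult_left_mono integral_mono[OF iAh])
      show "A N x powr (r - 1) * (h x)\<^sup>2 \<le> e * A N x powr r + K * ((h x)\<^sup>2) powr r" for x
        using powr_mult_le_eps[of "A N x" "(h x)\<^sup>2" e "r - 1" 1] r e A0 by (simp add: K_def)
    qed (use iA ih2 r in auto)
    also have "\<dots> = r * e * (\<integral>x. A N x powr r \<partial>cantor) + r * K * (\<integral>x. ((h x)\<^sup>2) powr r \<partial>cantor)"
      using iA ih2 by (simp add: distrib_left)
    finally show ?thesis
      using r by (simp add: e_def A_def)
  qed
  moreover have "0 < 2 * r * K" using r K by simp
  ultimately show thesis using that by blast
qed

text \<open>Duality: pair \<open>mpart f N\<close> with its own power and move the differences onto that power.\<close>
lemma mpart_Lp_below_2:
  assumes p: "1 < (p::real)" "p < 2"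
  obtains C where "\<And>f F N. dominated f F \<Longrightarrow> integrable cantor (\<lambda>x. F x powr p) \<Longrightarrow>
    (\<integral>x. \<bar>mpart f N x\<bar> powr p \<partial>cantor) \<le> C * (\<integral>x. F x powr p \<partial>cantor)"
proof -
  \<comment> \<open>Half of the exponent conjugate to \<open>p\<close>, because the square function
    bound is stated for squares; \<open>r > 1\<close> is exactly \<open>p < 2\<close>.\<close>
  define r where "r = p / (2 * (p - 1))"
  have r: "1 < r" using p by (simp add: r_def field_simps)
  obtain C where C: "0 < C" "\<And>N h. adapted N h \<Longrightarrow>
    (\<integral>x. (\<Sum>n\<le>N. (mdiff n h x)\<^sup>2) powr r \<partial>cantor) \<le> C * (\<integral>x. ((h x)\<^sup>2) powr r \<partial>cantor)"
    using square_function_bound[OF r] by blast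
  \<comment> \<open>After the square function bound the coefficient of the left side becomes
    \<open>e * C\<close>, that is 1/2.\<close>
  define e where "e = 1 / (2 * C)"
  have e: "0 < e" using C by (simp add: e_def)
  define K where "K = e powr (- (p - 1))"
  have "(\<integral>x. \<bar>mpart f N x\<bar> powr p \<partial>cantor) \<le> (2 * K) * (\<integral>x. F x powr p \<partial>cantor)"
    if fF: "dominated f F" and Fp: "integrable cantor (\<lambda>x. F x powr p)" for f F N
  proof -
    have F: "integrable cantor F" "\<And>x. 0 \<le> F x" using fF by (auto simp: dominated_def)
    have fi: "integrable cantor (f n)" for n by (rule dominated_integrable[OF fF])
    let ?S = "mpart f N"
    define h where "h x = sgn (?S x) * \<bar>?S x\<bar> powr (p - 1)" for x
    have h: "adapted N h"
      unfolding h_def[abs_def] by (intro adapted_mult adapted_powr adapted_abs adapted_comp[where \<phi>=sgn] adapted_mpart order_refl)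
    have ih: "integrable cantor h" using h by (rule adapted_integrable)
    have Sh: "\<bar>?S x\<bar> powr p = (\<Sum>n\<le>N. h x * mdiff n (f n) x)" for x
    proof -
      have "(\<Sum>n\<le>N. h x * mdiff n (f n) x) = h x * ?S x" by (simp add: mpart_def sum_distrib_left)
      also have "\<dots> = \<bar>?S x\<bar> powr (p - 1) * \<bar>?S x\<bar>"
        by (simp add: h_def abs_sgn[of "?S x"] mult_ac)
      also have "\<dots> = \<bar>?S x\<bar> powr p" by (rule powr_mult_self) simp
      finally show ?thesis by simp
    qed
    have h2: "((h x)\<^sup>2) powr r = \<bar>?S x\<bar> powr p" for x
    proof (cases "?S x = 0")
      case False
      have "\<bar>h x\<bar> = \<bar>?S x\<bar> powr (p - 1)" using False by (simp add: h_def abs_mult)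
      then have "(h x)\<^sup>2 = (\<bar>?S x\<bar> powr (p - 1)) powr 2" by (metis power2_abs powr_numeral powr_ge_zero)
      then have "((h x)\<^sup>2) powr r = \<bar>?S x\<bar> powr ((p - 1) * 2 * r)" by (simp add: powr_powr)
      moreover have "(p - 1) * 2 * r = p" using p by (simp add: r_def field_simps)
      ultimately show ?thesis by simp
    qed (simp add: h_def)
    define A where "A x = (\<Sum>n\<le>N. (mdiff n h x)\<^sup>2)" for x
    have A0: "0 \<le> A x" for x by (simp add: A_def sum_nonneg)
    have adA: "adapted N A" unfolding A_def[abs_def] by (intro adapted_sum adapted_power adapted_mdiff) simp
    have iA: "integrable cantor (\<lambda>x. A x powr r)" by (rule adapted_integrable[of N]) (intro adapted_powr adA)
    have iAF: "integrable cantor (\<lambda>x. sqrt (A x) * F x)"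
      by (rule adapted_mult_integrable[OF _ F(1), of N], rule adapted_comp[OF adA])
    have imf: "integrable cantor (\<lambda>x. mdiff n h x * f n x)" for n
      by (rule adapted_mult_integrable[OF adapted_mdiff[OF order_refl] fi])
    have ihm: "integrable cantor (\<lambda>x. h x * mdiff n (f n) x)" for n
      by (rule adapted_mult_integrable[OF h]) simp
    have "(\<integral>x. \<bar>?S x\<bar> powr p \<partial>cantor) = (\<Sum>n\<le>N. \<integral>x. h x * mdiff n (f n) x \<partial>cantor)"
      unfolding Sh by (rule Bochner_Integration.integral_sum[OF ihm])
    also have "\<dots> = (\<Sum>n\<le>N. \<integral>x. mdiff n h x * f n x \<partial>cantor)"
      by (intro sum.cong mdiff_swap ih fi refl)
    also have "\<dots> = (\<integral>x. (\<Sum>n\<le>N. mdiff n h x * f n x) \<partial>cantor)"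
      by (rule Bochner_Integration.integral_sum[OF imf, symmetric])
    also have "\<dots> \<le> (\<integral>x. sqrt (A x) * F x \<partial>cantor)"
    proof (rule integral_mono_AE)
      have "AE x in cantor. \<forall>N. (\<Sum>n\<le>N. (f n x)\<^sup>2) \<le> (F x)\<^sup>2"
        using fF by (simp add: dominated_def)
      then show "AE x in cantor. (\<Sum>n\<le>N. mdiff n h x * f n x) \<le> sqrt (A x) * F x"
      proof eventually_elim
        case (elim x)
        have "(\<Sum>n\<le>N. mdiff n h x * f n x)\<^sup>2 \<le> A x * (\<Sum>n\<le>N. (f n x)\<^sup>2)"
          unfolding A_def by (rule Cauchy_Schwarz_ineq_sum)
        also have "\<dots> \<le> A x * (F x)\<^sup>2" using elim A0 by (intro mult_left_mono) auto
        also have "\<dots> = (sqrt (A x) * F x)\<^sup>2" using A0 by (simp add: power_mult_distrib)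
        finally show ?case
          by (rule power2_le_imp_le) (use F(2) A0 in simp)
      qed
    qed (use imf iAF in auto)
    also have "\<dots> \<le> (\<integral>x. e * A x powr r + K * F x powr p \<partial>cantor)"
    proof (rule integral_mono[OF iAF])
      fix x
      \<comment> \<open>The substitution turns \<open>sqrt (A x)\<close> into
        \<open>a powr (p - 1)\<close> and \<open>A x powr r\<close> into \<open>a powr p\<close>,
        the shape of \<open>powr_mult_le_eps\<close>.\<close>
      define a where "a = A x powr (1 / (2 * (p - 1)))"
      have "1 / (2 * (p - 1)) * (p - 1) = 1 / 2" using p by (simp add: field_simps)
      then have a1: "a powr (p - 1) = sqrt (A x)"
        using A0[of x] by (simp only: a_def powr_powr powr_half_sqrt)
      have a2: "a powr p = A x powr r" by (simp add: a_def powr_powr r_def)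
      show "sqrt (A x) * F x \<le> e * A x powr r + K * F x powr p"
        using powr_mult_le_eps[of a "F x" e "p - 1" 1] p e F(2)[of x] a1 a2
        by (simp add: K_def a_def[symmetric]) (simp add: a_def)
    qed (use iA Fp in simp)
    also have "\<dots> = e * (\<integral>x. A x powr r \<partial>cantor) + K * (\<integral>x. F x powr p \<partial>cantor)"
      using iA Fp by simp
    also have "e * (\<integral>x. A x powr r \<partial>cantor) \<le> e * (C * (\<integral>x. \<bar>?S x\<bar> powr p \<partial>cantor))"
      using C(2)[OF h] e unfolding h2 A_def by (intro mult_left_mono) auto
    also have "\<dots> = (\<integral>x. \<bar>?S x\<bar> powr p \<partial>cantor) / 2" using C(1) by (simp add: e_def)
    finally show ?thesis by simp
  qed
  then show thesis using that by blast
qed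

section \<open>Exponents 2 and above\<close>

lemma integral_sum_sq_le:
  assumes fF: "dominated f F" and F2: "integrable cantor (\<lambda>x. (F x)\<^sup>2)"
  shows "integrable cantor (\<lambda>x. (f n x)\<^sup>2)"
    "(\<Sum>n\<le>N. \<integral>x. (f n x)\<^sup>2 \<partial>cantor) \<le> (\<integral>x. (F x)\<^sup>2 \<partial>cantor)"
proof -
  have [measurable]: "f n \<in> borel_measurable cantor" for n using fF by (auto simp: dominated_def)
  have i: "integrable cantor (\<lambda>x. (f n x)\<^sup>2)" for n
  proof (rule Bochner_Integration.integrable_bound[OF F2])
    show "AE x in cantor. norm ((f n x)\<^sup>2) \<le> norm ((F x)\<^sup>2)"
      using dominated_abs_le[OF fF]
      by eventually_elim (metis abs_ge_zero norm_power power2_abs power_mono real_norm_def order_trans)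
  qed measurable
  then show "integrable cantor (\<lambda>x. (f n x)\<^sup>2)" .
  have "(\<Sum>n\<le>N. \<integral>x. (f n x)\<^sup>2 \<partial>cantor) = (\<integral>x. (\<Sum>n\<le>N. (f n x)\<^sup>2) \<partial>cantor)"
    by (rule Bochner_Integration.integral_sum[OF i, symmetric])
  also have "\<dots> \<le> (\<integral>x. (F x)\<^sup>2 \<partial>cantor)"
    by (rule integral_mono_AE) (use i F2 fF in \<open>auto simp: dominated_def\<close>)
  finally show "(\<Sum>n\<le>N. \<integral>x. (f n x)\<^sup>2 \<partial>cantor) \<le> (\<integral>x. (F x)\<^sup>2 \<partial>cantor)" .
qed

lemma mpart_L2:
  assumes fF: "dominated f F" and F2: "integrable cantor (\<lambda>x. (F x)\<^sup>2)"
  shows "(\<integral>x. (mpart f N x)\<^sup>2 \<partial>cantor) \<le> (\<integral>x. (F x)\<^sup>2 \<partial>cantor)"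
proof -
  have [measurable]: "f n \<in> borel_measurable cantor" for n using fF by (auto simp: dominated_def)
  have "(\<integral>x. (mpart f N x)\<^sup>2 \<partial>cantor) = (\<Sum>k\<le>N. \<integral>x. (mdiff k (f k) x)\<^sup>2 \<partial>cantor)"
    by (rule integral_mpart_sq[OF dominated_integrable[OF fF]])
  also have "\<dots> \<le> (\<Sum>k\<le>N. \<integral>x. (f k x)\<^sup>2 \<partial>cantor)"
    using integral_mult_mdiff_sq_le[of _ "\<lambda>_. 1" "f _"] integral_sum_sq_le(1)[OF fF F2]
    by (intro sum_mono) auto
  also have "\<dots> \<le> (\<integral>x. (F x)\<^sup>2 \<partial>cantor)" by (rule integral_sum_sq_le(2)[OF fF F2])
  finally show ?thesis .
qed

text \<open>Convexity is used twice. The tangent at \<open>1 + t\<close> leaves the excess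
  \<open>p * (t * ((1 + t) powr (p - 1) - 1))\<close>, and convexity of the power
  \<open>p - 1 > 1\<close> makes it quadratic; for negative \<open>t\<close> the factor
  \<open>t\<close> reverses the tangent inequality.\<close>

lemma powr_taylor_1:
  fixes t :: real
  assumes p: "2 < p" and t: "\<bar>t\<bar> \<le> 1"
  shows "(1 + t) powr p \<le> 1 + p * t + p * (p - 1) * 2 powr p * t\<^sup>2"
proof -
  have T: "(1 + t) powr p + p * (1 + t) powr (p - 1) * (1 - (1 + t)) \<le> 1 powr p"
    using p t by (intro powr_tangent) auto
  have bound: "t * ((1 + t) powr (p - 1) - 1) \<le> (p - 1) * 2 powr p * t\<^sup>2"
  proof (cases "0 \<le> t")
    case True
    have "(1 + t) powr (p - 1) + (p - 1) * (1 + t) powr (p - 1 - 1) * (1 - (1 + t)) \<le> 1 powr (p - 1)"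
      using p True by (intro powr_tangent) auto
    then have "(1 + t) powr (p - 1) - 1 \<le> (p - 1) * (1 + t) powr (p - 2) * t" by (simp add: algebra_simps)
    also have "\<dots> \<le> (p - 1) * 2 powr p * t"
    proof (intro mult_right_mono mult_left_mono)
      have "(1 + t) powr (p - 2) \<le> 2 powr (p - 2)" using p t True by (intro powr_mono2) auto
      also have "\<dots> \<le> 2 powr p" by (intro powr_mono) auto
      finally show "(1 + t) powr (p - 2) \<le> 2 powr p" .
    qed (use p True in auto)
    finally have "t * ((1 + t) powr (p - 1) - 1) \<le> t * ((p - 1) * 2 powr p * t)"
      using True by (rule mult_left_mono)
    then show ?thesis by (simp add: power2_eq_square mult_ac)
  next
    case False
    have "1 powr (p - 1) + (p - 1) * 1 powr (p - 1 - 1) * ((1 + t) - 1) \<le> (1 + t) powr (p - 1)"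
      using p t by (intro powr_tangent) auto
    then have "(p - 1) * t \<le> (1 + t) powr (p - 1) - 1" by simp
    then have "t * ((1 + t) powr (p - 1) - 1) \<le> t * ((p - 1) * t)"
      using False by (intro mult_left_mono_neg) auto
    also have "\<dots> = (p - 1) * 1 * t\<^sup>2" by (simp add: power2_eq_square mult_ac)
    also have "\<dots> \<le> (p - 1) * 2 powr p * t\<^sup>2"
      using p by (intro mult_right_mono mult_left_mono) (auto intro!: ge_one_powr_ge_zero)
    finally show ?thesis .
  qed
  have "(1 + t) powr p \<le> 1 + p * t + p * (t * ((1 + t) powr (p - 1) - 1))"
    using T by (simp add: algebra_simps)
  also have "\<dots> \<le> 1 + p * t + p * ((p - 1) * 2 powr p * t\<^sup>2)"
    using bound p by (intro add_left_mono mult_left_mono) auto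
  finally show ?thesis by (simp add: mult_ac)
qed

lemma powr_mult_sq:
  fixes x :: real assumes "2 < p" shows "\<bar>x\<bar> powr (p - 2) * x\<^sup>2 = \<bar>x\<bar> powr p"
proof (cases "x = 0")
  case False
  have "\<bar>x\<bar> powr (p - 2 + 2) = \<bar>x\<bar> powr (p - 2) * \<bar>x\<bar> powr 2" by (rule powr_add)
  then show ?thesis using False by simp
qed simp

text \<open>If \<open>d\<close> dominates, every term is at most a multiple of the
  \<open>p\<close>-th power of its modulus; otherwise dividing by \<open>a\<close> reduces to
  \<open>powr_taylor_1\<close>.\<close>

lemma powr_taylor:
  assumes p: "2 < (p::real)"
  obtains C where "1 \<le> C" "\<And>a d :: real. \<bar>a + d\<bar> powr p \<le>
    \<bar>a\<bar> powr p + p * (sgn a * \<bar>a\<bar> powr (p - 1)) * d + C * ((\<bar>a\<bar> powr (p - 2) + \<bar>d\<bar> powr (p - 2)) * d\<^sup>2)"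
proof -
  define C where "C = 1 + 2 powr p + p + p * (p - 1) * 2 powr p"
  have C1: "1 \<le> C" using p by (simp add: C_def)
  have "\<bar>a + d\<bar> powr p \<le> \<bar>a\<bar> powr p + p * (sgn a * \<bar>a\<bar> powr (p - 1)) * d
      + C * ((\<bar>a\<bar> powr (p - 2) + \<bar>d\<bar> powr (p - 2)) * d\<^sup>2)" for a d :: real
  proof (cases "\<bar>a\<bar> \<le> \<bar>d\<bar>")
    case True
    have "\<bar>a + d\<bar> powr p \<le> (2 * \<bar>d\<bar>) powr p" using p True by (intro powr_mono2) auto
    then have 1: "\<bar>a + d\<bar> powr p \<le> 2 powr p * \<bar>d\<bar> powr p" by (simp add: powr_mult)
    have "\<bar>(sgn a * \<bar>a\<bar> powr (p - 1)) * d\<bar> \<le> \<bar>d\<bar> powr (p - 1) * \<bar>d\<bar>"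
      using p True by (auto simp: abs_mult abs_sgn_eq intro!: mult_right_mono powr_mono2)
    also have "\<dots> = \<bar>d\<bar> powr p" by (rule powr_mult_self) simp
    finally have "- (\<bar>d\<bar> powr p) \<le> (sgn a * \<bar>a\<bar> powr (p - 1)) * d" by linarith
    then have "p * (- (\<bar>d\<bar> powr p)) \<le> p * ((sgn a * \<bar>a\<bar> powr (p - 1)) * d)"
      using p by (intro mult_left_mono) auto
    then have 2: "- (p * \<bar>d\<bar> powr p) \<le> p * (sgn a * \<bar>a\<bar> powr (p - 1)) * d" by (simp add: mult_ac)
    have "(2 powr p + p) * \<bar>d\<bar> powr p \<le> C * \<bar>d\<bar> powr p"
      using p by (intro mult_right_mono) (auto simp: C_def)
    also have "\<dots> = C * (\<bar>d\<bar> powr (p - 2) * d\<^sup>2)" by (simp only: powr_mult_sq[OF p])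
    also have "\<dots> \<le> C * ((\<bar>a\<bar> powr (p - 2) + \<bar>d\<bar> powr (p - 2)) * d\<^sup>2)"
      using C1 by (intro mult_left_mono mult_right_mono) auto
    finally have 3: "2 powr p * \<bar>d\<bar> powr p + p * \<bar>d\<bar> powr p \<le> C * ((\<bar>a\<bar> powr (p - 2) + \<bar>d\<bar> powr (p - 2)) * d\<^sup>2)"
      by (simp add: distrib_right)
    have 4: "0 \<le> \<bar>a\<bar> powr p" by simp
    show ?thesis using 1 2 3 4 by linarith
  next
    case False
    then have a: "a \<noteq> 0" by auto
    define t where "t = d / a"
    have t: "\<bar>t\<bar> \<le> 1" using False a by (simp add: t_def)
    have d: "d = a * t" using a by (simp add: t_def)
    have "a + d = a * (1 + t)" by (simp add: d distrib_left)
    moreover have "\<bar>1 + t\<bar> = 1 + t" using t by linarith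
    ultimately have "\<bar>a + d\<bar> = \<bar>a\<bar> * (1 + t)" by (simp only: abs_mult)
    then have "\<bar>a + d\<bar> powr p = \<bar>a\<bar> powr p * (1 + t) powr p" using t by (simp add: powr_mult)
    also have "\<dots> \<le> \<bar>a\<bar> powr p * (1 + p * t + p * (p - 1) * 2 powr p * t\<^sup>2)"
      by (intro mult_left_mono powr_taylor_1 p t) auto
    also have "\<dots> = \<bar>a\<bar> powr p + p * (\<bar>a\<bar> powr p * t) + p * (p - 1) * 2 powr p * (\<bar>a\<bar> powr p * t\<^sup>2)"
      by (simp add: algebra_simps)
    also have "\<bar>a\<bar> powr p * t = (sgn a * \<bar>a\<bar> powr (p - 1)) * d"
    proof -
      have "\<bar>a\<bar> powr p = \<bar>a\<bar> powr (p - 1) * \<bar>a\<bar>" by (rule powr_mult_self[symmetric]) simp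
      also have "\<bar>a\<bar> powr (p - 1) * \<bar>a\<bar> = \<bar>a\<bar> powr (p - 1) * (sgn a * a)" by (simp add: sgn_if)
      finally show ?thesis by (simp only: d mult_ac)
    qed
    also have "\<bar>a\<bar> powr p * t\<^sup>2 = \<bar>a\<bar> powr (p - 2) * d\<^sup>2"
      using powr_mult_sq[OF p, of a] by (simp add: d power_mult_distrib mult_ac)
    also have "p * (p - 1) * 2 powr p * (\<bar>a\<bar> powr (p - 2) * d\<^sup>2)
        \<le> C * ((\<bar>a\<bar> powr (p - 2) + \<bar>d\<bar> powr (p - 2)) * d\<^sup>2)"
      using p by (intro mult_mono mult_right_mono) (auto simp: C_def)
    finally show ?thesis by (simp add: mult_ac)
  qed
  then show thesis using that C1 by blast
qed

text \<open>Taylor expansion along the martingale: the first order terms integrate to zero, and the second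
  order terms are controlled by \<open>M powr (p - 2) * F\<^sup>2\<close>, where \<open>M\<close> is the maximal function.\<close>
lemma mpart_Lp_above_2:
  assumes p: "2 < (p::real)"
  obtains C where "\<And>f F N. dominated f F \<Longrightarrow> integrable cantor (\<lambda>x. F x powr p) \<Longrightarrow>
    (\<integral>x. \<bar>mpart f N x\<bar> powr p \<partial>cantor) \<le> C * (\<integral>x. F x powr p \<partial>cantor)"
proof -
  obtain C where C: "1 \<le> C" "\<And>a d :: real. \<bar>a + d\<bar> powr p \<le>
    \<bar>a\<bar> powr p + p * (sgn a * \<bar>a\<bar> powr (p - 1)) * d + C * ((\<bar>a\<bar> powr (p - 2) + \<bar>d\<bar> powr (p - 2)) * d\<^sup>2)"
    using powr_taylor[OF p] by blast
  obtain D where D: "0 < D"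
    "\<And>N Y. adapted N Y \<Longrightarrow> (\<integral>x. runmax (\<lambda>k. avg k Y) N x powr p \<partial>cantor) \<le> D * (\<integral>x. \<bar>Y x\<bar> powr p \<partial>cantor)"
    by (rule doob_maximal[of p]) (use p in auto)
  \<comment> \<open>The Taylor constant times the factor by which the weights \<open>W\<close> may
    exceed the power of the maximal function.\<close>
  define L where "L = C * (1 + 2 powr (p - 2))"
  have L: "0 < L" using C by (simp add: L_def add_pos_nonneg)
  \<comment> \<open>Doob's inequality contributes \<open>D\<close>, so \<open>L * e * D\<close> is
    1/2.\<close>
  define e where "e = 1 / (2 * L * D)"
  have e: "0 < e" using L D by (simp add: e_def)
  define K where "K = e powr (- (p - 2) / 2)"
  have "(\<integral>x. \<bar>mpart f N x\<bar> powr p \<partial>cantor) \<le> (2 * L * K) * (\<integral>x. F x powr p \<partial>cantor)"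
    if fF: "dominated f F" and Fp: "integrable cantor (\<lambda>x. F x powr p)" for f F N
  proof -
    have F: "integrable cantor F" "\<And>x. 0 \<le> F x" using fF by (auto simp: dominated_def)
    have [measurable]: "F \<in> borel_measurable cantor" using F by auto
    have [measurable]: "f n \<in> borel_measurable cantor" for n using fF by (auto simp: dominated_def)
    have fi: "integrable cantor (f n)" for n by (rule dominated_integrable[OF fF])
    have F2: "integrable cantor (\<lambda>x. (F x)\<^sup>2)"
    proof (rule Bochner_Integration.integrable_bound[of _ "\<lambda>x. 1 + F x powr p"])
      show "AE x in cantor. norm ((F x)\<^sup>2) \<le> norm (1 + F x powr p)"
      proof (rule AE_I2)
        fix x
        have "(F x)\<^sup>2 \<le> 1 + F x powr p"
        proof (cases "F x \<le> 1")
          case True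
          then have "(F x)\<^sup>2 \<le> 1" using F(2)[of x] by (simp add: power_le_one)
          then show ?thesis by (smt (verit) powr_ge_zero)
        next
          case False
          then have "F x powr 2 \<le> F x powr p" using p by (intro powr_mono) auto
          then show ?thesis using False by simp
        qed
        then show "norm ((F x)\<^sup>2) \<le> norm (1 + F x powr p)" by simp
      qed
    qed (use Fp in auto)
    note f2 = integral_sum_sq_le(1)[OF fF F2]
    let ?S = "\<lambda>n. mpart f n" and ?d = "\<lambda>n. mdiff n (f n)"
    define M where "M = runmax (\<lambda>k. avg k (?S N)) N"
    have adM: "adapted N M" unfolding M_def by (rule adapted_runmax) simp
    have M0: "0 \<le> M x" for x unfolding M_def by (rule runmax_nonneg)
    have SM: "\<bar>?S n x\<bar> \<le> M x" if "n \<le> N" for n x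
      using runmax_ge[OF that, of "\<lambda>k. avg k (?S N)" x] by (simp add: M_def avg_mpart[OF fi that])
    \<comment> \<open>The second order weight of the expansion: the previous sum and the modulus of
      the current difference both depend on \<open>n - 1\<close> coordinates. At
      \<open>n = 0\<close> there is no previous sum.\<close>
    define W where "W n x = (if n = 0 then 0 else \<bar>?S (n - 1) x\<bar> powr (p - 2)) + \<bar>?d n x\<bar> powr (p - 2)" for n x
    have W0: "0 \<le> W n x" for n x by (simp add: W_def)
    have adW: "adapted (n - 1) (W n)" for n
    proof -
      have "adapted (n - 1) (\<lambda>x. (if n = 0 then 0 else \<bar>?S (n - 1) x\<bar> powr (p - 2)))"
        by (cases "n = 0") (auto intro!: adapted_powr adapted_abs)
      then show ?thesis
        unfolding W_def[abs_def] by (intro adapted_add adapted_powr adapted_abs_mdiff fi)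
    qed
    have WM: "W n x \<le> (1 + 2 powr (p - 2)) * M x powr (p - 2)" if "n \<le> N" for n x
    proof -
      have "\<bar>?d n x\<bar> \<le> 2 * M x"
      proof (cases n)
        case 0
        then have "?d n x = ?S n x" by (simp add: mpart_def)
        then show ?thesis using SM[OF that, of x] M0[of x] by simp
      next
        case (Suc m)
        then have "?d n x = ?S n x - ?S m x" by (simp add: mpart_def)
        then show ?thesis using SM[OF that, of x] SM[of m x] Suc that by simp
      qed
      then have "\<bar>?d n x\<bar> powr (p - 2) \<le> (2 * M x) powr (p - 2)" using p by (intro powr_mono2) auto
      also have "\<dots> = 2 powr (p - 2) * M x powr (p - 2)" by (simp add: powr_mult M0)
      finally have 1: "\<bar>?d n x\<bar> powr (p - 2) \<le> 2 powr (p - 2) * M x powr (p - 2)" .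
      have 2: "(if n = 0 then 0 else \<bar>?S (n - 1) x\<bar> powr (p - 2)) \<le> M x powr (p - 2)"
        using p that SM[of "n - 1" x] by (auto intro!: powr_mono2)
      show ?thesis using 1 2 by (simp add: W_def distrib_right)
    qed
    have iSp: "integrable cantor (\<lambda>x. \<bar>?S n x\<bar> powr p)" for n
      by (rule adapted_integrable[of n]) (intro adapted_powr adapted_abs adapted_mpart order_refl)
    have iWd: "integrable cantor (\<lambda>x. W n x * (?d n x)\<^sup>2)" for n
      by (rule adapted_integrable[of n]) (intro adapted_mult adapted_power adapted_mdiff order_refl adapted_mono[OF adW diff_le_self])
    have ito: "(\<integral>x. \<bar>?S n x\<bar> powr p \<partial>cantor) \<le> C * (\<Sum>k\<le>n. \<integral>x. W k x * (?d k x)\<^sup>2 \<partial>cantor)" for n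
    proof (induction n)
      case 0
      have "\<bar>?S 0 x\<bar> powr p = W 0 x * (?d 0 x)\<^sup>2" for x
        by (simp add: W_def mpart_def powr_mult_sq[OF p])
      then have "(\<integral>x. \<bar>?S 0 x\<bar> powr p \<partial>cantor) = 1 * (\<integral>x. W 0 x * (?d 0 x)\<^sup>2 \<partial>cantor)" by simp
      also have "\<dots> \<le> C * (\<integral>x. W 0 x * (?d 0 x)\<^sup>2 \<partial>cantor)"
        using C(1) W0 by (intro mult_right_mono Bochner_Integration.integral_nonneg) auto
      finally show ?case by simp
    next
      case (Suc n)
      let ?u = "\<lambda>x. p * (sgn (?S n x) * \<bar>?S n x\<bar> powr (p - 1))"
      have adu: "adapted n ?u"
        by (intro adapted_mult adapted_const adapted_powr adapted_abs adapted_comp[where \<phi>=sgn] adapted_mpart order_refl)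
      have iu: "integrable cantor (\<lambda>x. ?u x * ?d (Suc n) x)"
        by (rule adapted_mult_integrable[OF adu]) simp
      have "(\<integral>x. \<bar>?S (Suc n) x\<bar> powr p \<partial>cantor)
          \<le> (\<integral>x. \<bar>?S n x\<bar> powr p + ?u x * ?d (Suc n) x + C * (W (Suc n) x * (?d (Suc n) x)\<^sup>2) \<partial>cantor)"
      proof (rule integral_mono[OF iSp])
        show "\<bar>?S (Suc n) x\<bar> powr p \<le> \<bar>?S n x\<bar> powr p + ?u x * ?d (Suc n) x + C * (W (Suc n) x * (?d (Suc n) x)\<^sup>2)" for x
          using C(2)[of "?S n x" "?d (Suc n) x"] by (simp add: W_def mpart_def)
      qed (use iSp iu iWd in auto)
      also have "\<dots> = (\<integral>x. \<bar>?S n x\<bar> powr p \<partial>cantor) + (\<integral>x. ?u x * ?d (Suc n) x \<partial>cantor) + C * (\<integral>x. W (Suc n) x * (?d (Suc n) x)\<^sup>2 \<partial>cantor)"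
        using iSp[of n] iu iWd[of "Suc n"] by simp
      also have "(\<integral>x. ?u x * ?d (Suc n) x \<partial>cantor) = 0"
        using adu by (intro integral_mult_mdiff_zero fi) auto
      finally show ?case using Suc by (simp add: distrib_left)
    qed
    have adMp: "adapted N (\<lambda>x. M x powr s)" for s by (intro adapted_powr adM)
    have iMp: "integrable cantor (\<lambda>x. M x powr p)" by (rule adapted_integrable[OF adMp])
    have iMf: "integrable cantor (\<lambda>x. M x powr (p - 2) * (f n x)\<^sup>2)" for n
      by (rule adapted_mult_integrable[OF adMp f2])
    have iMF: "integrable cantor (\<lambda>x. M x powr (p - 2) * (F x)\<^sup>2)"
      by (rule adapted_mult_integrable[OF adMp F2])
    let ?c = "1 + 2 powr (p - 2)"
    have "(\<integral>x. \<bar>?S N x\<bar> powr p \<partial>cantor) \<le> C * (\<Sum>k\<le>N. \<integral>x. W k x * (?d k x)\<^sup>2 \<partial>cantor)"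
      by (rule ito)
    also have "\<dots> \<le> C * (\<Sum>k\<le>N. ?c * (\<integral>x. M x powr (p - 2) * (f k x)\<^sup>2 \<partial>cantor))"
    proof (intro mult_left_mono sum_mono)
      fix k assume k: "k \<in> {..N}"
      \<comment> \<open>The order matters: the difference is dropped while the weight is still
        predictable, and only then is the weight replaced by the maximal function, which is
        not.\<close>
      have "(\<integral>x. W k x * (?d k x)\<^sup>2 \<partial>cantor) \<le> (\<integral>x. W k x * (f k x)\<^sup>2 \<partial>cantor)"
        by (rule integral_mult_mdiff_sq_le[OF adW W0 _ f2]) measurable
      also have "\<dots> \<le> (\<integral>x. ?c * (M x powr (p - 2) * (f k x)\<^sup>2) \<partial>cantor)"
      proof (rule integral_mono[OF adapted_mult_integrable[OF adW f2]])
        show "W k x * (f k x)\<^sup>2 \<le> ?c * (M x powr (p - 2) * (f k x)\<^sup>2)" for x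
          using mult_right_mono[OF WM[of k x], of "(f k x)\<^sup>2"] k by (simp add: mult_ac)
      qed (use iMf in simp)
      finally show "(\<integral>x. W k x * (?d k x)\<^sup>2 \<partial>cantor) \<le> ?c * (\<integral>x. M x powr (p - 2) * (f k x)\<^sup>2 \<partial>cantor)"
        by simp
    qed (use C(1) in simp)
    also have "\<dots> = L * (\<integral>x. (\<Sum>k\<le>N. M x powr (p - 2) * (f k x)\<^sup>2) \<partial>cantor)"
      by (subst Bochner_Integration.integral_sum[OF iMf]) (simp add: L_def sum_distrib_left mult_ac)
    also have "\<dots> \<le> L * (\<integral>x. M x powr (p - 2) * (F x)\<^sup>2 \<partial>cantor)"
    proof (intro mult_left_mono integral_mono_AE)
      have "AE x in cantor. \<forall>N. (\<Sum>n\<le>N. (f n x)\<^sup>2) \<le> (F x)\<^sup>2"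
        using fF by (simp add: dominated_def)
      then show "AE x in cantor. (\<Sum>k\<le>N. M x powr (p - 2) * (f k x)\<^sup>2) \<le> M x powr (p - 2) * (F x)\<^sup>2"
        by eventually_elim (simp add: sum_distrib_left[symmetric] mult_left_mono)
    qed (use iMf iMF L in auto)
    also have "\<dots> \<le> L * (\<integral>x. e * M x powr p + K * F x powr p \<partial>cantor)"
    proof (intro mult_left_mono integral_mono[OF iMF])
      show "M x powr (p - 2) * (F x)\<^sup>2 \<le> e * M x powr p + K * F x powr p" for x
        using powr_mult_le_eps[of "M x" "F x" e "p - 2" 2] p e F(2)[of x] M0[of x]
        by (simp add: K_def)
    qed (use iMp Fp L in auto)
    also have "\<dots> = L * e * (\<integral>x. M x powr p \<partial>cantor) + L * K * (\<integral>x. F x powr p \<partial>cantor)"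
      using iMp Fp by (simp add: distrib_left)
    also have "L * e * (\<integral>x. M x powr p \<partial>cantor) \<le> L * e * (D * (\<integral>x. \<bar>?S N x\<bar> powr p \<partial>cantor))"
      using D(2)[of N "?S N"] L e unfolding M_def by (intro mult_left_mono) auto
    also have "\<dots> = (\<integral>x. \<bar>?S N x\<bar> powr p \<partial>cantor) / 2" using L D(1) by (simp add: e_def)
    finally show ?thesis by simp
  qed
  then show thesis using that by blast
qed

lemma mpart_Lp:
  assumes p: "1 < (p::real)"
  obtains C where "\<And>f F N. dominated f F \<Longrightarrow> integrable cantor (\<lambda>x. F x powr p) \<Longrightarrow>
    (\<integral>x. \<bar>mpart f N x\<bar> powr p \<partial>cantor) \<le> C * (\<integral>x. F x powr p \<partial>cantor)"
proof -
  consider "p < 2" | "p = 2" | "2 < p" by linarith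
  then show thesis
  proof cases
    case 1 then show ?thesis using mpart_Lp_below_2[OF p] that by blast
  next
    case 2
    have "(\<integral>x. \<bar>mpart f N x\<bar> powr p \<partial>cantor) \<le> 1 * (\<integral>x. F x powr p \<partial>cantor)"
      if "dominated f F" "integrable cantor (\<lambda>x. F x powr p)" for f F N
    proof -
      have "\<And>x. 0 \<le> F x" using that by (auto simp: dominated_def)
      then show ?thesis using mpart_L2[of f F N] that 2 by simp
    qed
    then show ?thesis by (rule that)
  next
    case 3 then show ?thesis using mpart_Lp_above_2 that by blast
  qed
qed

section \<open>The principal value operator\<close>

text \<open>The total mass is 1, so \<open>F \<le> 1 + F powr p\<close> gives integrability of
  \<open>F\<close> itself; the modulus in \<open>F\<close> secures nonnegativity at points where the
  series diverges.\<close>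

lemma in_Lp_l2_dominated:
  assumes f: "in_Lp_l2 p f" and p: "1 \<le> p"
  obtains F where "dominated (\<lambda>n z. f z n) F" "integrable cantor (\<lambda>x. F x powr p)"
    "Lp_l2_pow p f = ennreal (\<integral>x. F x powr p \<partial>cantor)"
proof -
  have [measurable]: "(\<lambda>x. f x n) \<in> borel_measurable cantor" for n
    using f by (simp add: in_Lp_l2_def)
  have sm: "AE x in cantor. summable (\<lambda>n. (f x n)\<^sup>2)" and fin: "Lp_l2_pow p f < \<infinity>"
    using f by (auto simp: in_Lp_l2_def)
  define F where "F x = \<bar>l2norm (f x)\<bar>" for x
  have [measurable]: "F \<in> borel_measurable cantor"
    unfolding F_def l2norm_def by measurable
  have F0: "0 \<le> F x" for x by (simp add: F_def)
  have F2: "AE x in cantor. (F x)\<^sup>2 = (\<Sum>n. (f x n)\<^sup>2)"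
    using sm by eventually_elim (simp add: F_def l2norm_def suminf_nonneg)
  have "AE x in cantor. F x = l2norm (f x)"
    using sm by eventually_elim (simp add: F_def l2norm_def suminf_nonneg)
  then have eq: "Lp_l2_pow p f = (\<integral>\<^sup>+ x. ennreal (F x powr p) \<partial>cantor)"
    unfolding Lp_l2_pow_def by (intro nn_integral_cong_AE) (auto elim!: eventually_mono)
  have iFp: "integrable cantor (\<lambda>x. F x powr p)"
    using fin by (intro integrableI_nonneg) (auto simp: eq)
  have iF: "integrable cantor F"
  proof (rule Bochner_Integration.integrable_bound[of _ "\<lambda>x. 1 + F x powr p"])
    show "AE x in cantor. norm (F x) \<le> norm (1 + F x powr p)"
    proof (rule AE_I2)
      fix x
      have "F x \<le> 1 + F x powr p"
      proof (cases "F x \<le> 1")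
        case False
        then have "F x powr 1 \<le> F x powr p" using p by (intro powr_mono) auto
        then show ?thesis using False by simp
      qed (simp add: add_increasing2)
      then show "norm (F x) \<le> norm (1 + F x powr p)" using F0[of x] by simp
    qed
  qed (use iFp in auto)
  have "AE x in cantor. \<forall>N. (\<Sum>n\<le>N. (f x n)\<^sup>2) \<le> (F x)\<^sup>2"
    using sm F2
  proof eventually_elim
    case (elim x)
    then show ?case by (auto intro!: sum_le_suminf)
  qed
  then have "dominated (\<lambda>n z. f z n) F"
    using iF F0 by (auto simp: dominated_def)
  moreover have "Lp_l2_pow p f = ennreal (\<integral>x. F x powr p \<partial>cantor)"
    unfolding eq using iFp by (intro nn_integral_eq_integral) auto
  ultimately show thesis using that iFp by blast
qed

text \<open>A limit along the integers of the partial sums rather than of the truncations, which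
  makes measurability immediate; the vanishing remainder identifies it with the principal value
  almost everywhere.\<close>

definition pv :: "((nat \<Rightarrow> bool) \<Rightarrow> nat \<Rightarrow> real) \<Rightarrow> (nat \<Rightarrow> bool) \<Rightarrow> real" where
  "pv f x = lim (\<lambda>N. mpart (\<lambda>n z. f z n) N x)"

lemma pv_measurable [measurable]: "pv f \<in> borel_measurable cantor"
  unfolding pv_def[abs_def] by measurable

lemma mpart_tendsto_pv_AE:
  assumes "dominated (\<lambda>n z. f z n) F"
  shows "AE x in cantor. (\<lambda>N. mpart (\<lambda>n z. f z n) N x) \<longlonglongrightarrow> pv f x"
  using mpart_convergent_AE[OF assms] by eventually_elim (simp add: pv_def convergent_LIMSEQ_iff)

lemma pv_to_pv_AE:
  assumes "dominated (\<lambda>n z. f z n) F"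
  shows "AE x in cantor. pv_to f x (pv f x)"
  using mpart_tendsto_pv_AE[OF assms] rem_tendsto_0_AE[OF assms]
proof eventually_elim
  case (elim x)
  have "(\<lambda>N. mpart (\<lambda>n z. f z n) N x - rem (\<lambda>n z. f z n) N x) \<longlonglongrightarrow> pv f x - 0"
    by (rule tendsto_diff[OF elim])
  then show ?case
    using dominated_integrable[OF assms] by (intro pv_to_from_sequence) auto
qed

text \<open>\<open>K0\<close> admits bounds that hold only from some index on, as for differences
  from a fixed partial sum.\<close>

lemma nn_integral_le_of_AE_limit:
  fixes u :: "nat \<Rightarrow> 'a \<Rightarrow> real"
  assumes [measurable]: "\<And>K. u K \<in> borel_measurable M"
    and lim: "AE x in M. (\<lambda>K. u K x) \<longlonglongrightarrow> v x"
    and le: "\<And>K. K0 \<le> K \<Longrightarrow> (\<integral>\<^sup>+ x. ennreal (u K x) \<partial>M) \<le> c"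
  shows "(\<integral>\<^sup>+ x. ennreal (v x) \<partial>M) \<le> c"
proof -
  have "(\<integral>\<^sup>+ x. ennreal (v x) \<partial>M) = (\<integral>\<^sup>+ x. liminf (\<lambda>K. ennreal (u K x)) \<partial>M)"
    using lim
    by (intro nn_integral_cong_AE) (auto elim!: eventually_mono intro!: lim_imp_Liminf[symmetric] tendsto_ennrealI)
  also have "\<dots> \<le> liminf (\<lambda>K. \<integral>\<^sup>+ x. ennreal (u K x) \<partial>M)"
    by (rule nn_integral_liminf) measurable
  also have "\<dots> \<le> limsup (\<lambda>K. \<integral>\<^sup>+ x. ennreal (u K x) \<partial>M)"
    by (rule Liminf_le_Limsup) simp
  also have "\<dots> \<le> c"
    by (rule Limsup_bounded) (use le in \<open>auto simp: eventually_sequentially\<close>)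
  finally show ?thesis .
qed

lemma mpart_diff_L2:
  assumes fF: "dominated f F" and F2: "integrable cantor (\<lambda>x. (F x)\<^sup>2)" and "M \<le> K"
  shows "(\<integral>x. (mpart f K x - mpart f M x)\<^sup>2 \<partial>cantor) \<le> (\<Sum>k=Suc M..K. \<integral>x. (f k x)\<^sup>2 \<partial>cantor)"
proof (cases "M = K")
  case False
  have [measurable]: "f n \<in> borel_measurable cantor" for n using fF by (auto simp: dominated_def)
  have "mpart f K x - mpart f M x = (\<Sum>k=Suc M..K. mdiff k (f k) x)" for x
  proof -
    have "{..K} = {..M} \<union> {Suc M..K}" using \<open>M \<le> K\<close> by auto
    then have "mpart f K x = mpart f M x + (\<Sum>k=Suc M..K. mdiff k (f k) x)"
      unfolding mpart_def by (simp only:) (rule sum.union_disjoint, auto)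
    then show ?thesis by simp
  qed
  then have "(\<integral>x. (mpart f K x - mpart f M x)\<^sup>2 \<partial>cantor) = (\<Sum>k=Suc M..K. \<integral>x. (mdiff k (f k) x)\<^sup>2 \<partial>cantor)"
    using integral_sum_mdiff_sq[OF dominated_integrable[OF fF], of "Suc M" K] False \<open>M \<le> K\<close> by simp
  also have "\<dots> \<le> (\<Sum>k=Suc M..K. \<integral>x. (f k x)\<^sup>2 \<partial>cantor)"
    using integral_mult_mdiff_sq_le[of _ "\<lambda>_. 1" "f _"] integral_sum_sq_le(1)[OF fF F2]
    by (intro sum_mono) auto
  finally show ?thesis .
qed simp

text \<open>Orthogonality bounds the distance between two partial sums by a tail of the convergent
  series of square integrals \<open>a n\<close>; Fatou's lemma in the larger index transfers this to
  \<open>pv f\<close>.\<close>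

lemma pv_L2:
  assumes "in_Lp_l2 2 f"
  shows "(\<lambda>N. \<integral>\<^sup>+ x. ennreal ((pv f x - (\<Sum>n<N. Delta n (\<lambda>z. f z n) x))\<^sup>2) \<partial>cantor) \<longlonglongrightarrow> 0"
proof -
  let ?f = "\<lambda>n z. f z n"
  obtain F where fF: "dominated ?f F" and "integrable cantor (\<lambda>x. F x powr 2)"
    by (rule in_Lp_l2_dominated[OF assms]) auto
  moreover have "0 \<le> F x" for x using fF by (simp add: dominated_def)
  ultimately have F2: "integrable cantor (\<lambda>x. (F x)\<^sup>2)" by simp
  define a where "a n = (\<integral>x. (f x n)\<^sup>2 \<partial>cantor)" for n
  have a0: "0 \<le> a n" for n by (simp add: a_def)
  have sa: "summable a"
    using integral_sum_sq_le(2)[OF fF F2] a0 unfolding a_def by (intro bounded_imp_summable)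
  define t where "t M = suminf a - (\<Sum>n<M. a n)" for M
  have t: "t \<longlonglongrightarrow> 0"
  proof -
    have "t \<longlonglongrightarrow> suminf a - suminf a"
      unfolding t_def[abs_def] by (intro tendsto_intros summable_LIMSEQ sa)
    then show ?thesis by simp
  qed
  have t_ge: "(\<Sum>k=Suc M..K. a k) \<le> t (Suc M)" for M K
  proof -
    have "(\<Sum>k<Suc M. a k) + (\<Sum>k=Suc M..K. a k) = (\<Sum>k\<in>{..<Suc M} \<union> {Suc M..K}. a k)"
      by (rule sum.union_disjoint[symmetric]) auto
    also have "\<dots> \<le> suminf a" by (rule sum_le_suminf[OF sa]) (use a0 in auto)
    finally show ?thesis by (simp add: t_def)
  qed
  \<comment> \<open>The sum over \<open>n < Suc M\<close> is \<open>mpart\<close> at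
    \<open>M\<close>; the shift is undone at the end.\<close>
  have bound: "(\<integral>\<^sup>+ x. ennreal ((pv f x - (\<Sum>n<Suc M. Delta n (\<lambda>z. f z n) x))\<^sup>2) \<partial>cantor) \<le> ennreal (t (Suc M))" for M
  proof -
    have "AE x in cantor. \<forall>n. Delta n (\<lambda>z. f z n) x = mdiff n (\<lambda>z. f z n) x"
      using Delta_eq_mdiff[OF dominated_integrable[OF fF]] by (simp add: AE_all_countable)
    then have "(\<integral>\<^sup>+ x. ennreal ((pv f x - (\<Sum>n<Suc M. Delta n (\<lambda>z. f z n) x))\<^sup>2) \<partial>cantor)
        = (\<integral>\<^sup>+ x. ennreal ((pv f x - mpart ?f M x)\<^sup>2) \<partial>cantor)"
      by (intro nn_integral_cong_AE) (auto elim!: eventually_mono simp: mpart_def lessThan_Suc_atMost)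
    also have "\<dots> \<le> ennreal (t (Suc M))"
    proof (rule nn_integral_le_of_AE_limit)
      show "AE x in cantor. (\<lambda>K. (mpart ?f K x - mpart ?f M x)\<^sup>2) \<longlonglongrightarrow> (pv f x - mpart ?f M x)\<^sup>2"
        using mpart_tendsto_pv_AE[OF fF] by eventually_elim (intro tendsto_intros)
      show "(\<integral>\<^sup>+ x. ennreal ((mpart ?f K x - mpart ?f M x)\<^sup>2) \<partial>cantor) \<le> ennreal (t (Suc M))" if "M \<le> K" for K
      proof -
        have "integrable cantor (\<lambda>x. (mpart ?f K x - mpart ?f M x)\<^sup>2)"
          by (rule adapted_integrable[of K]) (intro adapted_power adapted_diff adapted_mpart order_refl that)
        then have "(\<integral>\<^sup>+ x. ennreal ((mpart ?f K x - mpart ?f M x)\<^sup>2) \<partial>cantor)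
            = ennreal (\<integral>x. (mpart ?f K x - mpart ?f M x)\<^sup>2 \<partial>cantor)"
          by (intro nn_integral_eq_integral) auto
        also have "\<dots> \<le> ennreal (t (Suc M))"
          using mpart_diff_L2[OF fF F2 that] t_ge[of M K] by (intro ennreal_leI) (simp add: a_def)
        finally show ?thesis .
      qed
    qed measurable
    finally show ?thesis .
  qed
  have lim: "(\<lambda>M. ennreal (t (Suc M))) \<longlonglongrightarrow> 0"
    using tendsto_ennrealI[OF LIMSEQ_Suc[OF t]] by simp
  have "(\<lambda>M. \<integral>\<^sup>+ x. ennreal ((pv f x - (\<Sum>n<Suc M. Delta n (\<lambda>z. f z n) x))\<^sup>2) \<partial>cantor) \<longlonglongrightarrow> 0"
    by (rule tendsto_sandwich[OF _ _ tendsto_const lim]) (intro always_eventually allI bound zero_le)+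
  then show ?thesis by (rule LIMSEQ_imp_Suc)
qed

text \<open>Where the limit exceeds \<open>lam\<close> in modulus, so does some partial sum, hence
  the maximal estimate applies with the same constant.\<close>

lemma pv_weak_type:
  obtains C :: real where "\<And>f lam. in_Lp_l2 1 f \<Longrightarrow> 0 < lam \<Longrightarrow>
    ennreal lam * emeasure cantor {x \<in> space cantor. \<bar>pv f x\<bar> > lam} \<le> ennreal C * Lp_l2_pow 1 f"
proof -
  obtain C where C: "1 \<le> C" "\<And>f F lam. dominated f F \<Longrightarrow> 0 < lam \<Longrightarrow> {x. \<exists>n. lam < \<bar>mpart f n x\<bar>} \<in> sets cantor"
    "\<And>f F lam. dominated f F \<Longrightarrow> 0 < lam \<Longrightarrow>
    lam * measure cantor {x. \<exists>n. lam < \<bar>mpart f n x\<bar>} \<le> C * (\<integral>x. F x \<partial>cantor)"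
    by (rule weak_type_mpart_sup) blast
  have "ennreal lam * emeasure cantor {x \<in> space cantor. \<bar>pv f x\<bar> > lam} \<le> ennreal C * Lp_l2_pow 1 f"
    if f: "in_Lp_l2 1 f" and lam: "0 < lam" for f lam
  proof -
    let ?f = "\<lambda>n z. f z n"
    obtain F where fF: "dominated ?f F" and L: "Lp_l2_pow 1 f = ennreal (\<integral>x. F x powr 1 \<partial>cantor)"
      by (rule in_Lp_l2_dominated[OF f]) auto
    have F0: "0 \<le> F x" for x using fF by (simp add: dominated_def)
    let ?B = "{x. \<exists>n. lam < \<bar>mpart ?f n x\<bar>}"
    have "emeasure cantor {x \<in> space cantor. \<bar>pv f x\<bar> > lam} \<le> emeasure cantor ?B"
    proof (rule emeasure_mono_AE)
      show "AE x in cantor. x \<in> {x \<in> space cantor. \<bar>pv f x\<bar> > lam} \<longrightarrow> x \<in> ?B"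
        using mpart_tendsto_pv_AE[OF fF]
      proof eventually_elim
        case (elim x)
        show ?case
        proof
          assume "x \<in> {x \<in> space cantor. \<bar>pv f x\<bar> > lam}"
          then have "lam < \<bar>pv f x\<bar>" by simp
          moreover have "(\<lambda>N. \<bar>mpart ?f N x\<bar>) \<longlonglongrightarrow> \<bar>pv f x\<bar>" using elim by (rule tendsto_rabs)
          ultimately have "eventually (\<lambda>N. lam < \<bar>mpart ?f N x\<bar>) sequentially"
            by (intro order_tendstoD)
          then show "x \<in> ?B" by (auto simp: eventually_sequentially)
        qed
      qed
    qed (rule C(2)[OF fF lam])
    then have "ennreal lam * emeasure cantor {x \<in> space cantor. \<bar>pv f x\<bar> > lam} \<le> ennreal lam * emeasure cantor ?B"
      by (rule mult_left_mono) simp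
    also have "\<dots> = ennreal (lam * measure cantor ?B)"
      using lam by (simp add: cantor.emeasure_eq_measure ennreal_mult)
    also have "\<dots> \<le> ennreal (C * (\<integral>x. F x \<partial>cantor))"
      by (rule ennreal_leI[OF C(3)[OF fF lam]])
    also have "\<dots> = ennreal C * Lp_l2_pow 1 f"
      using C(1) F0 by (simp add: L ennreal_mult Bochner_Integration.integral_nonneg)
    finally show ?thesis .
  qed
  then show thesis by (rule that)
qed

lemma pv_strong_type:
  assumes p: "1 < (p::real)"
  obtains C :: real where "\<And>f. in_Lp_l2 p f \<Longrightarrow>
    (\<integral>\<^sup>+ x. ennreal (\<bar>pv f x\<bar> powr p) \<partial>cantor) \<le> ennreal C * Lp_l2_pow p f"
proof -
  obtain C where C: "\<And>f F N. dominated f F \<Longrightarrow> integrable cantor (\<lambda>x. F x powr p) \<Longrightarrow>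
    (\<integral>x. \<bar>mpart f N x\<bar> powr p \<partial>cantor) \<le> C * (\<integral>x. F x powr p \<partial>cantor)"
    by (rule mpart_Lp[OF p]) blast
  have "(\<integral>\<^sup>+ x. ennreal (\<bar>pv f x\<bar> powr p) \<partial>cantor) \<le> ennreal C * Lp_l2_pow p f"
    if f: "in_Lp_l2 p f" for f
  proof -
    let ?f = "\<lambda>n z. f z n"
    obtain F where fF: "dominated ?f F" and Fp: "integrable cantor (\<lambda>x. F x powr p)"
      and L: "Lp_l2_pow p f = ennreal (\<integral>x. F x powr p \<partial>cantor)"
      by (rule in_Lp_l2_dominated[OF f]) (use p in auto)
    have "(\<integral>\<^sup>+ x. ennreal (\<bar>pv f x\<bar> powr p) \<partial>cantor) \<le> ennreal (C * (\<integral>x. F x powr p \<partial>cantor))"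
    proof (rule nn_integral_le_of_AE_limit)
      show "AE x in cantor. (\<lambda>N. \<bar>mpart ?f N x\<bar> powr p) \<longlonglongrightarrow> \<bar>pv f x\<bar> powr p"
        using mpart_tendsto_pv_AE[OF fF]
        by eventually_elim (intro tendsto_powr' tendsto_rabs tendsto_const, use p in auto)
      show "(\<integral>\<^sup>+ x. ennreal (\<bar>mpart ?f N x\<bar> powr p) \<partial>cantor) \<le> ennreal (C * (\<integral>x. F x powr p \<partial>cantor))" for N
      proof -
        have "integrable cantor (\<lambda>x. \<bar>mpart ?f N x\<bar> powr p)"
          by (rule adapted_integrable[of N]) (intro adapted_powr adapted_abs adapted_mpart order_refl)
        then have "(\<integral>\<^sup>+ x. ennreal (\<bar>mpart ?f N x\<bar> powr p) \<partial>cantor) = ennreal (\<integral>x. \<bar>mpart ?f N x\<bar> powr p \<partial>cantor)"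
          by (intro nn_integral_eq_integral) auto
        also have "\<dots> \<le> ennreal (C * (\<integral>x. F x powr p \<partial>cantor))"
          by (rule ennreal_leI[OF C[OF fF Fp]])
        finally show ?thesis .
      qed
    qed measurable
    also have "\<dots> = ennreal C * Lp_l2_pow p f"
      by (simp add: L ennreal_mult'')
    finally show ?thesis .
  qed
  then show thesis by (rule that)
qed

theorem theorem4p12:
  shows
  "(\<forall>f. in_Lp_l2 2 f \<longrightarrow>
      (\<exists>g \<in> borel_measurable cantor.
         (AE x in cantor. pv_to f x (g x)) \<and>
         ((\<lambda>N. \<integral>\<^sup>+ x. ennreal ((g x - (\<Sum>n<N. Delta n (\<lambda>z. f z n) x))\<^sup>2) \<partial>cantor)
            \<longlonglongrightarrow> 0)))
   \<and> (\<exists>C::real. \<forall>f. in_Lp_l2 1 f \<longrightarrow>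
      (\<exists>g \<in> borel_measurable cantor.
         (AE x in cantor. pv_to f x (g x)) \<and>
         (\<forall>lam::real. lam > 0 \<longrightarrow>
            ennreal lam * emeasure cantor {x \<in> space cantor. \<bar>g x\<bar> > lam}
              \<le> ennreal C * Lp_l2_pow 1 f)))
   \<and> (\<forall>p::real. 1 < p \<longrightarrow> (\<exists>C::real. \<forall>f. in_Lp_l2 p f \<longrightarrow>
      (\<exists>g \<in> borel_measurable cantor.
         (AE x in cantor. pv_to f x (g x)) \<and>
         (\<integral>\<^sup>+ x. ennreal (\<bar>g x\<bar> powr p) \<partial>cantor) \<le> ennreal C * Lp_l2_pow p f)))"
proof (intro conjI)
  have pv: "\<exists>F. dominated (\<lambda>n z. f z n) F" if "in_Lp_l2 p f" "1 \<le> p" for p f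
    using in_Lp_l2_dominated[OF that] by blast
  show "\<forall>f. in_Lp_l2 2 f \<longrightarrow>
      (\<exists>g \<in> borel_measurable cantor.
         (AE x in cantor. pv_to f x (g x)) \<and>
         ((\<lambda>N. \<integral>\<^sup>+ x. ennreal ((g x - (\<Sum>n<N. Delta n (\<lambda>z. f z n) x))\<^sup>2) \<partial>cantor)
            \<longlonglongrightarrow> 0))"
    using pv[of 2] pv_to_pv_AE pv_L2 pv_measurable by (meson one_le_numeral)
  obtain C where C: "\<And>f lam. in_Lp_l2 1 f \<Longrightarrow> 0 < lam \<Longrightarrow>
    ennreal lam * emeasure cantor {x \<in> space cantor. \<bar>pv f x\<bar> > lam} \<le> ennreal C * Lp_l2_pow 1 f"
    by (rule pv_weak_type) blast
  show "\<exists>C::real. \<forall>f. in_Lp_l2 1 f \<longrightarrow>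
      (\<exists>g \<in> borel_measurable cantor.
         (AE x in cantor. pv_to f x (g x)) \<and>
         (\<forall>lam::real. lam > 0 \<longrightarrow>
            ennreal lam * emeasure cantor {x \<in> space cantor. \<bar>g x\<bar> > lam}
              \<le> ennreal C * Lp_l2_pow 1 f))"
  proof (intro exI[of _ C] allI impI)
    fix f assume f: "in_Lp_l2 1 f"
    then obtain F where "dominated (\<lambda>n z. f z n) F" using pv[of 1 f] by auto
    then show "\<exists>g \<in> borel_measurable cantor.
         (AE x in cantor. pv_to f x (g x)) \<and>
         (\<forall>lam::real. lam > 0 \<longrightarrow>
            ennreal lam * emeasure cantor {x \<in> space cantor. \<bar>g x\<bar> > lam}
              \<le> ennreal C * Lp_l2_pow 1 f)"
      using C[OF f] pv_to_pv_AE by (intro bexI[of _ "pv f"]) auto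
  qed
  show "\<forall>p::real. 1 < p \<longrightarrow> (\<exists>C::real. \<forall>f. in_Lp_l2 p f \<longrightarrow>
      (\<exists>g \<in> borel_measurable cantor.
         (AE x in cantor. pv_to f x (g x)) \<and>
         (\<integral>\<^sup>+ x. ennreal (\<bar>g x\<bar> powr p) \<partial>cantor) \<le> ennreal C * Lp_l2_pow p f))"
  proof (intro allI impI)
    fix p :: real assume p: "1 < p"
    obtain C where C: "\<And>f. in_Lp_l2 p f \<Longrightarrow>
      (\<integral>\<^sup>+ x. ennreal (\<bar>pv f x\<bar> powr p) \<partial>cantor) \<le> ennreal C * Lp_l2_pow p f"
      by (rule pv_strong_type[OF p]) blast
    show "\<exists>C::real. \<forall>f. in_Lp_l2 p f \<longrightarrow>
      (\<exists>g \<in> borel_measurable cantor.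
         (AE x in cantor. pv_to f x (g x)) \<and>
         (\<integral>\<^sup>+ x. ennreal (\<bar>g x\<bar> powr p) \<partial>cantor) \<le> ennreal C * Lp_l2_pow p f)"
    proof (intro exI[of _ C] allI impI)
      fix f assume f: "in_Lp_l2 p f"
      then obtain F where "dominated (\<lambda>n z. f z n) F" using pv[of p f] p by auto
      then show "\<exists>g \<in> borel_measurable cantor.
         (AE x in cantor. pv_to f x (g x)) \<and>
         (\<integral>\<^sup>+ x. ennreal (\<bar>g x\<bar> powr p) \<partial>cantor) \<le> ennreal C * Lp_l2_pow p f"
        using C[OF f] pv_to_pv_AE by (intro bexI[of _ "pv f"]) auto
    qed
  qed
qed

end
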